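(* Let $\mathcal F$ be the frustum-based lattice geometry approximating the axisymmetric warped-product 3-geometry $g=da^2+\rho(a)^2\,d\Omega^2$ (with $d\Omega^2=d\theta^2+\sin^2\theta\,d\phi^2$) having an arbitrary $C^2$ radial profile $\rho(a,t)$. It is built from $N_a$ triangulated spherical cross sections of radii $\rho_i$, axial edges $a_i$ and infinitesimal resolution parameter $\xi=\ell/\rho$; let $\mathcal F^*$ be its circumcentric dual lattice, all as described in the context. The two dual-edge simplicial Ricci flow (SRF) equations at a vertex $\mathcal O_i$ of $\mathcal F$ are the one for the dual edge $\sigma_i\in\mathcal F^*$ dual to the trapezoid $\overline{\mathcal O_i\mathcal X_i\mathcal O_{i+1}\mathcal X_{i+1}}$ and the one for the dual edge $\alpha_i\in\mathcal F^*$ dual to the triangle $\triangle_{\mathcal O_i\mathcal X_i\mathcal Y_i}$. These equations converge to their continuum Hamilton Ricci flow counterparts, $$\frac{\dot\sigma_i}{\sigma_i}=-Rc_{\sigma_i}\quad\Longrightarrow\quad \frac{\dot\rho}{\rho}=\frac{\rho''}{\rho}+\left(\frac{\rho'}{\rho}\right)^2-\frac{1}{\rho^2},$$ $$\frac{\dot\alpha_i}{\alpha_i}=-Rc_{\alpha_i}\quad\Longrightarrow\quad \frac{\dot a}{a}=2\,\frac{\rho''}{\rho},$$ in the limit when (1) $\xi\to 0$, and (2) $N_a\to\infty$. Here primes denote partial derivatives with respect to the axial distance $a$ and dots denote derivatives with respect to time $t$.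
   Context: **Continuum equations.** Hamilton's Ricci flow is $g^{ac}\dot g_{cb}=-2\,Rc^a{}_b$. For $g=da^2+\rho(a)^2d\Omega^2$, where $a$ is the proper axial distance and $\rho(a)$ is the radius of the cross-sectional 2-sphere at axial distance $a$, the Ricci tensor is diagonal with $Rc^a{}_a=-2\rho''/\rho$ and $Rc^\theta{}_\theta=Rc^\phi{}_\phi=\frac{1}{\rho^2}-\frac{\rho''}{\rho}-\left(\frac{\rho'}{\rho}\right)^2$. The flow equations are $\dot a/a=-Rc^a{}_a$ (rate of change of axial length) and $\dot\rho/\rho=-Rc^\theta{}_\theta$. **Cross-sectional spheres.** Take $N_a$ nearly equally spaced cross-sectional spheres, the $i$-th having radius $\rho_i$. Each is approximated by a triangulated polyhedron; all these polyhedra have the same lattice topology and are congruent to each other up to an overall scale factor. Near a vertex $\mathcal O$ on a sphere of radius $\rho$ and center $\mathcal C$ the triangulation is obtained by projecting from $\mathcal C$ onto the sphere an infinitesimal flat equilateral triangular lattice of edge length $\ell=\rho\,\xi$, tangent at its lattice point $\mathcal O$. Only the 6 triangles around $\mathcal O$ and the next 18 triangles are needed. Adjacent lattice points at planar distance $\ell$ from $\mathcal O$ are called $\mathcal X,\mathcal Y$; $\mathcal V$ is the lattice point at planar distance $\sqrt3\,\ell$ that forms a triangle with $\mathcal X,\mathcal Y$; $\mathcal U$ is the lattice point at planar distance $2\ell$ on the ray $\mathcal O\mathcal X$. The 24 projected triangles are, up to symmetry, $\{\mathcal O,\mathcal X,\mathcal Y\}$, $\{\mathcal V,\mathcal X,\mathcal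 Y\}$ and $\{\mathcal X,\mathcal U,\mathcal V\}$. Edge lengths are the spherical arc lengths ($\rho$ times the angle subtended at $\mathcal C$): - $s=|\mathcal O\mathcal X|=\rho\xi(1-\tfrac13\xi^2+\cdots)$, - $\bar s=|\mathcal X\mathcal Y|=\rho\xi(1-\tfrac{11}{24}\xi^2+\cdots)$, - $u=|\mathcal X\mathcal V|=\rho\xi(1-\tfrac{35}{24}\xi^2+\cdots)$, - $\bar u=|\mathcal U\mathcal V|=\rho\xi(1-\tfrac{11}{6}\xi^2+\cdots)$, - $u'=|\mathcal X\mathcal U|=\rho\xi(1-\tfrac73\xi^2+\cdots)$. The infinitesimal $\xi=\ell/\rho$ is global, the same for all the triangulated sphere cross sections. A subscript $i$ means the quantity on the $i$-th sphere ($\rho=\rho_i$). **Frustum lattice $\mathcal F$.** Corresponding vertices of the $i$-th and $(i+1)$-st polyhedra are joined by axial edges, all of the same length $a_i$. Each pair of corresponding triangles together with three axial edges bounds a triangle-based frustum block with flat Euclidean interior; its top and base triangles are similar, parallel and aligned, and its three lateral faces are planar isosceles trapezoids. The two end polyhedra ($i=1$ and $i=N_a$) are filled in as flat Euclidean end caps, so $\mathcal F$ is a piecewise flat 3-sphere. The SRF equations are functions of the axial edges $a_i$ $(1\le i\le N_a-1)$ and the radii $\rho_i$ $(1\le i\le N_a)$. **Circumcentric dual $\mathcal F^*$.** Each frustum block has a circumcenter. Each 2-face $\lambda^*$ of $\mathcal F$ (triangle or trapezoid) is dual to an edge $\lambda$ of $\mathcal F^*$, which joins the circumcenters of the two polyhedra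 sharing the face, is perpendicular to the face and pierces it at the face's circumcenter; its length is also denoted $\lambda$. The circumcenter of each end cap is the common meeting place of the dual axial edges through its triangles. The dual edge $\alpha_i$ is dual to the triangle $\triangle_{\mathcal O_i\mathcal X_i\mathcal Y_i}$ and joins the circumcenter of the block over this triangle between spheres $i-1$ and $i$ to that of the block between spheres $i$ and $i+1$. The dual edge $\sigma_i$ is dual to the trapezoid $\overline{\mathcal O_i\mathcal X_i\mathcal O_{i+1}\mathcal X_{i+1}}$ and joins the circumcenters of the two blocks between spheres $i$ and $i+1$ sharing that trapezoid. Each edge $\ell$ of $\mathcal F$ is dual to a polygon $\ell^*$ of $\mathcal F^*$; its area, also denoted $\ell^*$, is the sum over the blocks containing $\ell$ of the area of the kite with vertices the midpoint of $\ell$, the circumcenters of the two faces of the block meeting at $\ell$, and the circumcenter of the block. **Dual-edge SRF equations.** For an edge $\ell$ of $\mathcal F$, let $\epsilon_\ell$ be its deficit angle: $2\pi$ minus the sum of the dihedral angles at $\ell$ of the blocks containing $\ell$. For a dual edge $\lambda$ with dual face $\lambda^*$ and an edge $\ell$ of that face, let $m_{\lambda\ell}$ be the moment arm from the midpoint of $\ell$ to the circumcenter of $\lambda^*$, and set $$V_{\lambda\ell}=\tfrac16\,\lambda\,\ell\,m_{\lambda\ell},\qquad V_\lambda=\sum_{\ell\in\lambda^*}V_{\lambda\ell}.$$ The simplicial Ricci curvature along $\lambda$ and the dual-edge SRF equation are $$Rc_\lambda=\sum_{\ell\in\lambda^*}2\,\frac{\epsilon_\ell}{\ell^*}\,\frac{V_{\lambda\ell}}{V_\lambda},\qquad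 \frac{\dot\lambda}{\lambda}=-Rc_\lambda,$$ the sum being over the edges $\ell$ of the face $\lambda^*$. For $\lambda=\alpha_i$ the edges are $\overline{\mathcal O_i\mathcal X_i}$, $\overline{\mathcal O_i\mathcal Y_i}$ (both of length $s_i$) and $\overline{\mathcal X_i\mathcal Y_i}$ (of length $\bar s_i$). For $\lambda=\sigma_i$ the edges are $\overline{\mathcal O_i\mathcal X_i}$ (length $s_i$), $\overline{\mathcal O_{i+1}\mathcal X_{i+1}}$ (length $s_{i+1}$) and the two axial edges $\overline{\mathcal O_i\mathcal O_{i+1}}$, $\overline{\mathcal X_i\mathcal X_{i+1}}$ (both of length $a_i$, but with different deficit angles and dual areas). **Limit.** The continuum limit of the lattice is achieved by taking $N_a\to\infty$, or equivalently $a_i\to0$, and $\xi\to0$, or equivalently letting the number of vertices of each cross-sectional polyhedron tend to infinity. *)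

theory Defs
  imports "HOL-Analysis.Analysis"
begin

section \<open>Euclidean building blocks\<close>

definition vangle :: "'a::real_inner \<Rightarrow> 'a \<Rightarrow> real" where
  "vangle u v = arccos (u \<bullet> v / (norm u * norm v))"

definition perp_part :: "'a::real_inner \<Rightarrow> 'a \<Rightarrow> 'a" where
  "perp_part v e = v - (v \<bullet> e / (e \<bullet> e)) *\<^sub>R e"

text \<open>Interior angle at the edge \<open>p q\<close> between the two half-planes bounded by that edge that
  contain \<open>r\<close> and \<open>s\<close>, respectively.\<close>
definition dihedral :: "'a::real_inner \<Rightarrow> 'a \<Rightarrow> 'a \<Rightarrow> 'a \<Rightarrow> real" where
  "dihedral p q r s = vangle (perp_part (r - p) (q - p)) (perp_part (s - p) (q - p))"

text \<open>Unspecified unless the points of \<open>S\<close> lie on a common sphere; for triangles, isosceles trapezoids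
  and frustum blocks this is the usual circumcenter.\<close>
definition circumcenter :: "'a::euclidean_space set \<Rightarrow> 'a" where
  "circumcenter S = (THE c. c \<in> affine hull S \<and> (\<exists>r. \<forall>p\<in>S. dist c p = r))"

definition tri_area :: "real^3 \<Rightarrow> real^3 \<Rightarrow> real^3 \<Rightarrow> real" where
  "tri_area p q r = norm (cross3 (q - p) (r - p)) / 2"

text \<open>The kite \<open>m f k g\<close>, cut along its diagonal \<open>m k\<close>.\<close>
definition kite_area :: "real^3 \<Rightarrow> real^3 \<Rightarrow> real^3 \<Rightarrow> real^3 \<Rightarrow> real" where
  "kite_area m f k g = tri_area m f k + tri_area m k g"

text \<open>A concrete flat triangle \<open>p\<^sub>0 p\<^sub>1 p\<^sub>2\<close> with \<open>|p\<^sub>0 p\<^sub>1| = c\<close>, \<open>|p\<^sub>0 p\<^sub>2| = b\<close>, \<open>|p\<^sub>1 p\<^sub>2| = a\<close>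
  in the plane \<open>z = 0\<close>.\<close>
definition flat_triangle :: "real \<Rightarrow> real \<Rightarrow> real \<Rightarrow> nat \<Rightarrow> real^3" where
  "flat_triangle c b a k =
     (let x = (c\<^sup>2 + b\<^sup>2 - a\<^sup>2) / (2 * c)
      in [vector [0, 0, 0], vector [c, 0, 0], vector [x, sqrt (b\<^sup>2 - x\<^sup>2), 0]] ! k)"

section \<open>The triangulated cross sections\<close>

text \<open>The pair \<open>(m, n)\<close> is the point \<open>m X + n Y\<close> of the equilateral triangular lattice in the plane
  tangent to the sphere at \<open>O = (0, 0)\<close>, where \<open>X = (1, 0)\<close> and \<open>Y = (0, 1)\<close> are adjacent
  neighbours of \<open>O\<close>. Thus \<open>V = (1, 1)\<close> and \<open>U = (2, 0)\<close>.\<close>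
type_synonym lattice_point = "int \<times> int"

abbreviation pt_O :: lattice_point where "pt_O \<equiv> (0, 0)"
abbreviation pt_X :: lattice_point where "pt_X \<equiv> (1, 0)"
abbreviation pt_Y :: lattice_point where "pt_Y \<equiv> (0, 1)"

text \<open>Rotation by 60 degrees, taking \<open>X\<close> to \<open>Y\<close> and \<open>Y\<close> to \<open>Y - X\<close>.\<close>
fun rot60 :: "lattice_point \<Rightarrow> lattice_point" where
  "rot60 (m, n) = (- n, m + n)"

definition neighbour :: "nat \<Rightarrow> lattice_point \<Rightarrow> lattice_point" where
  "neighbour k P = P + (rot60 ^^ k) (1, 0)"

text \<open>The two lattice triangles containing the edge \<open>P Q\<close> have third vertex \<open>apex k P Q\<close>
  with \<open>k = 1\<close> and \<open>k = 5\<close>.\<close>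
definition apex :: "nat \<Rightarrow> lattice_point \<Rightarrow> lattice_point \<Rightarrow> lattice_point" where
  "apex k P Q = P + (rot60 ^^ k) (Q - P)"

text \<open>Position relative to the center of the sphere, in units of its radius, so that the lattice has
  spacing \<open>\<xi>\<close> and the tangent plane is at height 1. Only the direction matters for the projection
  onto the sphere.\<close>
definition lattice_ray :: "real \<Rightarrow> lattice_point \<Rightarrow> real^3" where
  "lattice_ray \<xi> P =
     vector [\<xi> * (of_int (fst P) + of_int (snd P) / 2), \<xi> * (sqrt 3 / 2 * of_int (snd P)), 1]"

section \<open>The frustum lattice\<close>

text \<open>Cross sections are numbered \<open>1, \<dots>, sections F\<close>; \<open>axial F i\<close> is the length of the axial edges
  between sections \<open>i\<close> and \<open>i + 1\<close>; \<open>resolution F\<close> is \<open>\<xi>\<close>. The flat end caps fill sections \<open>1\<close> and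
  \<open>sections F\<close>; \<open>cap F i\<close> is the circumradius of the cap that fills section \<open>i\<close>.\<close>
record frustum_lattice =
  sections :: nat
  resolution :: real
  radius :: "nat \<Rightarrow> real"
  axial :: "nat \<Rightarrow> real"
  cap :: "nat \<Rightarrow> real"

text \<open>The arc length, on section \<open>i\<close>, between the projections of two lattice points.\<close>
definition edge_length :: "frustum_lattice \<Rightarrow> nat \<Rightarrow> lattice_point \<Rightarrow> lattice_point \<Rightarrow> real" where
  "edge_length F i P Q =
     radius F i * vangle (lattice_ray (resolution F) P) (lattice_ray (resolution F) Q)"

text \<open>In everything that follows, a triangle is an ordered triple of lattice points, and a quantity
  attached to one of its edges (vertices) refers to the edge \<open>P Q\<close> (to the vertex \<open>P\<close>).\<close>
definition sec_tri ::
  "frustum_lattice \<Rightarrow> nat \<Rightarrow> lattice_point \<Rightarrow> lattice_point \<Rightarrow> lattice_point \<Rightarrow> nat \<Rightarrow> real^3" where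
  "sec_tri F i P Q R = flat_triangle (edge_length F i P Q) (edge_length F i P R) (edge_length F i Q R)"

definition sec_center ::
  "frustum_lattice \<Rightarrow> nat \<Rightarrow> lattice_point \<Rightarrow> lattice_point \<Rightarrow> lattice_point \<Rightarrow> real^3" where
  "sec_center F i P Q R = circumcenter (sec_tri F i P Q R ` {0, 1, 2})"

text \<open>The block over \<open>P Q R\<close> between sections \<open>i\<close> and \<open>i + 1\<close> has the vertices
  \<open>sec_tri F i P Q R k\<close> and \<open>upper_tri F i P Q R k\<close> with \<open>k < 3\<close>. The upper triangle is the lower one
  scaled about the axis through its circumcenter; this alignment makes the three axial edges equal,
  and the height \<open>h\<close> is the one for which their common length is \<open>axial F i\<close>.\<close>
definition upper_tri ::
  "frustum_lattice \<Rightarrow> nat \<Rightarrow> lattice_point \<Rightarrow> lattice_point \<Rightarrow> lattice_point \<Rightarrow> nat \<Rightarrow> real^3" where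
  "upper_tri F i P Q R k =
     (let B = sec_tri F i P Q R;
          c = sec_center F i P Q R;
          q = radius F (i + 1) / radius F i;
          h = sqrt ((axial F i)\<^sup>2 - ((q - 1) * dist c (B 0))\<^sup>2)
      in c + q *\<^sub>R (B k - c) + vector [0, 0, h])"

definition upper_center ::
  "frustum_lattice \<Rightarrow> nat \<Rightarrow> lattice_point \<Rightarrow> lattice_point \<Rightarrow> lattice_point \<Rightarrow> real^3" where
  "upper_center F i P Q R = circumcenter (upper_tri F i P Q R ` {0, 1, 2})"

definition block_center ::
  "frustum_lattice \<Rightarrow> nat \<Rightarrow> lattice_point \<Rightarrow> lattice_point \<Rightarrow> lattice_point \<Rightarrow> real^3" where
  "block_center F i P Q R =
     circumcenter (sec_tri F i P Q R ` {0, 1, 2} \<union> upper_tri F i P Q R ` {0, 1, 2})"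

text \<open>Circumcenter of the lateral trapezoid over the edge between the \<open>j\<close>-th and \<open>k\<close>-th vertices.\<close>
definition lateral_center ::
  "frustum_lattice \<Rightarrow> nat \<Rightarrow> lattice_point \<Rightarrow> lattice_point \<Rightarrow> lattice_point \<Rightarrow> nat \<Rightarrow> nat \<Rightarrow> real^3" where
  "lateral_center F i P Q R j k =
     circumcenter (sec_tri F i P Q R ` {j, k} \<union> upper_tri F i P Q R ` {j, k})"

text \<open>An end cap is the union of the pyramids that join its triangles to its circumcenter. The apex of
  the pyramid lies on the normal through the circumcenter of the triangle, at distance \<open>cap F i\<close> from the
  vertices. The dihedral angle (the dual area) of the cap at an edge is the sum of the contributions of
  the two pyramids at that edge.\<close>
definition cap_center ::
  "frustum_lattice \<Rightarrow> nat \<Rightarrow> lattice_point \<Rightarrow> lattice_point \<Rightarrow> lattice_point \<Rightarrow> real^3" where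
  "cap_center F i P Q R =
     (let c = sec_center F i P Q R
      in c + vector [0, 0, sqrt ((cap F i)\<^sup>2 - (dist c (sec_tri F i P Q R 0))\<^sup>2)])"

definition cap_angle ::
  "frustum_lattice \<Rightarrow> nat \<Rightarrow> lattice_point \<Rightarrow> lattice_point \<Rightarrow> lattice_point \<Rightarrow> real" where
  "cap_angle F i P Q R =
     (let B = sec_tri F i P Q R in dihedral (B 0) (B 1) (B 2) (cap_center F i P Q R))"

definition cap_area ::
  "frustum_lattice \<Rightarrow> nat \<Rightarrow> lattice_point \<Rightarrow> lattice_point \<Rightarrow> lattice_point \<Rightarrow> real" where
  "cap_area F i P Q R =
     (let B = sec_tri F i P Q R
      in tri_area (midpoint (B 0) (B 1)) (sec_center F i P Q R) (cap_center F i P Q R))"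

definition cap_height ::
  "frustum_lattice \<Rightarrow> nat \<Rightarrow> lattice_point \<Rightarrow> lattice_point \<Rightarrow> lattice_point \<Rightarrow> real" where
  "cap_height F i P Q R = dist (cap_center F i P Q R) (sec_center F i P Q R)"

subsection \<open>Deficit angles and dual areas\<close>

text \<open>Dihedral angle and dual kite, at the edge \<open>P Q\<close> of section \<open>i\<close>, of the bodies over \<open>P Q R\<close> that
  lie between sections \<open>i\<close> and \<open>i + 1\<close> (\<open>above\<close>) and between sections \<open>i - 1\<close> and \<open>i\<close> (\<open>below\<close>).\<close>
definition angle_above ::
  "frustum_lattice \<Rightarrow> nat \<Rightarrow> lattice_point \<Rightarrow> lattice_point \<Rightarrow> lattice_point \<Rightarrow> real" where
  "angle_above F i P Q R =
     (if i = sections F then cap_angle F i P Q R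
      else let B = sec_tri F i P Q R; T = upper_tri F i P Q R
           in dihedral (B 0) (B 1) (B 2) (T 0))"

definition angle_below ::
  "frustum_lattice \<Rightarrow> nat \<Rightarrow> lattice_point \<Rightarrow> lattice_point \<Rightarrow> lattice_point \<Rightarrow> real" where
  "angle_below F i P Q R =
     (if i = 1 then cap_angle F i P Q R
      else let B = sec_tri F (i - 1) P Q R; T = upper_tri F (i - 1) P Q R
           in dihedral (T 0) (T 1) (T 2) (B 0))"

definition area_above ::
  "frustum_lattice \<Rightarrow> nat \<Rightarrow> lattice_point \<Rightarrow> lattice_point \<Rightarrow> lattice_point \<Rightarrow> real" where
  "area_above F i P Q R =
     (if i = sections F then cap_area F i P Q R
      else let B = sec_tri F i P Q R
           in kite_area (midpoint (B 0) (B 1)) (sec_center F i P Q R) (block_center F i P Q R)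
                (lateral_center F i P Q R 0 1))"

definition area_below ::
  "frustum_lattice \<Rightarrow> nat \<Rightarrow> lattice_point \<Rightarrow> lattice_point \<Rightarrow> lattice_point \<Rightarrow> real" where
  "area_below F i P Q R =
     (if i = 1 then cap_area F i P Q R
      else let T = upper_tri F (i - 1) P Q R
           in kite_area (midpoint (T 0) (T 1)) (upper_center F (i - 1) P Q R)
                (block_center F (i - 1) P Q R) (lateral_center F (i - 1) P Q R 0 1))"

definition edge_deficit :: "frustum_lattice \<Rightarrow> nat \<Rightarrow> lattice_point \<Rightarrow> lattice_point \<Rightarrow> real" where
  "edge_deficit F i P Q =
     2 * pi - (\<Sum>k\<in>{1, 5}. angle_above F i P Q (apex k P Q) + angle_below F i P Q (apex k P Q))"

definition edge_dual_area :: "frustum_lattice \<Rightarrow> nat \<Rightarrow> lattice_point \<Rightarrow> lattice_point \<Rightarrow> real" where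
  "edge_dual_area F i P Q =
     (\<Sum>k\<in>{1, 5}. area_above F i P Q (apex k P Q) + area_below F i P Q (apex k P Q))"

text \<open>The axial edge at \<open>P\<close> between sections \<open>i\<close> and \<open>i + 1\<close> belongs to the six blocks around it.\<close>
definition axial_deficit :: "frustum_lattice \<Rightarrow> nat \<Rightarrow> lattice_point \<Rightarrow> real" where
  "axial_deficit F i P =
     2 * pi - (\<Sum>k<6. let B = sec_tri F i P (neighbour k P) (neighbour (k + 1) P);
                          T = upper_tri F i P (neighbour k P) (neighbour (k + 1) P)
                      in dihedral (B 0) (T 0) (B 1) (B 2))"

definition axial_dual_area :: "frustum_lattice \<Rightarrow> nat \<Rightarrow> lattice_point \<Rightarrow> real" where
  "axial_dual_area F i P =
     (\<Sum>k<6. let Q = neighbour k P; R = neighbour (k + 1) P;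
                 B = sec_tri F i P Q R; T = upper_tri F i P Q R
             in kite_area (midpoint (B 0) (T 0)) (lateral_center F i P Q R 0 1)
                  (block_center F i P Q R) (lateral_center F i P Q R 0 2))"

subsection \<open>Dual edges and their simplicial Ricci curvature\<close>

definition dual_alpha :: "frustum_lattice \<Rightarrow> nat \<Rightarrow> real" where
  "dual_alpha F i =
     (if i = 1 then cap_height F i pt_O pt_X pt_Y
      else dist (block_center F (i - 1) pt_O pt_X pt_Y) (upper_center F (i - 1) pt_O pt_X pt_Y)) +
     (if i = sections F then cap_height F i pt_O pt_X pt_Y
      else dist (block_center F i pt_O pt_X pt_Y) (sec_center F i pt_O pt_X pt_Y))"

definition dual_sigma :: "frustum_lattice \<Rightarrow> nat \<Rightarrow> real" where
  "dual_sigma F i =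
     (\<Sum>k\<in>{1, 5}. let R = apex k pt_O pt_X
        in dist (block_center F i pt_O pt_X R) (lateral_center F i pt_O pt_X R 0 1))"

text \<open>The second argument lists \<open>(\<ell>, \<epsilon>\<^sub>\<ell>, \<ell>\<^sup>*, m)\<close>, that is length, deficit angle, dual area and moment
  arm, for the edges of the face dual to an edge of length \<open>lam\<close>.\<close>
definition dual_ricci :: "real \<Rightarrow> (real \<times> real \<times> real \<times> real) list \<Rightarrow> real" where
  "dual_ricci lam es =
     (let vol = (\<lambda>l m. 1/6 * lam * l * m);
          total = (\<Sum>(l, e, A, m)\<leftarrow>es. vol l m)
      in \<Sum>(l, e, A, m)\<leftarrow>es. 2 * (e / A) * (vol l m / total))"

definition Rc_alpha :: "frustum_lattice \<Rightarrow> nat \<Rightarrow> real" where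
  "Rc_alpha F i = dual_ricci (dual_alpha F i)
     (map (\<lambda>(P, Q, R). (edge_length F i P Q, edge_deficit F i P Q, edge_dual_area F i P Q,
              dist (midpoint (sec_tri F i P Q R 0) (sec_tri F i P Q R 1)) (sec_center F i P Q R)))
        [(pt_O, pt_X, pt_Y), (pt_O, pt_Y, pt_X), (pt_X, pt_Y, pt_O)])"

definition Rc_sigma :: "frustum_lattice \<Rightarrow> nat \<Rightarrow> real" where
  "Rc_sigma F i =
     (let B = sec_tri F i pt_O pt_X pt_Y;
          T = upper_tri F i pt_O pt_X pt_Y;
          c = lateral_center F i pt_O pt_X pt_Y 0 1
      in dual_ricci (dual_sigma F i)
           [(edge_length F i pt_O pt_X, edge_deficit F i pt_O pt_X,
               edge_dual_area F i pt_O pt_X, dist (midpoint (B 0) (B 1)) c),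
            (edge_length F (i + 1) pt_O pt_X, edge_deficit F (i + 1) pt_O pt_X,
               edge_dual_area F (i + 1) pt_O pt_X, dist (midpoint (T 0) (T 1)) c),
            (axial F i, axial_deficit F i pt_O, axial_dual_area F i pt_O,
               dist (midpoint (B 0) (T 0)) c),
            (axial F i, axial_deficit F i pt_X, axial_dual_area F i pt_X,
               dist (midpoint (B 1) (T 1)) c)])"

section \<open>Continuum geometry and limit\<close>

definition C2_on ::
  "('a::real_normed_vector \<Rightarrow> 'b::real_normed_vector) \<Rightarrow> 'a set \<Rightarrow> bool" where
  "C2_on f S \<longleftrightarrow>
     (\<exists>(f' :: 'a \<Rightarrow> 'a \<Rightarrow>\<^sub>L 'b) (f'' :: 'a \<Rightarrow> 'a \<Rightarrow>\<^sub>L ('a \<Rightarrow>\<^sub>L 'b)).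
        (\<forall>z\<in>S. (f has_derivative blinfun_apply (f' z)) (at z)) \<and>
        (\<forall>z\<in>S. (f' has_derivative blinfun_apply (f'' z)) (at z)) \<and>
        continuous_on S f'')"

text \<open>\<open>A (x, \<tau>)\<close> is the proper axial distance, at time \<open>\<tau>\<close>, of the cross section with (time-independent)
  label \<open>x\<close>, and \<open>\<rho> (a, \<tau>)\<close> the radius of the section at proper axial distance \<open>a\<close>. In terms of
  labels the metric is \<open>(\<partial>A/\<partial>x)\<^sup>2 dx\<^sup>2 + \<rho>\<^sup>2 d\<Omega>\<^sup>2\<close>. The labels range over the open
  interval between the two poles.\<close>
definition warped_geometry ::
  "real \<Rightarrow> real \<Rightarrow> real set \<Rightarrow> (real \<times> real \<Rightarrow> real) \<Rightarrow> (real \<times> real \<Rightarrow> real) \<Rightarrow> bool" where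
  "warped_geometry xl xr J A \<rho> \<longleftrightarrow>
     xl < xr \<and> open J \<and>
     C2_on A ({xl<..<xr} \<times> J) \<and>
     (\<forall>x\<in>{xl<..<xr}. \<forall>\<tau>\<in>J. 0 < deriv (\<lambda>y. A (y, \<tau>)) x) \<and>
     (\<forall>\<tau>\<in>J. bounded ((\<lambda>x. A (x, \<tau>)) ` {xl<..<xr})) \<and>
     C2_on \<rho> ((\<lambda>(x, \<tau>). (A (x, \<tau>), \<tau>)) ` ({xl<..<xr} \<times> J)) \<and>
     (\<forall>x\<in>{xl<..<xr}. \<forall>\<tau>\<in>J. 0 < \<rho> (A (x, \<tau>), \<tau>))"

text \<open>\<open>F\<close> has its sections at the axial positions \<open>pos 1, \<dots>, pos N\<close>. The circumradii of the end caps
  are left unconstrained.\<close>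
definition approximates :: "frustum_lattice \<Rightarrow> nat \<Rightarrow> real \<Rightarrow> (nat \<Rightarrow> real) \<Rightarrow> (real \<Rightarrow> real) \<Rightarrow> bool" where
  "approximates F N \<xi> pos profile \<longleftrightarrow>
     sections F = N \<and> resolution F = \<xi> \<and>
     (\<forall>i\<in>{1..N}. radius F i = profile (pos i)) \<and>
     (\<forall>i\<in>{1..<N}. axial F i = pos (i + 1) - pos i)"

text \<open>The spacings of \<open>N\<close> sections agree up to a factor \<open>K\<close>.\<close>
definition nearly_equally_spaced :: "real \<Rightarrow> nat \<Rightarrow> (nat \<Rightarrow> real) \<Rightarrow> bool" where
  "nearly_equally_spaced K N pos \<longleftrightarrow>
     (\<forall>i\<in>{1..<N}. \<forall>j\<in>{1..<N}. pos (i + 1) - pos i \<le> K * (pos (j + 1) - pos j))"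

definition log_rate :: "(real \<Rightarrow> real) \<Rightarrow> real \<Rightarrow> real" where
  "log_rate f t = deriv f t / f t"

text \<open>First \<open>\<xi> \<rightarrow> 0\<close> with the sections fixed, then \<open>N \<rightarrow> \<infinity>\<close>.\<close>
definition continuum_limit :: "(nat \<Rightarrow> real \<Rightarrow> real) \<Rightarrow> real \<Rightarrow> bool" where
  "continuum_limit f L \<longleftrightarrow>
     (\<exists>g. (\<forall>\<^sub>F N in sequentially. (f N \<longlongrightarrow> g N) (at_right 0)) \<and> g \<longlonglongrightarrow> L)"

text \<open>The family of lattice equations \<open>l N \<xi> = r N \<xi>\<close> converges to the equation \<open>L = R\<close>: both sides
  converge, and therefore the lattice equations imply the limiting one.\<close>
definition equations_converge ::
  "(nat \<Rightarrow> real \<Rightarrow> real) \<Rightarrow> (nat \<Rightarrow> real \<Rightarrow> real) \<Rightarrow> real \<Rightarrow> real \<Rightarrow> bool" where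
  "equations_converge l r L R \<longleftrightarrow>
     continuum_limit l L \<and> continuum_limit r R \<and>
     ((\<forall>\<^sub>F N in sequentially. \<forall>\<^sub>F \<xi> in at_right 0. l N \<xi> = r N \<xi>) \<longrightarrow> L = R)"

end

theory Submission
  imports Defs
begin

text \<open>
A frustum block has an axis that contains the circumcenters of its two triangles and of the block itself, and the
circumcenter of a lateral trapezoid is the foot of the perpendicular from the circumcenter of the block. All angles,
dual areas and dual edges are therefore elementary functions of the two radii, the axial length and the sides of the
unit-sphere triangle below the block, and both limits can be computed term by term.

In the first limit, \<open>\<xi> \<rightarrow> 0\<close> with the sections fixed, a block becomes a thin column. At an edge of a cross section,
deficit and dual area are both of order \<open>\<xi>\<close>: the dihedral angles are \<open>pi / 2\<close> up to the slopes of the lateral faces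
(\<open>angle_above_eq\<close>, \<open>angle_below_eq\<close>), so that the deficit is the change of slope from one layer to the next, and the
ratio tends to a second divided difference of the radii (\<open>edge_curvature_limit\<close>), which represents \<open>- \<rho>'' / \<rho>\<close>. At an
axial edge, both are of order \<open>\<xi>\<^sup>2\<close>. The deficit is the angle defect of the triangulated sphere, corrected by the tilt of
the axial edge. This defect needs the sides up to relative order \<open>\<xi>\<^sup>2\<close> (\<open>side_expansion\<close>), and although the
expansions differ from edge to edge, their contributions to the star of a vertex always add up to the same number
(\<open>side_coeff_star\<close>). The ratio of deficit and dual area thus has the same limit at both ends of the dual trapezoid
(\<open>axial_curvature_limit\<close>), and this limit represents \<open>(1 - \<rho>'\<^sup>2) / \<rho>\<^sup>2\<close>. For the triangle dual to \<open>\<alpha>\<close>, the volume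
fractions tend to one third each, and the curvature is twice that of its edges. For the trapezoid dual to \<open>\<sigma>\<close>, the two
edges of the cross sections and the two axial edges get half of the weight each, and the curvature is the sum of the
two kinds (\<open>Rc_alpha_limit\<close>, \<open>Rc_sigma_limit\<close>).

On the other side of the equations, \<open>\<alpha>\<close> tends to the mean of the two adjacent axial edges and \<open>\<sigma> / \<xi>\<close> to a multiple of
the mean of the two radii. Their derivatives in time converge as well, so that the logarithmic rates tend to those of
the means (\<open>alpha_rate\<close>, \<open>sigma_rate\<close>).

In the second limit, \<open>N \<rightarrow> \<infinity>\<close>, nearly equal spacing forces all gaps to zero (\<open>gap_limit\<close>). The sections involved then
converge to the interior section \<open>x0\<close>, away from the end caps, and the divided differences converge to derivatives by
Taylor's theorem and the mean value theorem. The rate of \<open>\<alpha>\<close> is a difference in the label of rates in time, whereas the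
continuum equation contains the rate in time of a derivative in the label; the two agree because the mixed second
derivatives of \<open>A\<close> do (\<open>C2_mixed_partials\<close>).
\<close>

section \<open>Circumcenters and kites\<close>

text \<open>Two points that are both equidistant from \<open>S\<close> differ by a vector orthogonal to \<open>affine hull S\<close>; if both lie in
  that hull, the difference is orthogonal to itself.\<close>
lemma circumcenter_eqI:
  fixes c :: "'a::euclidean_space"
  assumes c: "c \<in> affine hull S" and r: "\<And>p. p \<in> S \<Longrightarrow> dist c p = r"
  shows "circumcenter S = c"
  unfolding circumcenter_def
proof (rule the_equality)
  show "c \<in> affine hull S \<and> (\<exists>r. \<forall>p\<in>S. dist c p = r)"
    using assms by blast
next
  fix c' assume c': "c' \<in> affine hull S \<and> (\<exists>r. \<forall>p\<in>S. dist c' p = r)"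
  then obtain r' where r': "\<And>p. p \<in> S \<Longrightarrow> dist c' p = r'" by blast
  define k where "k = (c \<bullet> c - c' \<bullet> c' - r\<^sup>2 + r'\<^sup>2) / 2"
  have "(c - c') \<bullet> p = k" if "p \<in> S" for p
  proof -
    have "(c - p) \<bullet> (c - p) = r\<^sup>2" "(c' - p) \<bullet> (c' - p) = r'\<^sup>2"
      using r[OF that] r'[OF that] by (simp_all add: dist_norm dot_square_norm)
    then show ?thesis
      unfolding k_def by (simp add: inner_diff inner_commute field_simps)
  qed
  then have "affine hull S \<subseteq> {p. (c - c') \<bullet> p = k}"
    by (intro hull_minimal) (auto simp: affine_hyperplane)
  then have "(c - c') \<bullet> c = k" "(c - c') \<bullet> c' = k"
    using c c' by blast+
  then have "(c - c') \<bullet> (c - c') = 0"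
    by (simp add: inner_diff_right)
  then show "c' = c" by simp
qed

lemma tri_area_right_angle:
  assumes "(q - p) \<bullet> (r - q) = 0"
  shows "tri_area p q r = dist p q * dist q r / 2"
proof -
  have "cross3 (q - p) (r - p) = cross3 (q - p) (r - q)"
    using cross_refl[of "q - p"] by (simp add: cross3_simps)
  moreover have "(norm (cross3 (q - p) (r - q)))\<^sup>2 = (norm (q - p) * norm (r - q))\<^sup>2"
    using norm_cross_dot[of "q - p" "r - q"] assms by simp
  ultimately show ?thesis
    unfolding tri_area_def dist_norm
    by (simp add: norm_minus_commute power2_eq_iff_nonneg)
qed

lemma tri_area_swap: "tri_area p q r = tri_area p r q"
  unfolding tri_area_def by (subst cross_skew) simp

text \<open>The dual kites all have this shape: a circumcenter of a face is the foot of the perpendicular from the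
  circumcenter of the block, and a midpoint of an edge the foot of the one from the circumcenter of a face.\<close>
lemma kite_area_right_angles:
  assumes "(f - m) \<bullet> (k - f) = 0" "(g - m) \<bullet> (k - g) = 0"
  shows "kite_area m f k g = (dist m f * dist f k + dist m g * dist g k) / 2"
  using assms unfolding kite_area_def tri_area_swap[of m k g]
  by (simp add: tri_area_right_angle add_divide_distrib)

section \<open>Acute flat triangles\<close>

definition acute_triangle :: "real \<Rightarrow> real \<Rightarrow> real \<Rightarrow> bool" where
  "acute_triangle c b a \<longleftrightarrow> 0 < c \<and> 0 < b \<and> 0 < a \<and>
     a\<^sup>2 < b\<^sup>2 + c\<^sup>2 \<and> b\<^sup>2 < c\<^sup>2 + a\<^sup>2 \<and> c\<^sup>2 < a\<^sup>2 + b\<^sup>2"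

text \<open>Sixteen times the squared area of the triangle, by Heron's formula.\<close>
definition heron :: "real \<Rightarrow> real \<Rightarrow> real \<Rightarrow> real" where
  "heron c b a = 2 * a\<^sup>2 * b\<^sup>2 + 2 * b\<^sup>2 * c\<^sup>2 + 2 * c\<^sup>2 * a\<^sup>2 - a ^ 4 - b ^ 4 - c ^ 4"

definition circumradius :: "real \<Rightarrow> real \<Rightarrow> real \<Rightarrow> real" where
  "circumradius c b a = a * b * c / sqrt (heron c b a)"

text \<open>Distance from the circumcenter to the side \<open>c\<close>; positive exactly when the angle opposite to \<open>c\<close> is acute.\<close>
definition apothem :: "real \<Rightarrow> real \<Rightarrow> real \<Rightarrow> real" where
  "apothem c b a = c * (a\<^sup>2 + b\<^sup>2 - c\<^sup>2) / (2 * sqrt (heron c b a))"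

text \<open>With the three positive numbers \<open>p = b\<^sup>2 + c\<^sup>2 - a\<^sup>2\<close>, \<open>q\<close>, \<open>r\<close> of the acuteness condition, \<open>heron\<close> is
  \<open>p q + q r + r p\<close>. Acuteness therefore also excludes degenerate triangles.\<close>
lemma heron_pos:
  assumes "acute_triangle c b a" shows "0 < heron c b a"
proof -
  define p q r where "p = b\<^sup>2 + c\<^sup>2 - a\<^sup>2" and "q = c\<^sup>2 + a\<^sup>2 - b\<^sup>2" and "r = a\<^sup>2 + b\<^sup>2 - c\<^sup>2"
  have "heron c b a = p * q + q * r + r * p"
    unfolding heron_def p_def q_def r_def by algebra
  moreover have "0 < p" "0 < q" "0 < r"
    using assms unfolding acute_triangle_def p_def q_def r_def by auto
  ultimately show ?thesis by (simp add: add_pos_pos)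
qed

lemma apothem_pos: "acute_triangle c b a \<Longrightarrow> 0 < apothem c b a"
  using heron_pos[of c b a] unfolding apothem_def acute_triangle_def by simp

lemma circumradius_pos: "acute_triangle c b a \<Longrightarrow> 0 < circumradius c b a"
  using heron_pos[of c b a] unfolding circumradius_def acute_triangle_def by simp

lemma apothem_circumradius:
  assumes "acute_triangle c b a"
  shows "(apothem c b a)\<^sup>2 + c\<^sup>2 / 4 = (circumradius c b a)\<^sup>2"
proof -
  have H: "0 < heron c b a" using assms by (rule heron_pos)
  have "c\<^sup>2 * (a\<^sup>2 + b\<^sup>2 - c\<^sup>2)\<^sup>2 + c\<^sup>2 * heron c b a = 4 * (a * b * c)\<^sup>2"
    unfolding heron_def by algebra
  moreover have "(apothem c b a)\<^sup>2 = c\<^sup>2 * (a\<^sup>2 + b\<^sup>2 - c\<^sup>2)\<^sup>2 / (4 * heron c b a)"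
    "(circumradius c b a)\<^sup>2 = (a * b * c)\<^sup>2 / heron c b a"
    using H by (simp_all add: apothem_def circumradius_def power_divide power_mult_distrib)
  ultimately show ?thesis
    using H by (simp add: add_frac_eq frac_eq_eq)
qed

text \<open>The equations that determine the coordinates of the vertices and of the circumcenter; square roots and
  quotients do not appear in them.\<close>
lemma flat_triangle_coordinates:
  assumes "acute_triangle c b a"
  obtains x y where
    "flat_triangle c b a 0 = vector [0, 0, 0]"
    "flat_triangle c b a 1 = vector [c, 0, 0]"
    "flat_triangle c b a 2 = vector [x, y, 0]"
    "2 * c * x = c\<^sup>2 + b\<^sup>2 - a\<^sup>2" "x\<^sup>2 + y\<^sup>2 = b\<^sup>2" "0 < y"
    "2 * y * apothem c b a = b\<^sup>2 - c * x"
proof -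
  have c: "0 < c" and H: "0 < heron c b a"
    using assms heron_pos by (auto simp: acute_triangle_def)
  define x where "x = (c\<^sup>2 + b\<^sup>2 - a\<^sup>2) / (2 * c)"
  define y where "y = sqrt (b\<^sup>2 - x\<^sup>2)"
  have cx: "2 * c * x = c\<^sup>2 + b\<^sup>2 - a\<^sup>2" using c by (simp add: x_def)
  have "4 * c\<^sup>2 * (b\<^sup>2 - x\<^sup>2) = 4 * c\<^sup>2 * b\<^sup>2 - (2 * c * x)\<^sup>2"
    by (simp add: algebra_simps power_mult_distrib)
  also have "\<dots> = heron c b a"
    unfolding cx heron_def by algebra
  finally have y2: "b\<^sup>2 - x\<^sup>2 = heron c b a / (2 * c)\<^sup>2"
    using c by (simp add: field_simps power_mult_distrib)
  then have y: "y = sqrt (heron c b a) / (2 * c)"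
    using c real_sqrt_abs[of "2 * c"] by (simp add: y_def real_sqrt_divide del: real_sqrt_abs power_mult_distrib)
  have "0 < b\<^sup>2 - x\<^sup>2" using y2 H c by simp
  then have "x\<^sup>2 + y\<^sup>2 = b\<^sup>2" by (simp add: y_def)
  moreover have "0 < y" using y H c by simp
  moreover have "2 * y * apothem c b a = (a\<^sup>2 + b\<^sup>2 - c\<^sup>2) / 2"
    using H c unfolding y apothem_def by simp
  then have "2 * y * apothem c b a = b\<^sup>2 - c * x"
    using cx by (simp add: field_simps)
  ultimately show thesis
    using that[of x y] cx by (simp add: flat_triangle_def Let_def x_def y_def)
qed

lemma flat_triangle_scale:
  assumes "0 < r" "k < 3"
  shows "flat_triangle (r * c) (r * b) (r * a) k = r *\<^sub>R flat_triangle c b a k"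
proof -
  have x: "((r * c)\<^sup>2 + (r * b)\<^sup>2 - (r * a)\<^sup>2) / (2 * (r * c)) = r * ((c\<^sup>2 + b\<^sup>2 - a\<^sup>2) / (2 * c))"
  proof -
    have "(r * c)\<^sup>2 + (r * b)\<^sup>2 - (r * a)\<^sup>2 = r * (r * (c\<^sup>2 + b\<^sup>2 - a\<^sup>2))"
      by (simp add: power_mult_distrib power2_eq_square algebra_simps)
    then show ?thesis
      using assms by (simp add: ac_simps)
  qed
  have y: "sqrt ((r * b)\<^sup>2 - (r * x)\<^sup>2) = r * sqrt (b\<^sup>2 - x\<^sup>2)" for x
  proof -
    have "(r * b)\<^sup>2 - (r * x)\<^sup>2 = r\<^sup>2 * (b\<^sup>2 - x\<^sup>2)" by (simp add: algebra_simps power_mult_distrib)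
    then show ?thesis using assms by (simp add: real_sqrt_mult)
  qed
  have "k = 0 \<or> k = 1 \<or> k = 2" using assms by auto
  then show ?thesis
    unfolding flat_triangle_def x Let_def y
    by (auto simp: vec_eq_iff forall_3)
qed

definition flat_center :: "real \<Rightarrow> real \<Rightarrow> real \<Rightarrow> real^3" where
  "flat_center c b a = vector [c / 2, apothem c b a, 0]"

lemma flat_center:
  assumes "acute_triangle c b a" "k \<in> {0, 1, 2}"
  shows "norm (flat_triangle c b a k - flat_center c b a) = circumradius c b a"
    and "flat_center c b a \<in> affine hull (flat_triangle c b a ` {0, 1, 2})"
proof -
  obtain x y where xy:
    "flat_triangle c b a 0 = vector [0, 0, 0]"
    "flat_triangle c b a (Suc 0) = vector [c, 0, 0]"
    "flat_triangle c b a 2 = vector [x, y, 0]"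
    "2 * c * x = c\<^sup>2 + b\<^sup>2 - a\<^sup>2" "x\<^sup>2 + y\<^sup>2 = b\<^sup>2" "0 < y"
    "2 * y * apothem c b a = b\<^sup>2 - c * x"
    using flat_triangle_coordinates[OF assms(1)] by (metis One_nat_def)
  define e where "e = apothem c b a"
  have c: "0 < c" using assms by (simp add: acute_triangle_def)
  have "(x - c / 2)\<^sup>2 + (y - e)\<^sup>2 = e\<^sup>2 + c\<^sup>2 / 4"
    using xy(5,7) unfolding e_def[symmetric] by (simp add: power2_eq_square algebra_simps)
  then have "(norm (flat_triangle c b a k - flat_center c b a))\<^sup>2 = e\<^sup>2 + c\<^sup>2 / 4"
    using assms(2) xy(1-3) unfolding power2_norm_eq_inner flat_center_def e_def
    by (auto simp: inner_vec_def sum_3 power2_eq_square)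
  then show "norm (flat_triangle c b a k - flat_center c b a) = circumradius c b a"
    using apothem_circumradius[OF assms(1)] circumradius_pos[OF assms(1)]
    unfolding e_def by (simp add: power2_eq_iff_nonneg)
  \<comment> \<open>Barycentric coordinates of the circumcenter.\<close>
  define v where "v = e / y"
  define u where "u = (c / 2 - v * x) / c"
  have "flat_center c b a = (1 - u - v) *\<^sub>R flat_triangle c b a 0 + u *\<^sub>R flat_triangle c b a 1 + v *\<^sub>R flat_triangle c b a 2"
    using xy c by (simp add: vec_eq_iff forall_3 flat_center_def u_def v_def e_def)
  then show "flat_center c b a \<in> affine hull (flat_triangle c b a ` {0, 1, 2})"
    unfolding image_insert image_empty affine_hull_3
    by (intro CollectI exI[of _ "1 - u - v"] exI[of _ u] exI[of _ v]) simp
qed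

lemma flat_triangle_dist:
  assumes "acute_triangle c b a"
  shows "norm (flat_triangle c b a 0 - flat_triangle c b a 1) = c"
    and "norm (flat_triangle c b a 0 - flat_triangle c b a 2) = b"
    and "norm (flat_triangle c b a 1 - flat_triangle c b a 2) = a"
proof -
  obtain x y where xy:
    "flat_triangle c b a 0 = vector [0, 0, 0]"
    "flat_triangle c b a 1 = vector [c, 0, 0]"
    "flat_triangle c b a 2 = vector [x, y, 0]"
    "2 * c * x = c\<^sup>2 + b\<^sup>2 - a\<^sup>2" "x\<^sup>2 + y\<^sup>2 = b\<^sup>2"
    using flat_triangle_coordinates[OF assms(1)] by metis
  have "(c - x)\<^sup>2 + y\<^sup>2 = a\<^sup>2" using xy(4,5) by (simp add: power2_diff)
  moreover have "0 < c" "0 < b" "0 < a" using assms by (auto simp: acute_triangle_def)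
  ultimately show "norm (flat_triangle c b a 0 - flat_triangle c b a 1) = c"
    "norm (flat_triangle c b a 0 - flat_triangle c b a 2) = b"
    "norm (flat_triangle c b a 1 - flat_triangle c b a 2) = a"
    unfolding xy(1-3) norm_eq_sqrt_inner using xy(5)
    by (simp_all add: inner_vec_def sum_3 power2_eq_square[symmetric])
qed

lemma flat_triangle_horizontal:
  assumes "k < 3"
  shows "(flat_triangle c b a k - flat_center c b a) \<bullet> vector [0, 0, 1] = 0"
proof -
  have "k = 0 \<or> k = 1 \<or> k = 2" using assms by auto
  then show ?thesis
    unfolding flat_triangle_def flat_center_def Let_def
    by (auto simp: inner_vec_def sum_3)
qed

text \<open>The resolution always tends to zero from above.\<close>
abbreviation small_limit :: "(real \<Rightarrow> real) \<Rightarrow> real \<Rightarrow> bool" (infix "\<rightarrow>\<^sub>0" 60) where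
  "g \<rightarrow>\<^sub>0 l \<equiv> (g \<longlongrightarrow> l) (at_right 0)"

section \<open>Geometry of a frustum block\<close>

text \<open>Lengths are measured on the unit sphere: since all sections carry the same triangulation, the triangles of
  section \<open>i\<close> are the unit ones scaled by its radius.\<close>
definition side :: "real \<Rightarrow> lattice_point \<Rightarrow> lattice_point \<Rightarrow> real" where
  "side \<xi> P Q = vangle (lattice_ray \<xi> P) (lattice_ray \<xi> Q)"

lemma norm_orthogonal_combination:
  fixes m w n :: "'a::real_inner"
  assumes "m \<bullet> w = 0" "m \<bullet> n = 0" "w \<bullet> n = 0" "n \<bullet> n = 1"
  shows "(norm (x *\<^sub>R m + y *\<^sub>R w + z *\<^sub>R n))\<^sup>2 = x\<^sup>2 * (m \<bullet> m) + y\<^sup>2 * (w \<bullet> w) + z\<^sup>2"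
  using assms unfolding power2_norm_eq_inner
  by (simp add: inner_add inner_commute power2_eq_square algebra_simps)

lemma midpoint_diff:
  fixes l p q :: "'a::real_vector"
  assumes "l - p = x" "l - q = y"
  shows "l - midpoint p q = (1 / 2) *\<^sub>R (x + y)"
  unfolding assms[symmetric] midpoint_def
  by (simp add: algebra_simps flip: scaleR_add_left)

text \<open>A block over a unit-sphere triangle with sides \<open>c\<close>, \<open>b\<close>, \<open>a\<close>, between sections of radii \<open>r0\<close> and \<open>r1\<close>, with
  axial edges of length \<open>A\<close>. Here \<open>h\<close> is the height of the block and \<open>z\<close> the height of its circumcenter; \<open>H l\<close> is the
  height of the lateral trapezoid over a side \<open>l\<close> and \<open>\<tau> l\<close> the fraction of it at which the trapezoid's circumcenter
  lies; \<open>apo l\<close> is the distance of the side \<open>l\<close> from the circumcenter of the unit triangle. The radius of the cross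
  section through the circumcenter of the trapezoid is \<open>radial l\<close>, the distance between the circumcenters of block and
  trapezoid is \<open>apo l * f l\<close>, and \<open>\<kappa> l\<close> is the cosine of the base angles of the trapezoid, up to sign.\<close>
locale frustum_shape =
  fixes r0 r1 A c b a :: real
begin

definition D where "D = r1 - r0"
definition Rc where "Rc = circumradius c b a"
definition h where "h = sqrt (A\<^sup>2 - (D * Rc)\<^sup>2)"
definition z where "z = (A\<^sup>2 + 2 * Rc\<^sup>2 * D * r0) / (2 * h)"
definition H where "H l = sqrt (A\<^sup>2 - (D * l / 2)\<^sup>2)"
definition apo where "apo l = sqrt (Rc\<^sup>2 - (l / 2)\<^sup>2)"
definition \<tau> where "\<tau> l = 1 / 2 + (r1\<^sup>2 - r0\<^sup>2) * l\<^sup>2 / (8 * (H l)\<^sup>2)"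
definition radial where "radial l = (r0 + r1) * A\<^sup>2 / (2 * (H l)\<^sup>2)"
definition f where "f l = (r0 + r1) * A\<^sup>2 / (2 * h * H l)"
definition \<kappa> where "\<kappa> l = D * l / (2 * A)"

end

text \<open>The inequality \<open>thin\<close> bounds the width of the block by its height, so that \<open>h\<close> is real and the circumcenter
  of the block lies between its two triangles. It holds for small resolution because \<open>circumradius\<close> tends to zero.\<close>
locale frustum_block = frustum_shape +
  fixes F :: frustum_lattice and i :: nat and P Q R :: lattice_point
  assumes radii: "radius F i = r0" "radius F (Suc i) = r1" "0 < r0" "0 < r1"
    and axial: "axial F i = A" "0 < A"
    and sides: "side (resolution F) P Q = c" "side (resolution F) P R = b" "side (resolution F) Q R = a"
    and acute: "acute_triangle c b a"
    and thin: "2 * (circumradius c b a)\<^sup>2 * \<bar>r1 - r0\<bar> * (r0 + r1) < A\<^sup>2"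
begin

text \<open>All points are written as \<open>C + r *\<^sub>R \<delta> k + s *\<^sub>R axis\<close>, up to affine combinations: \<open>C\<close> is the circumcenter of the base triangle, \<open>\<delta> k\<close> a
  radius vector of the unit triangle, and \<open>axis\<close> the unit normal.\<close>
definition axis :: "real^3" where "axis = vector [0, 0, 1]"
definition \<delta> where "\<delta> k = flat_triangle c b a k - flat_center c b a"
definition C where "C = r0 *\<^sub>R flat_center c b a"

lemma thin_bounds:
  "(D * Rc)\<^sup>2 < A\<^sup>2" "0 < A\<^sup>2 + 2 * Rc\<^sup>2 * D * r0" "0 < A\<^sup>2 - 2 * Rc\<^sup>2 * D * r1"
proof -
  have t: "2 * Rc\<^sup>2 * (\<bar>D\<bar> * (r0 + r1)) < A\<^sup>2"
    using thin by (simp add: Rc_def D_def mult.assoc)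
  have *: "2 * Rc\<^sup>2 * u < A\<^sup>2" if "u \<le> \<bar>D\<bar> * (r0 + r1)" for u
    using mult_left_mono[OF that, of "2 * Rc\<^sup>2"] t by simp
  have "\<bar>D\<bar> * \<bar>D\<bar> \<le> \<bar>D\<bar> * (r0 + r1)"
    using radii by (intro mult_left_mono) (auto simp: D_def)
  from *[OF this] show "(D * Rc)\<^sup>2 < A\<^sup>2"
    using zero_le_power2[of "D * Rc"] by (simp add: power_mult_distrib power2_eq_square mult_ac)
  have "- D * r0 \<le> \<bar>D\<bar> * (r0 + r1)" 
    using radii by (intro mult_mono) auto
  from *[OF this] show "0 < A\<^sup>2 + 2 * Rc\<^sup>2 * D * r0" by (simp add: mult_ac)
  have "D * r1 \<le> \<bar>D\<bar> * (r0 + r1)" 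
    using radii by (intro mult_mono) auto
  from *[OF this] show "0 < A\<^sup>2 - 2 * Rc\<^sup>2 * D * r1" by (simp add: mult_ac)
qed

lemma h_pos: "0 < h" and h_square: "h\<^sup>2 = A\<^sup>2 - (D * Rc)\<^sup>2"
  using thin_bounds(1) by (simp_all add: h_def)

lemma z_pos: "0 < z"
  using thin_bounds h_pos by (simp add: z_def)

text \<open>The same formula as the one for \<open>z\<close>, with the two triangles exchanged.\<close>
lemma h_minus_z: "h - z = (A\<^sup>2 - 2 * Rc\<^sup>2 * D * r1) / (2 * h)"
proof -
  have "h - z = (2 * h\<^sup>2 - (A\<^sup>2 + 2 * Rc\<^sup>2 * D * r0)) / (2 * h)"
    using h_pos by (simp add: z_def field_simps power2_eq_square)
  also have "2 * h\<^sup>2 - (A\<^sup>2 + 2 * Rc\<^sup>2 * D * r0) = A\<^sup>2 - 2 * Rc\<^sup>2 * D * r1"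
    unfolding h_square by (simp add: D_def power2_eq_square algebra_simps)
  finally show ?thesis .
qed

lemma z_less: "z < h"
  using h_minus_z thin_bounds h_pos by (smt (verit) divide_pos_pos)

lemma axis_unit [simp]: "axis \<bullet> axis = 1" "norm axis = 1"
  by (simp_all add: axis_def inner_vec_def sum_3 norm_eq_sqrt_inner)

lemma scale_axis: "s *\<^sub>R axis = vector [0, 0, s]"
  by (simp add: axis_def vec_eq_iff forall_3)

lemma delta_axis [simp]: "k < 3 \<Longrightarrow> \<delta> k \<bullet> axis = 0"
  unfolding \<delta>_def axis_def by (rule flat_triangle_horizontal)

lemma delta_norm: "k \<in> {0, 1, 2} \<Longrightarrow> norm (\<delta> k) = Rc"
  unfolding \<delta>_def Rc_def by (rule flat_center(1)[OF acute])

lemma delta_square: "k \<in> {0, 1, 2} \<Longrightarrow> \<delta> k \<bullet> \<delta> k = Rc\<^sup>2"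
  by (simp add: dot_square_norm delta_norm)

lemma edge_length_eq:
  "edge_length F i P Q = r0 * c" "edge_length F i P R = r0 * b" "edge_length F i Q R = r0 * a"
  using radii sides by (simp_all add: edge_length_def side_def)

abbreviation "base \<equiv> sec_tri F i P Q R"
abbreviation "roof \<equiv> upper_tri F i P Q R"
abbreviation "base_center \<equiv> sec_center F i P Q R"
abbreviation "roof_center \<equiv> upper_center F i P Q R"
abbreviation "center \<equiv> block_center F i P Q R"
abbreviation "side_center \<equiv> lateral_center F i P Q R"

lemma sec_tri_scale: "k < 3 \<Longrightarrow> base k = r0 *\<^sub>R flat_triangle c b a k"
  unfolding sec_tri_def edge_length_eq by (rule flat_triangle_scale[OF radii(3)])

lemma sec_tri_eq: "k < 3 \<Longrightarrow> base k = C + r0 *\<^sub>R \<delta> k"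
  by (simp add: sec_tri_scale C_def \<delta>_def algebra_simps)

text \<open>In the coordinates centered at the circumcenter, the circumcenter is the origin; this is the membership
  condition for circumcenters, and it is invariant under the scalings and translations that produce both triangles.\<close>
lemma affine_hull_shape: "0 \<in> affine hull (\<delta> ` {0, 1, 2})"
proof -
  have "(\<lambda>x. - flat_center c b a + x) ` (affine hull (flat_triangle c b a ` {0, 1, 2})) = affine hull (\<delta> ` {0, 1, 2})"
    unfolding affine_hull_translation[symmetric] by (simp add: image_image \<delta>_def)
  then show ?thesis using flat_center(2)[OF acute, of 0] by force
qed

lemma affine_hull_scaled_shape:
  assumes "g 0 = p + s *\<^sub>R \<delta> 0" "g 1 = p + s *\<^sub>R \<delta> 1" "g 2 = p + s *\<^sub>R \<delta> 2"
  shows "p \<in> affine hull (g ` {0, 1, 2})"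
proof -
  have "g ` {0, 1, 2} = (\<lambda>x. p + x) ` ((\<lambda>x. s *\<^sub>R x) ` (\<delta> ` {0, 1, 2}))"
    using assms by simp
  moreover have "affine hull ((\<lambda>x. p + x) ` ((\<lambda>x. s *\<^sub>R x) ` (\<delta> ` {0, 1, 2})))
     = (\<lambda>x. p + x) ` ((\<lambda>x. s *\<^sub>R x) ` (affine hull (\<delta> ` {0, 1, 2})))"
    by (simp only: affine_hull_translation affine_hull_linear_image[OF bounded_linear_scaleR_right])
  ultimately show ?thesis using affine_hull_shape by force
qed

lemma sec_center_hull: "C \<in> affine hull (base ` {0, 1, 2})"
  by (rule affine_hull_scaled_shape[where s=r0]) (simp_all add: sec_tri_eq)

lemma sec_center_eq: "base_center = C"
  unfolding sec_center_def using sec_center_hull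
proof (rule circumcenter_eqI)
  fix p assume "p \<in> base ` {0, 1, 2}"
  then show "dist C p = r0 * Rc"
    using radii by (auto simp: sec_tri_eq dist_norm delta_norm)
qed

lemma upper_tri_eq: "k < 3 \<Longrightarrow> roof k = C + r1 *\<^sub>R \<delta> k + h *\<^sub>R axis"
proof -
  assume k: "k < 3"
  have q: "(r1 / r0 - 1) * (r0 * Rc) = D * Rc"
    using radii by (simp add: D_def field_simps)
  have "dist C (base 0) = r0 * Rc"
    using radii by (simp add: sec_tri_eq dist_norm delta_norm)
  then show ?thesis
    using k radii axial(1)
    by (simp add: upper_tri_def Let_def sec_center_eq q h_def[symmetric] sec_tri_eq scale_axis)
qed

lemma upper_center_hull: "C + h *\<^sub>R axis \<in> affine hull (roof ` {0, 1, 2})"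
  by (rule affine_hull_scaled_shape[where s=r1]) (simp_all add: upper_tri_eq)

lemma upper_center_eq: "roof_center = C + h *\<^sub>R axis"
  unfolding upper_center_def using upper_center_hull
proof (rule circumcenter_eqI)
  fix p assume "p \<in> roof ` {0, 1, 2}"
  then show "dist (C + h *\<^sub>R axis) p = r1 * Rc"
    using radii by (auto simp: upper_tri_eq dist_norm delta_norm)
qed

text \<open>This is the equation of which \<open>z\<close> is the solution.\<close>
lemma z_equidistant: "(r0 * Rc)\<^sup>2 + z\<^sup>2 = (r1 * Rc)\<^sup>2 + (h - z)\<^sup>2"
proof -
  have "2 * h * z = A\<^sup>2 + 2 * Rc\<^sup>2 * D * r0"
    using h_pos by (simp add: z_def)
  also have "\<dots> = h\<^sup>2 + (D * Rc)\<^sup>2 + 2 * Rc\<^sup>2 * D * r0"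
    by (simp add: h_square)
  finally show ?thesis by (simp add: D_def power2_eq_square algebra_simps)
qed

lemma norm_delta_axis:
  assumes "k \<in> {0, 1, 2}"
  shows "norm (x *\<^sub>R \<delta> k + y *\<^sub>R axis) = sqrt ((x * Rc)\<^sup>2 + y\<^sup>2)"
proof -
  have k: "k < 3" using assms by auto
  have "(norm (x *\<^sub>R \<delta> k + y *\<^sub>R axis))\<^sup>2 = (x * Rc)\<^sup>2 + y\<^sup>2"
    using norm_orthogonal_combination[of "\<delta> k" 0 axis x 0 y] k delta_square[OF assms]
    by (simp add: power_mult_distrib)
  then show ?thesis by (simp add: real_sqrt_unique)
qed

text \<open>The axis consists of the points equidistant from the vertices of each triangle; the height \<open>z\<close> equalizes
  the two distances.\<close>
lemma block_center_eq: "center = C + z *\<^sub>R axis"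
  unfolding block_center_def
proof (rule circumcenter_eqI)
  let ?S = "base ` {0, 1, 2} \<union> roof ` {0, 1, 2}"
  have "C \<in> affine hull ?S" "C + h *\<^sub>R axis \<in> affine hull ?S"
    using sec_center_hull upper_center_hull hull_mono[of _ ?S affine] by blast+
  then have "(1 - z / h) *\<^sub>R C + (z / h) *\<^sub>R (C + h *\<^sub>R axis) \<in> affine hull ?S"
    by (intro mem_affine[OF affine_affine_hull]) auto
  also have "(1 - z / h) *\<^sub>R C + (z / h) *\<^sub>R (C + h *\<^sub>R axis) = C + z *\<^sub>R axis"
    using h_pos by (simp add: algebra_simps)
  finally show "C + z *\<^sub>R axis \<in> affine hull ?S" .
  have "dist (C + z *\<^sub>R axis) (C + r0 *\<^sub>R \<delta> k) = sqrt ((r0 * Rc)\<^sup>2 + z\<^sup>2)"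
     "dist (C + z *\<^sub>R axis) (C + r1 *\<^sub>R \<delta> k + h *\<^sub>R axis) = sqrt ((r0 * Rc)\<^sup>2 + z\<^sup>2)" if "k \<in> {0, 1, 2}" for k
  proof -
    have "dist (C + z *\<^sub>R axis) (C + r0 *\<^sub>R \<delta> k) = norm (- r0 *\<^sub>R \<delta> k + z *\<^sub>R axis)"
      "dist (C + z *\<^sub>R axis) (C + r1 *\<^sub>R \<delta> k + h *\<^sub>R axis) = norm (- r1 *\<^sub>R \<delta> k + (z - h) *\<^sub>R axis)"
      by (simp_all add: dist_norm algebra_simps)
    moreover have "(- r1 * Rc)\<^sup>2 + (z - h)\<^sup>2 = (r0 * Rc)\<^sup>2 + z\<^sup>2"
      unfolding z_equidistant by (simp add: power2_commute[of z h])
    ultimately show "dist (C + z *\<^sub>R axis) (C + r0 *\<^sub>R \<delta> k) = sqrt ((r0 * Rc)\<^sup>2 + z\<^sup>2)"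
      "dist (C + z *\<^sub>R axis) (C + r1 *\<^sub>R \<delta> k + h *\<^sub>R axis) = sqrt ((r0 * Rc)\<^sup>2 + z\<^sup>2)"
      by (simp_all only: norm_delta_axis[OF that] power_mult_distrib power2_minus)
  qed
  then show "\<And>p. p \<in> ?S \<Longrightarrow> dist (C + z *\<^sub>R axis) p = sqrt ((r0 * Rc)\<^sup>2 + z\<^sup>2)"
    by (auto simp: sec_tri_eq upper_tri_eq)
qed

lemma dist_block_sec: "dist (center) (base_center) = z"
  using z_pos by (simp add: block_center_eq sec_center_eq dist_norm)

lemma dist_block_upper: "dist (center) (roof_center) = h - z"
proof -
  have "C + z *\<^sub>R axis - (C + h *\<^sub>R axis) = (z - h) *\<^sub>R axis" by (simp add: algebra_simps)
  then show ?thesis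
    using z_less by (simp add: block_center_eq upper_center_eq dist_norm)
qed

text \<open>Over the side between the vertices \<open>j\<close> and \<open>k\<close>, the three mutually orthogonal vectors \<open>\<mu>\<close> (to the midpoint),
  \<open>\<omega>\<close> (along the side) and \<open>axis\<close> form a frame; \<open>v\<close> joins the midpoints of the parallel sides of the trapezoid.\<close>
definition \<mu> where "\<mu> j k = (1 / 2) *\<^sub>R (\<delta> j + \<delta> k)"
definition \<omega> where "\<omega> j k = (1 / 2) *\<^sub>R (\<delta> j - \<delta> k)"
definition v where "v j k = D *\<^sub>R \<mu> j k + h *\<^sub>R axis"
context
  fixes j k :: nat and l :: real
  assumes jk: "j \<in> {0, 1, 2}" "k \<in> {0, 1, 2}" and l: "norm (\<delta> j - \<delta> k) = l"
begin

lemma lt3: "j < 3" "k < 3"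
  using jk by auto

lemma delta_eq: "\<delta> j = \<mu> j k + \<omega> j k" "\<delta> k = \<mu> j k - \<omega> j k"
  by (simp_all add: \<mu>_def \<omega>_def algebra_simps flip: scaleR_2)

lemma orthogonal:
  "\<mu> j k \<bullet> \<omega> j k = 0" "\<mu> j k \<bullet> axis = 0" "\<omega> j k \<bullet> axis = 0"
  "\<omega> j k \<bullet> \<mu> j k = 0" "axis \<bullet> \<mu> j k = 0" "axis \<bullet> \<omega> j k = 0"
  using delta_square[OF jk(1)] delta_square[OF jk(2)] lt3
  by (simp_all add: \<mu>_def \<omega>_def inner_add inner_diff inner_commute[of axis] inner_commute[of "\<delta> k" "\<delta> j"] diff_divide_distrib)

lemma omega_square: "\<omega> j k \<bullet> \<omega> j k = (l / 2)\<^sup>2"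
  using l dot_square_norm[of "\<delta> j - \<delta> k"] by (simp add: \<omega>_def power_divide power2_eq_square)

lemma mu_square: "\<mu> j k \<bullet> \<mu> j k = Rc\<^sup>2 - (l / 2)\<^sup>2"
  using delta_square[OF jk(1)] orthogonal(1,4) omega_square
  by (simp add: delta_eq(1) inner_add)

lemma half_le: "(l / 2)\<^sup>2 \<le> Rc\<^sup>2"
  using mu_square inner_ge_zero[of "\<mu> j k"] by linarith

lemma mu_square_apo: "\<mu> j k \<bullet> \<mu> j k = (apo l)\<^sup>2" 
  using half_le by (simp add: mu_square apo_def)

lemma apo_nonneg: "0 \<le> apo l"
  using half_le by (simp add: apo_def)

lemma H_square_h: "A\<^sup>2 - (D * l / 2)\<^sup>2 = D\<^sup>2 * (apo l)\<^sup>2 + h\<^sup>2"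
  using half_le by (simp add: h_square apo_def power_mult_distrib algebra_simps power_divide)

lemma H_square: "(H l)\<^sup>2 = A\<^sup>2 - (D * l / 2)\<^sup>2" and H_pos: "0 < H l"
proof -
  have "0 < A\<^sup>2 - (D * l / 2)\<^sup>2" unfolding H_square_h using h_pos by (simp add: add_nonneg_pos)
  then show "(H l)\<^sup>2 = A\<^sup>2 - (D * l / 2)\<^sup>2" "0 < H l" by (simp_all add: H_def)
qed

lemma v_square: "v j k \<bullet> v j k = (H l)\<^sup>2"
  unfolding H_square H_square_h v_def
  by (simp add: inner_add orthogonal mu_square_apo power2_eq_square)

text \<open>The radius of the cross sections is an affine function of the height along the trapezoid.\<close>
lemma radial_tau: "r0 + \<tau> l * D = radial l"
proof -
  have "r0 + \<tau> l * D = (r0 + r1) * (4 * (H l)\<^sup>2 + (D * l)\<^sup>2) / (8 * (H l)\<^sup>2)"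
    using H_pos by (simp add: \<tau>_def D_def power2_eq_square field_simps)
  also have "4 * (H l)\<^sup>2 + (D * l)\<^sup>2 = 4 * A\<^sup>2"
    by (simp add: H_square power_divide)
  finally show ?thesis by (simp add: radial_def)
qed

definition L where "L = C + radial l *\<^sub>R \<mu> j k + (\<tau> l * h) *\<^sub>R axis"

text \<open>Orthogonality of \<open>v\<close> to the segment between the two circumcenters, in coordinates.\<close>
lemma foot_height: "h * (z - \<tau> l * h) = radial l * D * (apo l)\<^sup>2"
proof -
  have e: "(apo l)\<^sup>2 = Rc\<^sup>2 - (l / 2)\<^sup>2" using mu_square mu_square_apo by simp
  have hz: "2 * (h * z) = A\<^sup>2 + 2 * Rc\<^sup>2 * D * r0" using h_pos by (simp add: z_def)
  have t: "\<tau> l * (8 * (H l)\<^sup>2) = 4 * (H l)\<^sup>2 + (r1\<^sup>2 - r0\<^sup>2) * l\<^sup>2" 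
    using H_pos by (simp add: \<tau>_def field_simps)
  have "2 * h * (z - \<tau> l * h) - 2 * radial l * D * (apo l)\<^sup>2
      = 2 * (h * z) - 2 * r0 * D * (apo l)\<^sup>2 - 2 * \<tau> l * (h\<^sup>2 + D\<^sup>2 * (apo l)\<^sup>2)"
    unfolding radial_tau[symmetric] by (simp add: power2_eq_square algebra_simps)
  also have "h\<^sup>2 + D\<^sup>2 * (apo l)\<^sup>2 = (H l)\<^sup>2"
    by (simp add: H_square H_square_h)
  also have "2 * \<tau> l * (H l)\<^sup>2 = (H l)\<^sup>2 + (r1\<^sup>2 - r0\<^sup>2) * l\<^sup>2 / 4"
    using t by simp
  also have "2 * (h * z) - 2 * r0 * D * (apo l)\<^sup>2 - \<dots> = 0"
    unfolding hz e H_square by (simp add: D_def power2_eq_square field_simps)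
  finally show ?thesis by simp
qed

lemma block_to_L: "C + z *\<^sub>R axis - L = - radial l *\<^sub>R \<mu> j k + 0 *\<^sub>R \<omega> j k + (z - \<tau> l * h) *\<^sub>R axis"
  by (simp add: L_def algebra_simps)

text \<open>The point \<open>L\<close> is the foot of the perpendicular from the circumcenter of the block to the plane of the
  trapezoid, which is spanned by \<open>v\<close> and \<open>\<omega>\<close>.\<close>
lemma block_to_L_orthogonal: "(C + z *\<^sub>R axis - L) \<bullet> (x *\<^sub>R v j k + y *\<^sub>R \<omega> j k) = 0"
proof -
  have "(C + z *\<^sub>R axis - L) \<bullet> v j k = - radial l * D * (apo l)\<^sup>2 + h * (z - \<tau> l * h)"
    unfolding block_to_L v_def by (simp add: inner_add inner_diff orthogonal mu_square_apo)
  moreover have "(C + z *\<^sub>R axis - L) \<bullet> \<omega> j k = 0"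
    unfolding block_to_L by (simp add: inner_add inner_diff orthogonal)
  ultimately show ?thesis by (simp add: foot_height inner_add)
qed

lemma dist_block_L: "dist (C + z *\<^sub>R axis) L = apo l * ((r0 + r1) * A\<^sup>2 / (2 * h * H l))"
proof -
  have zt: "z - \<tau> l * h = radial l * D * (apo l)\<^sup>2 / h"
    using foot_height h_pos by (simp add: field_simps)
  have "(dist (C + z *\<^sub>R axis) L)\<^sup>2 = (radial l)\<^sup>2 * (apo l)\<^sup>2 + (z - \<tau> l * h)\<^sup>2"
    unfolding dist_norm block_to_L
    by (subst norm_orthogonal_combination) (simp_all add: orthogonal mu_square_apo)
  also have "\<dots> = (radial l * apo l / h)\<^sup>2 * (h\<^sup>2 + D\<^sup>2 * (apo l)\<^sup>2)"
    unfolding zt using h_pos by (simp add: power2_eq_square field_simps)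
  also have "h\<^sup>2 + D\<^sup>2 * (apo l)\<^sup>2 = (H l)\<^sup>2"
    by (simp add: H_square H_square_h)
  also have "(radial l * apo l / h)\<^sup>2 * (H l)\<^sup>2 = (apo l * ((r0 + r1) * A\<^sup>2 / (2 * h * H l)))\<^sup>2"
    using H_pos by (simp add: radial_def power2_eq_square ac_simps)
  finally show ?thesis
    using radii H_pos h_pos apo_nonneg by (simp add: power2_eq_iff_nonneg)
qed

lemma norm_v_omega: "(norm (x *\<^sub>R v j k + y *\<^sub>R \<omega> j k))\<^sup>2 = (x * H l)\<^sup>2 + (y * l / 2)\<^sup>2"
proof -
  have "v j k \<bullet> \<omega> j k = 0" "\<omega> j k \<bullet> v j k = 0" by (simp_all add: v_def inner_add orthogonal)
  then show ?thesis
    by (simp add: power2_norm_eq_inner inner_add v_square omega_square)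
      (simp add: power2_eq_square)
qed

lemma L_to_vertices:
  "L - base j = \<tau> l *\<^sub>R v j k + (- r0) *\<^sub>R \<omega> j k"
  "L - base k = \<tau> l *\<^sub>R v j k + r0 *\<^sub>R \<omega> j k"
  "L - roof j = (\<tau> l - 1) *\<^sub>R v j k + (- r1) *\<^sub>R \<omega> j k"
  "L - roof k = (\<tau> l - 1) *\<^sub>R v j k + r1 *\<^sub>R \<omega> j k"
  unfolding sec_tri_eq[OF lt3(1)] sec_tri_eq[OF lt3(2)] upper_tri_eq[OF lt3(1)] upper_tri_eq[OF lt3(2)]
    L_def delta_eq v_def radial_tau[symmetric] D_def
  by (simp_all add: algebra_simps)

lemma L_to_midpoints:
  "L - midpoint (base j) (base k) = \<tau> l *\<^sub>R v j k + 0 *\<^sub>R \<omega> j k"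
  "L - midpoint (roof j) (roof k) = (\<tau> l - 1) *\<^sub>R v j k + 0 *\<^sub>R \<omega> j k"
  "L - midpoint (base j) (roof j)
     = (\<tau> l - 1 / 2) *\<^sub>R v j k + (- (r0 + r1) / 2) *\<^sub>R \<omega> j k"
  "L - midpoint (base k) (roof k)
     = (\<tau> l - 1 / 2) *\<^sub>R v j k + ((r0 + r1) / 2) *\<^sub>R \<omega> j k"
  unfolding midpoint_diff[OF L_to_vertices(1,2)] midpoint_diff[OF L_to_vertices(3,4)]
    midpoint_diff[OF L_to_vertices(1,3)] midpoint_diff[OF L_to_vertices(2,4)]
  by (simp_all add: vec_eq_iff field_simps)

lemma L_right_angles:
  "(L - midpoint (base j) (base k)) \<bullet> (C + z *\<^sub>R axis - L) = 0"
  "(L - midpoint (roof j) (roof k)) \<bullet> (C + z *\<^sub>R axis - L) = 0"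
  "(L - midpoint (base j) (roof j)) \<bullet> (C + z *\<^sub>R axis - L) = 0"
  unfolding L_to_midpoints by (subst inner_commute, rule block_to_L_orthogonal)+

text \<open>The choice of \<open>\<tau>\<close> equalizes the distances of \<open>L\<close> to the two parallel sides of the trapezoid.\<close>
lemma tau_equidistant: "(\<tau> l * H l)\<^sup>2 + (r0 * l / 2)\<^sup>2 = ((\<tau> l - 1) * H l)\<^sup>2 + (r1 * l / 2)\<^sup>2"
proof -
  have t: "\<tau> l * (8 * (H l)\<^sup>2) = 4 * (H l)\<^sup>2 + (r1\<^sup>2 - r0\<^sup>2) * l\<^sup>2" 
    using H_pos by (simp add: \<tau>_def field_simps)
  then show ?thesis by (simp add: power2_eq_square field_simps)
qed

lemma lateral_center_eq: "side_center j k = L"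
  unfolding lateral_center_def
proof (rule circumcenter_eqI)
  let ?B = "base" and ?T = "roof"
  let ?S = "?B ` {j, k} \<union> ?T ` {j, k}"
  let ?s = "\<tau> l"
  have hull: "?B j \<in> affine hull ?S" "?B k \<in> affine hull ?S" "?T j \<in> affine hull ?S" "?T k \<in> affine hull ?S"
    by (simp_all add: hull_inc)
  have aff: "affine (affine hull ?S)" by simp
  have mid: "midpoint p q \<in> affine hull ?S" if "p \<in> affine hull ?S" "q \<in> affine hull ?S" for p q
    using mem_affine[OF aff that, of "1/2" "1/2"] by (simp add: midpoint_def scaleR_right_distrib)
  have "(1 - ?s) *\<^sub>R midpoint (?B j) (?B k) + ?s *\<^sub>R midpoint (?T j) (?T k) \<in> affine hull ?S"
    by (intro mem_affine[OF aff] mid hull) simp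
  also have "(1 - ?s) *\<^sub>R midpoint (?B j) (?B k) + ?s *\<^sub>R midpoint (?T j) (?T k)
     = L - (1 - ?s) *\<^sub>R (L - midpoint (?B j) (?B k)) - ?s *\<^sub>R (L - midpoint (?T j) (?T k))"
    by (simp add: algebra_simps)
  also have "\<dots> = L"
    unfolding L_to_midpoints by (simp add: algebra_simps)
  finally show "L \<in> affine hull ?S" .
  have "(norm (L - p))\<^sup>2 = (\<tau> l * H l)\<^sup>2 + (r0 * l / 2)\<^sup>2" if "p \<in> ?S" for p
    using that tau_equidistant by (auto simp only: L_to_vertices norm_v_omega insert_iff empty_iff image_insert image_empty
        Un_iff power_mult_distrib power_divide power2_minus)
  then show "dist L p = sqrt ((\<tau> l * H l)\<^sup>2 + (r0 * l / 2)\<^sup>2)" if "p \<in> ?S" for p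
    using that unfolding dist_norm by (metis norm_ge_zero real_sqrt_unique)
qed

end

end

section \<open>Angles and dual areas of a frustum block\<close>

lemma perp_part_scale:
  "perp_part (s *\<^sub>R v) e = s *\<^sub>R perp_part v e"
  "s \<noteq> 0 \<Longrightarrow> perp_part v (s *\<^sub>R e) = perp_part v e"
  by (simp_all add: perp_part_def algebra_simps)

lemma perp_part_inner:
  assumes "e \<noteq> 0"
  shows "perp_part u e \<bullet> perp_part w e = u \<bullet> w - (u \<bullet> e) * (w \<bullet> e) / (e \<bullet> e)"
  using assms by (simp add: perp_part_def inner_diff inner_commute)

lemma vangle_scale: "0 < s \<Longrightarrow> vangle (s *\<^sub>R u) w = vangle u w"
  by (simp add: vangle_def)

text \<open>The angle between the direction \<open>(1, 0)\<close> and a line that recedes by \<open>x\<close> over the height \<open>h\<close>.\<close>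
lemma arccos_slope:
  assumes "0 < h"
  shows "arccos (- x / sqrt (x\<^sup>2 + h\<^sup>2)) = pi / 2 + arctan (x / h)"
proof -
  have "cos (pi / 2 + arctan (x / h)) = - sin (arctan (x / h))"
    by (simp add: cos_add)
  also have "\<dots> = - (x / h) / sqrt (1 + (x / h)\<^sup>2)"
    by (simp add: sin_arctan)
  also have "1 + (x / h)\<^sup>2 = (x\<^sup>2 + h\<^sup>2) / h\<^sup>2"
    using assms by (simp add: field_simps)
  also have "- (x / h) / sqrt ((x\<^sup>2 + h\<^sup>2) / h\<^sup>2) = - x / sqrt (x\<^sup>2 + h\<^sup>2)"
    using assms by (simp add: real_sqrt_divide)
  finally have "cos (pi / 2 + arctan (x / h)) = - x / sqrt (x\<^sup>2 + h\<^sup>2)" .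
  moreover have "arccos (cos (pi / 2 + arctan (x / h))) = pi / 2 + arctan (x / h)"
    using arctan_lbound[of "x / h"] arctan_ubound[of "x / h"]
    by (intro arccos_cos) linarith+
  ultimately show ?thesis by simp
qed

context frustum_block
begin

lemma sides_delta: "norm (\<delta> 0 - \<delta> (Suc 0)) = c" "norm (\<delta> 0 - \<delta> 2) = b" "norm (\<delta> (Suc 0) - \<delta> 2) = a"
  using flat_triangle_dist[OF acute] by (simp_all add: \<delta>_def)

lemma sides_pos: "0 < c" "0 < b" "0 < a"
  using acute by (auto simp: acute_triangle_def)

lemma apo_c: "apo c = apothem c b a"
proof -
  have "Rc\<^sup>2 - (c / 2)\<^sup>2 = (apothem c b a)\<^sup>2"
    using apothem_circumradius[OF acute] by (simp add: Rc_def power_divide)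
  then show ?thesis
    using apothem_pos[OF acute] by (simp add: apo_def)
qed

text \<open>Seen along the edge, the triangle is horizontal and the lateral face rises by \<open>h\<close> while it moves outwards by
  \<open>D * apo c\<close>. The two signs of \<open>\<sigma>\<close> are the dihedral angles at the base and at the top.\<close>
lemma dihedral_faces:
  assumes s: "0 < s" and \<sigma>: "\<bar>\<sigma>\<bar> = 1"
  shows "dihedral (p + s *\<^sub>R \<delta> 0) (p + s *\<^sub>R \<delta> 1) (p + s *\<^sub>R \<delta> 2) (p + s *\<^sub>R \<delta> 0 + \<sigma> *\<^sub>R (D *\<^sub>R \<delta> 0 + h *\<^sub>R axis))
     = pi / 2 + arctan (\<sigma> * D * apo c / h)"
proof -
  obtain x y where xy:
    "flat_triangle c b a 0 = vector [0, 0, 0]"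
    "flat_triangle c b a (Suc 0) = vector [c, 0, 0]"
    "flat_triangle c b a 2 = vector [x, y, 0]" and y: "0 < y"
    using flat_triangle_coordinates[OF acute] by (metis One_nat_def)
  define e where "e = apothem c b a"
  have d: "\<delta> 0 = vector [- c / 2, - e, 0]" "\<delta> 1 - \<delta> 0 = vector [c, 0, 0]" "\<delta> 2 - \<delta> 0 = vector [x, y, 0]"
    by (simp_all add: \<delta>_def xy flat_center_def e_def vec_eq_iff forall_3)
  have c: "0 < c" by (rule sides_pos)
  have base: "perp_part (s *\<^sub>R (\<delta> 2 - \<delta> 0)) (s *\<^sub>R (\<delta> 1 - \<delta> 0)) = (s * y) *\<^sub>R vector [0, 1, 0]"
    using c s unfolding perp_part_scale(1) perp_part_scale(2)[OF less_imp_neq[OF s, symmetric]] d(2,3)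
    by (simp add: perp_part_def inner_vec_def sum_3 vec_eq_iff forall_3)
  have lat: "perp_part (\<sigma> *\<^sub>R (D *\<^sub>R \<delta> 0 + h *\<^sub>R axis)) (s *\<^sub>R (\<delta> 1 - \<delta> 0)) = vector [0, - (\<sigma> * D * e), \<sigma> * h]"
    using c s unfolding perp_part_scale(2)[OF less_imp_neq[OF s, symmetric]] d(2)
    unfolding d(1) axis_def
    by (simp add: perp_part_def inner_vec_def sum_3 vec_eq_iff forall_3)
  have s2: "\<sigma>\<^sup>2 = 1" using \<sigma> by (metis power2_abs power_one)
  have "norm (vector [0, - (\<sigma> * D * e), \<sigma> * h] :: real^3) = sqrt ((\<sigma> * D * e)\<^sup>2 + h\<^sup>2)"
    using s2 by (simp add: norm_eq_sqrt_inner inner_vec_def sum_3 power_mult_distrib flip: power2_eq_square)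
  moreover have "(vector [0, 1, 0] :: real^3) \<bullet> vector [0, - (\<sigma> * D * e), \<sigma> * h] = - (\<sigma> * D * e)"
    "norm (vector [0, 1, 0] :: real^3) = 1"
    by (simp_all add: norm_eq_sqrt_inner inner_vec_def sum_3)
  moreover have "dihedral (p + s *\<^sub>R \<delta> 0) (p + s *\<^sub>R \<delta> 1) (p + s *\<^sub>R \<delta> 2) (p + s *\<^sub>R \<delta> 0 + \<sigma> *\<^sub>R (D *\<^sub>R \<delta> 0 + h *\<^sub>R axis))
     = vangle (perp_part (s *\<^sub>R (\<delta> 2 - \<delta> 0)) (s *\<^sub>R (\<delta> 1 - \<delta> 0)))
         (perp_part (\<sigma> *\<^sub>R (D *\<^sub>R \<delta> 0 + h *\<^sub>R axis)) (s *\<^sub>R (\<delta> 1 - \<delta> 0)))"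
    by (simp add: dihedral_def algebra_simps)
  ultimately have "dihedral (p + s *\<^sub>R \<delta> 0) (p + s *\<^sub>R \<delta> 1) (p + s *\<^sub>R \<delta> 2) (p + s *\<^sub>R \<delta> 0 + \<sigma> *\<^sub>R (D *\<^sub>R \<delta> 0 + h *\<^sub>R axis))
     = arccos (- (\<sigma> * D * e) / sqrt ((\<sigma> * D * e)\<^sup>2 + h\<^sup>2))"
    unfolding base lat using s y vangle_scale[of "s * y"] by (simp add: vangle_def)
  then show ?thesis
    using arccos_slope[OF h_pos, of "\<sigma> * D * e"] by (simp add: apo_c e_def)
qed

lemma angle_above_eq:
  assumes "i \<noteq> sections F"
  shows "angle_above F i P Q R = pi / 2 + arctan (D * apo c / h)"
proof -
  have T: "roof 0 = C + r0 *\<^sub>R \<delta> 0 + 1 *\<^sub>R (D *\<^sub>R \<delta> 0 + h *\<^sub>R axis)"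
    by (simp add: upper_tri_eq D_def algebra_simps)
  show ?thesis
    using dihedral_faces[OF radii(3), of 1 C] assms
    unfolding angle_above_def Let_def T by (simp add: sec_tri_eq)
qed

lemma angle_below_eq: "i \<noteq> 0 \<Longrightarrow> angle_below F (Suc i) P Q R = pi / 2 - arctan (D * apo c / h)"
proof -
  assume i: "i \<noteq> 0"
  have B: "base 0 = C + h *\<^sub>R axis + r1 *\<^sub>R \<delta> 0 + (- 1) *\<^sub>R (D *\<^sub>R \<delta> 0 + h *\<^sub>R axis)"
    by (simp add: sec_tri_eq D_def algebra_simps)
  have T: "roof k = C + h *\<^sub>R axis + r1 *\<^sub>R \<delta> k" if "k < 3" for k
    using that by (simp add: upper_tri_eq)
  show ?thesis
    using dihedral_faces[OF radii(4), of "-1" "C + h *\<^sub>R axis"] i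
    by (simp add: angle_below_def B T arctan_minus)
qed


lemma dist_block_lateral01: "dist (center) (side_center 0 (Suc 0)) = apo c * f c"
  using lateral_center_eq[of 0 "Suc 0", OF _ _ sides_delta(1)] dist_block_L[of 0 "Suc 0", OF _ _ sides_delta(1)]
  by (simp add: block_center_eq f_def)

lemma dist_block_lateral02: "dist (center) (side_center 0 2) = apo b * f b"
  using lateral_center_eq[of 0 2, OF _ _ sides_delta(2)] dist_block_L[of 0 2, OF _ _ sides_delta(2)]
  by (simp add: block_center_eq f_def)

lemma center_to_midpoint:
  "C - midpoint (base 0) (base (Suc 0)) = - r0 *\<^sub>R \<mu> 0 (Suc 0)"
  "C + h *\<^sub>R axis - midpoint (roof 0) (roof (Suc 0)) = - r1 *\<^sub>R \<mu> 0 (Suc 0)"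
  by (simp_all add: sec_tri_eq upper_tri_eq midpoint_def \<mu>_def vec_eq_iff field_simps)

lemma dist_midpoint_center:
  "dist (midpoint (base 0) (base (Suc 0))) (base_center) = r0 * apo c"
  "dist (midpoint (roof 0) (roof (Suc 0))) (roof_center) = r1 * apo c"
proof -
  note s = sides_delta(1)
  have "norm (\<mu> 0 (Suc 0)) = apo c"
    using mu_square_apo[of 0 "Suc 0", OF _ _ s] apo_nonneg[of 0 "Suc 0", OF _ _ s]
    by (simp add: dot_square_norm)
  then show "dist (midpoint (base 0) (base (Suc 0))) (base_center) = r0 * apo c"
    "dist (midpoint (roof 0) (roof (Suc 0))) (roof_center) = r1 * apo c"
    using radii center_to_midpoint
    by (simp_all add: dist_norm norm_minus_commute[of "midpoint _ _"] sec_center_eq upper_center_eq)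
qed

lemma dist_midpoint_lateral:
  "dist (midpoint (base 0) (base (Suc 0))) (side_center 0 (Suc 0)) = \<bar>\<tau> c\<bar> * H c"
  "dist (midpoint (roof 0) (roof (Suc 0))) (side_center 0 (Suc 0)) = \<bar>1 - \<tau> c\<bar> * H c"
proof -
  note s = sides_delta(1)
  have "(norm (v 0 (Suc 0)))\<^sup>2 = (H c)\<^sup>2"
    using v_square[of 0 "Suc 0", OF _ _ s] by (simp add: dot_square_norm)
  then have n: "norm (v 0 (Suc 0)) = H c"
    using H_pos[of 0 "Suc 0", OF _ _ s] by (simp add: power2_eq_iff_nonneg)
  show
  "dist (midpoint (base 0) (base (Suc 0))) (side_center 0 (Suc 0)) = \<bar>\<tau> c\<bar> * H c"
  "dist (midpoint (roof 0) (roof (Suc 0))) (side_center 0 (Suc 0)) = \<bar>1 - \<tau> c\<bar> * H c"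
    using L_to_midpoints(1,2)[of 0 "Suc 0", OF _ _ s]
    by (simp_all add: n lateral_center_eq[of 0 "Suc 0", OF _ _ s] dist_norm norm_minus_commute[of "midpoint _ _"] abs_minus_commute)
qed

text \<open>The same formula covers all the axial edges: the sign of \<open>s\<close> tells at which end of the side the axial edge
  stands.\<close>
lemma norm_axial_offset:
  assumes "j \<in> {0, 1, 2}" "k \<in> {0, 1, 2}" "norm (\<delta> j - \<delta> k) = l" "0 \<le> l" "\<bar>s\<bar> = (r0 + r1) / 2"
  shows "norm ((\<tau> l - 1 / 2) *\<^sub>R v j k + s *\<^sub>R \<omega> j k) = (r0 + r1) * l * A / (4 * H l)"
proof -
  note H = H_square[OF assms(1-3)] H_pos[OF assms(1-3)]
  have s2: "s\<^sup>2 = ((r0 + r1) / 2)\<^sup>2" using assms(5) by (metis power2_abs)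
  have "(norm ((\<tau> l - 1 / 2) *\<^sub>R v j k + s *\<^sub>R \<omega> j k))\<^sup>2 = ((\<tau> l - 1 / 2) * H l)\<^sup>2 + s\<^sup>2 * l\<^sup>2 / 4"
    unfolding norm_v_omega[OF assms(1-3)] by (simp add: power_mult_distrib power_divide)
  also have "\<dots> = ((r0 + r1) * l / (4 * H l))\<^sup>2 * ((D * l / 2)\<^sup>2 + (H l)\<^sup>2)"
    using H(2) unfolding s2 by (simp add: \<tau>_def D_def power2_eq_square field_simps)
  also have "\<dots> = ((r0 + r1) * l * A / (4 * H l))\<^sup>2"
    unfolding H(1) by (simp add: power_mult_distrib power_divide)
  finally show ?thesis
    using H(2) radii axial assms(4) by (simp add: power2_eq_iff_nonneg)
qed

lemma dist_axial_midpoint_lateral: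
  "dist (midpoint (base 0) (roof 0)) (side_center 0 (Suc 0)) = (r0 + r1) * c * A / (4 * H c)"
  "dist (midpoint (base (Suc 0)) (roof (Suc 0))) (side_center 0 (Suc 0)) = (r0 + r1) * c * A / (4 * H c)"
  "dist (midpoint (base 0) (roof 0)) (side_center 0 2) = (r0 + r1) * b * A / (4 * H b)"
  using norm_axial_offset[of 0 "Suc 0" c "- (r0 + r1) / 2"] norm_axial_offset[of 0 "Suc 0" c "(r0 + r1) / 2"]
    norm_axial_offset[of 0 2 b "- (r0 + r1) / 2"]
    L_to_midpoints(3,4)[of 0 "Suc 0", OF _ _ sides_delta(1)] L_to_midpoints(3)[of 0 2, OF _ _ sides_delta(2)]
    sides_delta sides_pos radii
    lateral_center_eq[of 0 "Suc 0", OF _ _ sides_delta(1)] lateral_center_eq[of 0 2, OF _ _ sides_delta(2)]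
  by (simp_all add: dist_norm norm_minus_commute[of "midpoint _ _"])

lemma area_above_eq:
  assumes "i \<noteq> sections F"
  shows "area_above F i P Q R = apo c * (r0 * z + \<bar>\<tau> c\<bar> * H c * f c) / 2"
proof -
  note s = sides_delta(1)
  let ?m = "midpoint (base 0) (base (Suc 0))"
  let ?K = "C + z *\<^sub>R axis" and ?L = "L 0 (Suc 0) c"
  have "kite_area ?m C ?K ?L = (dist ?m C * dist C ?K + dist ?m ?L * dist ?L ?K) / 2"
    by (rule kite_area_right_angles)
      (simp_all add: center_to_midpoint orthogonal[of 0 "Suc 0", OF _ _ s] L_right_angles[of 0 "Suc 0", OF _ _ s])
  then show ?thesis
    using assms dist_midpoint_center(1) dist_midpoint_lateral(1) dist_block_lateral01 dist_block_sec
      lateral_center_eq[of 0 "Suc 0", OF _ _ s]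
    by (simp add: area_above_def Let_def sec_center_eq block_center_eq dist_commute field_simps)
qed

lemma area_below_eq:
  assumes "i \<noteq> 0"
  shows "area_below F (Suc i) P Q R = apo c * (r1 * (h - z) + \<bar>1 - \<tau> c\<bar> * H c * f c) / 2"
proof -
  note s = sides_delta(1)
  let ?m = "midpoint (roof 0) (roof (Suc 0))"
  let ?C = "C + h *\<^sub>R axis" and ?K = "C + z *\<^sub>R axis" and ?L = "L 0 (Suc 0) c"
  have K: "?K - ?C = (z - h) *\<^sub>R axis" by (simp add: algebra_simps)
  have "kite_area ?m ?C ?K ?L = (dist ?m ?C * dist ?C ?K + dist ?m ?L * dist ?L ?K) / 2"
    by (rule kite_area_right_angles, unfold K)
      (simp_all add: center_to_midpoint orthogonal[of 0 "Suc 0", OF _ _ s] L_right_angles[of 0 "Suc 0", OF _ _ s])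
  then show ?thesis
    using assms dist_midpoint_center(2) dist_midpoint_lateral(2) dist_block_lateral01 dist_block_upper
      lateral_center_eq[of 0 "Suc 0", OF _ _ s]
    by (simp add: area_below_def Let_def upper_center_eq block_center_eq dist_commute right_diff_distrib
        distrib_left mult.assoc mult.left_commute[of "apo c"])
qed

lemma axial_kite_eq:
  "kite_area (midpoint (base 0) (roof 0)) (side_center 0 (Suc 0))
     (center) (side_center 0 2)
   = ((r0 + r1) * c * A / (4 * H c) * (apo c * f c) + (r0 + r1) * b * A / (4 * H b) * (apo b * f b)) / 2"
proof -
  note s = sides_delta(1) and s' = sides_delta(2)
  let ?M = "midpoint (base 0) (roof 0)"
  let ?K = "C + z *\<^sub>R axis" and ?L = "L 0 (Suc 0) c" and ?L' = "L 0 2 b"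
  have "kite_area ?M ?L ?K ?L' = (dist ?M ?L * dist ?L ?K + dist ?M ?L' * dist ?L' ?K) / 2"
    by (rule kite_area_right_angles) (simp_all add: L_right_angles[of 0 "Suc 0", OF _ _ s] L_right_angles[of 0 2, OF _ _ s'])
  then show ?thesis
    using dist_axial_midpoint_lateral dist_block_lateral01 dist_block_lateral02
      lateral_center_eq[of 0 "Suc 0", OF _ _ s] lateral_center_eq[of 0 2, OF _ _ s']
    by (simp add: block_center_eq dist_commute)
qed

text \<open>Projecting two sides of the triangle along the tilted axial edge changes the cosine of their angle by the
  product of their components \<open>\<kappa>\<close> along that edge. This tilt is the source of the term \<open>- \<rho>'\<^sup>2\<close> in the curvature of
  the cross sections.\<close>
lemma axial_dihedral_eq:
  "dihedral (base 0) (roof 0) (base (Suc 0)) (base 2)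
   = arccos (((b\<^sup>2 + c\<^sup>2 - a\<^sup>2) / (2 * b * c) - \<kappa> b * \<kappa> c) / (sqrt (1 - (\<kappa> b)\<^sup>2) * sqrt (1 - (\<kappa> c)\<^sup>2)))"
proof -
  define w where "w = D *\<^sub>R \<delta> 0 + h *\<^sub>R axis"
  define u where "u = \<delta> (Suc 0) - \<delta> 0"
  define u' where "u' = \<delta> 2 - \<delta> 0"
  have bb: "\<delta> 0 \<bullet> \<delta> 0 = Rc\<^sup>2" "\<delta> (Suc 0) \<bullet> \<delta> (Suc 0) = Rc\<^sup>2" "\<delta> 2 \<bullet> \<delta> 2 = Rc\<^sup>2"
    by (simp_all add: delta_square)
  have uu: "u \<bullet> u = c\<^sup>2" "u' \<bullet> u' = b\<^sup>2" "(u - u') \<bullet> (u - u') = a\<^sup>2"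
    using sides_delta unfolding u_def u'_def by (simp_all add: dot_square_norm norm_minus_commute)
  have uu': "u \<bullet> u' = (b\<^sup>2 + c\<^sup>2 - a\<^sup>2) / 2"
    using uu by (simp add: inner_diff inner_commute)
  have "u \<bullet> axis = 0" "u' \<bullet> axis = 0"
    unfolding u_def u'_def by (simp_all add: inner_diff)
  moreover have "u \<bullet> \<delta> 0 = - c\<^sup>2 / 2" "u' \<bullet> \<delta> 0 = - b\<^sup>2 / 2"
    using uu(1,2) bb unfolding u_def u'_def by (simp_all add: inner_diff inner_commute)
  ultimately have uw: "u \<bullet> w = - D * c\<^sup>2 / 2" "u' \<bullet> w = - D * b\<^sup>2 / 2"
    by (simp_all add: w_def inner_add)
  have "axis \<bullet> \<delta> 0 = 0" using delta_axis[of 0] by (simp add: inner_commute)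
  then have ww: "w \<bullet> w = A\<^sup>2"
    using h_square bb by (simp add: w_def inner_add power2_eq_square)
  have w0: "w \<noteq> 0" using ww axial by auto
  define p where "p = perp_part u w"
  define p' where "p' = perp_part u' w"
  note k = \<kappa>_def power2_eq_square
  have H: "0 < A\<^sup>2 - (D * c / 2)\<^sup>2" "0 < A\<^sup>2 - (D * b / 2)\<^sup>2"
    using zero_less_power[OF H_pos[of 0 "Suc 0", OF _ _ sides_delta(1)], of 2]
      zero_less_power[OF H_pos[of 0 2, OF _ _ sides_delta(2)], of 2]
      H_square[of 0 "Suc 0", OF _ _ sides_delta(1)] H_square[of 0 2, OF _ _ sides_delta(2)]
    by simp_all
  have pp: "p \<bullet> p = c\<^sup>2 * (1 - (\<kappa> c)\<^sup>2)" "p' \<bullet> p' = b\<^sup>2 * (1 - (\<kappa> b)\<^sup>2)"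
    unfolding p_def p'_def perp_part_inner[OF w0] uu uw ww
    using axial by (simp_all add: k field_simps)
  have "p \<bullet> p' = (b\<^sup>2 + c\<^sup>2 - a\<^sup>2) / 2 - D\<^sup>2 * c\<^sup>2 * b\<^sup>2 / (4 * A\<^sup>2)"
    unfolding p_def p'_def perp_part_inner[OF w0] uu' uw ww
    by (simp add: power2_eq_square)
  also have "\<dots> = b * c * ((b\<^sup>2 + c\<^sup>2 - a\<^sup>2) / (2 * b * c) - \<kappa> b * \<kappa> c)"
    using sides_pos axial by (simp add: k field_simps)
  finally have pp': "p \<bullet> p' = b * c * ((b\<^sup>2 + c\<^sup>2 - a\<^sup>2) / (2 * b * c) - \<kappa> b * \<kappa> c)" .
  have np: "norm p = c * sqrt (1 - (\<kappa> c)\<^sup>2)" "norm p' = b * sqrt (1 - (\<kappa> b)\<^sup>2)"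
    using sides_pos by (simp_all add: norm_eq_sqrt_inner pp real_sqrt_mult)
  have "dihedral (base 0) (roof 0) (base (Suc 0)) (base 2)
     = vangle (perp_part (r0 *\<^sub>R u) w) (perp_part (r0 *\<^sub>R u') w)"
    unfolding dihedral_def by (simp add: sec_tri_eq upper_tri_eq w_def u_def u'_def D_def algebra_simps)
  also have "\<dots> = arccos (p \<bullet> p' / (norm p * norm p'))"
    using radii by (simp add: perp_part_scale p_def[symmetric] p'_def[symmetric] vangle_def)
  also have "p \<bullet> p' / (norm p * norm p') = ((b\<^sup>2 + c\<^sup>2 - a\<^sup>2) / (2 * b * c) - \<kappa> b * \<kappa> c) / (sqrt (1 - (\<kappa> b)\<^sup>2) * sqrt (1 - (\<kappa> c)\<^sup>2))"
    unfolding pp' np using sides_pos by (simp add: ac_simps)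
  finally show ?thesis .
qed

end

section \<open>Sides of the projected lattice at small resolution\<close>

text \<open>Inner product and, up to the factor \<open>sqrt 3 / 2\<close>, determinant of the planar lattice vectors.\<close>
definition lattice_inner :: "lattice_point \<Rightarrow> lattice_point \<Rightarrow> real" where
  "lattice_inner P Q = of_int (fst P) * of_int (fst Q) + of_int (snd P) * of_int (snd Q)
     + (of_int (fst P) * of_int (snd Q) + of_int (snd P) * of_int (fst Q)) / 2"

definition lattice_det :: "lattice_point \<Rightarrow> lattice_point \<Rightarrow> real" where
  "lattice_det P Q = of_int (fst P) * of_int (snd Q) - of_int (snd P) * of_int (fst Q)"

definition adjacent :: "lattice_point \<Rightarrow> lattice_point \<Rightarrow> bool" where
  "adjacent P Q \<longleftrightarrow> lattice_inner (Q - P) (Q - P) = 1"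

lemma adjacent_iff: "adjacent P Q \<longleftrightarrow> lattice_inner P P + lattice_inner Q Q - 2 * lattice_inner P Q = 1"
  by (simp add: adjacent_def lattice_inner_def field_simps)

lemma lattice_ray_inner: "lattice_ray \<xi> P \<bullet> lattice_ray \<xi> Q = 1 + \<xi>\<^sup>2 * lattice_inner P Q"
  by (simp add: lattice_ray_def inner_vec_def sum_3 lattice_inner_def power2_eq_square algebra_simps)

lemma lattice_gram:
  "lattice_inner P P * lattice_inner Q Q - (lattice_inner P Q)\<^sup>2 = 3 / 4 * (lattice_det P Q)\<^sup>2"
  by (simp add: lattice_inner_def lattice_det_def power2_eq_square field_simps)

text \<open>The side between adjacent lattice points is \<open>\<xi> * (1 + side_coeff P Q * \<xi>\<^sup>2 + \<dots>)\<close>. For the five kinds of edges in the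
  24 triangles around \<open>O\<close>, the values are \<open>- 1 / 3\<close>, \<open>- 11 / 24\<close>, \<open>- 35 / 24\<close>, \<open>- 11 / 6\<close> and \<open>- 7 / 3\<close>.\<close>
definition side_coeff :: "lattice_point \<Rightarrow> lattice_point \<Rightarrow> real" where
  "side_coeff P Q = 3 / 8 * (lattice_det P Q)\<^sup>2 - lattice_inner P Q - 1 / 3"

text \<open>The tangent of the angle is the quotient of the area and the inner product of the two rays, and Lagrange's
  identity gives the area. The arctangent has a simpler expansion at \<open>0\<close> than the arccosine at \<open>1\<close>.\<close>
lemma side_arctan:
  assumes "adjacent P Q" "0 < \<xi>" "0 < 1 + \<xi>\<^sup>2 * lattice_inner P Q"
  shows "side \<xi> P Q = arctan (\<xi> * sqrt (1 + 3 / 4 * (lattice_det P Q)\<^sup>2 * \<xi>\<^sup>2) / (1 + \<xi>\<^sup>2 * lattice_inner P Q))"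
proof -
  define u v where "u = lattice_ray \<xi> P" and "v = lattice_ray \<xi> Q"
  \<comment> \<open>\<open>W\<close> is the inner product of the rays and \<open>X\<close> the area of the parallelogram that they span.\<close>
  define W where "W = 1 + \<xi>\<^sup>2 * lattice_inner P Q"
  define X where "X = \<xi> * sqrt (1 + 3 / 4 * (lattice_det P Q)\<^sup>2 * \<xi>\<^sup>2)"
  have W: "0 < W" using assms(3) by (simp add: W_def)
  have X0: "0 \<le> X" using assms by (simp add: X_def)
  have uv: "u \<bullet> v = W" by (simp add: u_def v_def W_def lattice_ray_inner)
  have X2: "X\<^sup>2 = \<xi>\<^sup>2 * (1 + 3 / 4 * (lattice_det P Q)\<^sup>2 * \<xi>\<^sup>2)"
    by (simp add: X_def power_mult_distrib)
  have "(u \<bullet> u) * (v \<bullet> v) = W\<^sup>2 + X\<^sup>2"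
  proof -
    have n: "lattice_inner P P + lattice_inner Q Q = 1 + 2 * lattice_inner P Q"
      using assms(1) by (simp add: adjacent_iff)
    have "(u \<bullet> u) * (v \<bullet> v) = 1 + \<xi>\<^sup>2 * (lattice_inner P P + lattice_inner Q Q)
        + \<xi> ^ 4 * (lattice_inner P P * lattice_inner Q Q)"
      unfolding u_def v_def lattice_ray_inner by (simp add: power2_eq_square power4_eq_xxxx algebra_simps)
    also have "lattice_inner P P * lattice_inner Q Q = 3 / 4 * (lattice_det P Q)\<^sup>2 + (lattice_inner P Q)\<^sup>2"
      using lattice_gram[of P Q] by simp
    finally show ?thesis
      unfolding n X2 W_def by (simp add: power2_eq_square power4_eq_xxxx algebra_simps)
  qed
  then have nn: "norm u * norm v = sqrt (W\<^sup>2 + X\<^sup>2)"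
    by (simp add: norm_eq_sqrt_inner flip: real_sqrt_mult)
  have "1 + (X / W)\<^sup>2 = (W\<^sup>2 + X\<^sup>2) / W\<^sup>2" using W by (simp add: field_simps)
  then have "cos (arctan (X / W)) = W / sqrt (W\<^sup>2 + X\<^sup>2)"
    using W by (simp add: cos_arctan real_sqrt_divide)
  then have "side \<xi> P Q = arccos (cos (arctan (X / W)))"
    by (simp add: side_def vangle_def u_def[symmetric] v_def[symmetric] uv nn)
  also have "\<dots> = arctan (X / W)"
  proof (rule arccos_cos)
    show "arctan (X / W) \<le> pi" using arctan_ubound[of "X / W"] pi_gt_zero by linarith
  qed (use W X0 in simp)
  finally show ?thesis by (simp add: X_def W_def)
qed

lemma arctan_cubic: "((\<lambda>x. (arctan x / x - 1) / x\<^sup>2) \<longlongrightarrow> - 1 / 3) (at_right (0::real))"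
proof -
  have ev: "eventually (\<lambda>x::real. 0 < x) (at_right 0)"
    by (simp add: eventually_at_right_less)
  have "(\<lambda>x::real. (arctan x - x) / x ^ 3) \<rightarrow>\<^sub>0 - 1 / 3"
  proof (rule lhopital_right_0)
    show "(\<lambda>x::real. arctan x - x) \<rightarrow>\<^sub>0 0" "(\<lambda>x::real. x ^ 3) \<rightarrow>\<^sub>0 0"
      by (auto intro!: tendsto_eq_intros)
    show "\<forall>\<^sub>F x::real in at_right 0. ((\<lambda>x. arctan x - x) has_real_derivative (inverse (1 + x\<^sup>2) - 1)) (at x)"
      "\<forall>\<^sub>F x::real in at_right 0. ((\<lambda>x. x ^ 3) has_real_derivative (3 * x\<^sup>2)) (at x)"
      by (auto intro!: always_eventually derivative_eq_intros)
    show "\<forall>\<^sub>F x::real in at_right 0. x ^ 3 \<noteq> 0" "\<forall>\<^sub>F x::real in at_right 0. 3 * x\<^sup>2 \<noteq> 0"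
      by (rule eventually_mono[OF ev]; simp)+
    have "(\<lambda>x::real. - 1 / (3 * (1 + x\<^sup>2))) \<rightarrow>\<^sub>0 - 1 / 3"
      by (auto intro!: tendsto_eq_intros)
    moreover have "\<forall>\<^sub>F x::real in at_right 0. - 1 / (3 * (1 + x\<^sup>2)) = (inverse (1 + x\<^sup>2) - 1) / (3 * x\<^sup>2)"
    proof (rule eventually_mono[OF ev])
      fix x :: real assume "0 < x"
      moreover have "1 + x\<^sup>2 \<noteq> 0" using zero_le_power2[of x] by linarith
      moreover from this have "inverse (1 + x\<^sup>2) - 1 = - x\<^sup>2 / (1 + x\<^sup>2)"
        by (simp add: field_simps)
      ultimately show "- 1 / (3 * (1 + x\<^sup>2)) = (inverse (1 + x\<^sup>2) - 1) / (3 * x\<^sup>2)"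
        by simp
    qed
    ultimately show "(\<lambda>x::real. (inverse (1 + x\<^sup>2) - 1) / (3 * x\<^sup>2)) \<rightarrow>\<^sub>0 - 1 / 3"
      by (rule Lim_transform_eventually)
  qed
  moreover have "\<forall>\<^sub>F x::real in at_right 0. (arctan x - x) / x ^ 3 = (arctan x / x - 1) / x\<^sup>2"
    by (rule eventually_mono[OF ev]) (simp add: field_simps power2_eq_square power3_eq_cube)
  ultimately show ?thesis by (rule Lim_transform_eventually)
qed

lemma eventually_pos: "\<forall>\<^sub>F \<xi>::real in at_right 0. 0 < \<xi>"
  by (simp add: eventually_at_right_less)

lemma tendsto_id0: "(\<lambda>\<xi>::real. \<xi>) \<rightarrow>\<^sub>0 0"
  by (simp add: tendsto_ident_at)

text \<open>With \<open>t = \<xi> S / W\<close> the tangent, the three contributions are the cubic term of the arctangent and the quadratic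
  terms of \<open>S\<close> and \<open>W\<close>.\<close>
lemma side_expansion:
  assumes "adjacent P Q"
  shows "(\<lambda>\<xi>. (side \<xi> P Q / \<xi> - 1) / \<xi>\<^sup>2) \<rightarrow>\<^sub>0 side_coeff P Q"
proof -
  define d where "d = 3 / 4 * (lattice_det P Q)\<^sup>2"
  define s where "s = lattice_inner P Q"
  have d: "0 \<le> d" by (simp add: d_def)
  define S where "S \<xi> = sqrt (1 + d * \<xi>\<^sup>2)" for \<xi>
  define W where "W \<xi> = 1 + \<xi>\<^sup>2 * s" for \<xi>
  define t where "t \<xi> = \<xi> * S \<xi> / W \<xi>" for \<xi>
  have S: "S \<rightarrow>\<^sub>0 1" and W: "W \<rightarrow>\<^sub>0 1"
    unfolding S_def[abs_def] W_def[abs_def] by (auto intro!: tendsto_eq_intros)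
  have Wpos: "\<forall>\<^sub>F \<xi> in at_right 0. 0 < W \<xi>"
    using order_tendstoD(1)[OF W] by simp
  have Spos: "0 < S \<xi>" for \<xi> using d by (simp add: S_def add_pos_nonneg)
  have tpos: "\<forall>\<^sub>F \<xi> in at_right 0. 0 < t \<xi>"
    using Wpos eventually_pos by eventually_elim (simp add: t_def Spos)
  have t0: "t \<rightarrow>\<^sub>0 0"
    unfolding t_def[abs_def] by (rule tendsto_eq_intros tendsto_id0 S W | simp)+
  then have "filterlim t (at_right 0) (at_right 0)"
    unfolding filterlim_at using eventually_mono[OF tpos]
    by (auto simp: eventually_conj_iff)
  then have a: "(\<lambda>\<xi>. (arctan (t \<xi>) / t \<xi> - 1) / (t \<xi>)\<^sup>2) \<rightarrow>\<^sub>0 - 1 / 3"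
    by (rule filterlim_compose[OF arctan_cubic])
  have "(\<lambda>\<xi>. (arctan (t \<xi>) / t \<xi> - 1) / (t \<xi>)\<^sup>2 * (S \<xi> / W \<xi>) ^ 3 + (d / (S \<xi> + 1) - s) / W \<xi>) \<rightarrow>\<^sub>0 - 1 / 3 * (1 / 1) ^ 3 + (d / (1 + 1) - s) / 1"
    by (intro tendsto_intros a S W) simp_all
  also have "- 1 / 3 * (1 / 1) ^ 3 + (d / (1 + 1) - s) / 1 = side_coeff P Q"
    by (simp add: side_coeff_def d_def s_def)
  finally show ?thesis
  proof (rule Lim_transform_eventually)
    show "\<forall>\<^sub>F \<xi> in at_right 0. (arctan (t \<xi>) / t \<xi> - 1) / (t \<xi>)\<^sup>2 * (S \<xi> / W \<xi>) ^ 3 + (d / (S \<xi> + 1) - s) / W \<xi>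
        = (side \<xi> P Q / \<xi> - 1) / \<xi>\<^sup>2"
      using eventually_pos Wpos tpos
    proof eventually_elim
      case (elim \<xi>)
      have "(S \<xi> - 1) * (S \<xi> + 1) = d * \<xi>\<^sup>2"
        using d by (simp add: S_def algebra_simps)
      moreover have "S \<xi> + 1 \<noteq> 0" using Spos[of \<xi>] by linarith
      ultimately have s1: "S \<xi> = 1 + \<xi>\<^sup>2 * (d / (S \<xi> + 1))"
        by (simp add: field_simps)
      have sd: "side \<xi> P Q = arctan (t \<xi>)"
        using side_arctan[OF assms] elim by (simp add: t_def S_def W_def d_def s_def)
      define y where "y = S \<xi> / W \<xi>"
      have y: "0 < y" "t \<xi> = \<xi> * y" using elim Spos by (simp_all add: y_def t_def)
      have "y - 1 = \<xi>\<^sup>2 * ((d / (S \<xi> + 1) - s) / W \<xi>)"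
      proof -
        have "y - 1 = (S \<xi> - W \<xi>) / W \<xi>" using elim by (simp add: y_def field_simps)
        also have "S \<xi> - W \<xi> = \<xi>\<^sup>2 * (d / (S \<xi> + 1) - s)"
          by (subst s1) (simp add: W_def algebra_simps)
        finally show ?thesis by simp
      qed
      then have e: "(d / (S \<xi> + 1) - s) / W \<xi> = (y - 1) / \<xi>\<^sup>2"
        using elim by (simp add: field_simps)
      have "(q / (\<xi> * y) - 1) / (\<xi> * y)\<^sup>2 * y ^ 3 = (q / \<xi> - y) / \<xi>\<^sup>2" for q
      proof -
        have "(q / (\<xi> * y) - 1) / (\<xi> * y)\<^sup>2 * y ^ 3 = (q / (\<xi> * y) - 1) * y / \<xi>\<^sup>2"
          using y by (simp add: power_mult_distrib power2_eq_square power3_eq_cube)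
        also have "(q / (\<xi> * y) - 1) * y = q / \<xi> - y"
          using y elim by (simp add: left_diff_distrib)
        finally show ?thesis .
      qed
      from this[of "arctan (\<xi> * y)"] show ?case
        unfolding e y_def[symmetric] sd y(2) by (simp add: diff_divide_distrib)
    qed
  qed
qed

lemma side_limit:
  assumes "adjacent P Q"
  shows "(\<lambda>\<xi>. side \<xi> P Q / \<xi>) \<rightarrow>\<^sub>0 1"
proof -
  have "(\<lambda>\<xi>. 1 + \<xi>\<^sup>2 * ((side \<xi> P Q / \<xi> - 1) / \<xi>\<^sup>2)) \<rightarrow>\<^sub>0 1 + 0\<^sup>2 * side_coeff P Q"
    by (intro tendsto_intros side_expansion assms)
  then have "(\<lambda>\<xi>. 1 + \<xi>\<^sup>2 * ((side \<xi> P Q / \<xi> - 1) / \<xi>\<^sup>2)) \<rightarrow>\<^sub>0 1"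
    by simp
  moreover have "\<forall>\<^sub>F \<xi> in at_right 0. 1 + \<xi>\<^sup>2 * ((side \<xi> P Q / \<xi> - 1) / \<xi>\<^sup>2) = side \<xi> P Q / \<xi>"
    by (rule eventually_mono[OF eventually_pos]) simp
  ultimately show ?thesis by (rule Lim_transform_eventually)
qed

definition lattice_triangle :: "lattice_point \<Rightarrow> lattice_point \<Rightarrow> lattice_point \<Rightarrow> bool" where
  "lattice_triangle P Q R \<longleftrightarrow> adjacent P Q \<and> adjacent P R \<and> adjacent Q R"

lemma lattice_inner_rot60: "lattice_inner (rot60 v) (rot60 v) = lattice_inner v v"
proof (cases v)
  case (Pair m n)
  then show ?thesis by (simp add: lattice_inner_def field_simps)
qed

lemma lattice_inner_rot60_diff: "lattice_inner (rot60 v - v) (rot60 v - v) = lattice_inner v v"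
proof (cases v)
  case (Pair m n)
  then show ?thesis by (simp add: lattice_inner_def field_simps)
qed

lemma lattice_inner_minus: "lattice_inner (- v) (- v) = lattice_inner v v"
  by (simp add: lattice_inner_def)

lemma lattice_inner_rot60_pow: "lattice_inner ((rot60 ^^ k) v) ((rot60 ^^ k) v) = lattice_inner v v"
proof (induction k)
  case (Suc k)
  then show ?case by (simp only: funpow.simps o_apply lattice_inner_rot60)
qed simp

lemma lattice_triangle_apex:
  assumes "adjacent P Q" "k \<in> {1, 5}"
  shows "lattice_triangle P Q (apex k P Q)"
proof -
  define v where "v = Q - P"
  have v: "lattice_inner v v = 1" using assms(1) by (simp only: adjacent_def v_def)
  have a: "apex k P Q - P = (rot60 ^^ k) v" "apex k P Q - Q = (rot60 ^^ k) v - v"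
    by (simp_all add: apex_def v_def)
  \<comment> \<open>In the complex plane, \<open>rot60\<close> is multiplication by a primitive sixth root of unity \<open>\<zeta>\<close>, and \<open>\<zeta>\<^sup>5 - 1 = - \<zeta>\<close>.\<close>
  have five: "(rot60 ^^ 5) v - v = - rot60 v"
    by (cases v) (simp add: eval_nat_numeral)
  have "lattice_inner ((rot60 ^^ k) v - v) ((rot60 ^^ k) v - v) = 1"
    using assms(2)
  proof
    assume "k = 1"
    then show ?thesis by (simp only: One_nat_def funpow.simps o_id lattice_inner_rot60_diff v)
  next
    assume "k \<in> {5}"
    then have "k = 5" by simp
    then show ?thesis by (simp only: five lattice_inner_minus lattice_inner_rot60 v)
  qed
  then show ?thesis
    using assms(1) by (simp only: lattice_triangle_def adjacent_def a lattice_inner_rot60_pow v simp_thms)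
qed

lemma lattice_triangle_neighbours: "lattice_triangle P (neighbour k P) (neighbour (Suc k) P)"
proof -
  define v where "v = (rot60 ^^ k) (1, 0)"
  have v: "lattice_inner v v = 1"
    unfolding v_def lattice_inner_rot60_pow by (simp add: lattice_inner_def)
  have n: "neighbour k P - P = v" "neighbour (Suc k) P - P = rot60 v" 
    "neighbour (Suc k) P - neighbour k P = rot60 v - v"
    by (simp_all add: neighbour_def v_def)
  show ?thesis
    unfolding lattice_triangle_def adjacent_def n lattice_inner_rot60 lattice_inner_rot60_diff v by simp
qed

lemma neighbour_simps:
  "neighbour 0 (m, n) = (m + 1, n)" "neighbour (Suc 0) (m, n) = (m, n + 1)" "neighbour 2 (m, n) = (m - 1, n + 1)"
  "neighbour 3 (m, n) = (m - 1, n)" "neighbour 4 (m, n) = (m, n - 1)" "neighbour 5 (m, n) = (m + 1, n - 1)"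
  "neighbour 6 (m, n) = (m + 1, n)"
  by (simp_all add: neighbour_def eval_nat_numeral)

text \<open>This sum determines the angle defect of the triangulated sphere. It does not depend on the vertex \<open>P\<close>, although
  the lattice is projected from the tangent plane at \<open>O\<close> and the individual coefficients do depend on it: by Legendre's
  theorem, the angles of a flat and of a spherical triangle with the same sides differ by a third of the area, and the
  spherical angles around \<open>P\<close> add up to \<open>2 * pi\<close>.\<close>
lemma side_coeff_star:
  "(\<Sum>k<6. side_coeff P (neighbour k P) + side_coeff P (neighbour (Suc k) P)
      - 2 * side_coeff (neighbour k P) (neighbour (Suc k) P)) = 3 / 2"
proof (cases P)
  case (Pair m n)
  have six: "(\<Sum>k<6. g k) = g 0 + g (Suc 0) + g 2 + g 3 + g 4 + g 5" for g :: "nat \<Rightarrow> real"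
    by (simp add: eval_nat_numeral)
  have Suc: "Suc (Suc 0) = 2" "Suc 2 = 3" "Suc 3 = 4" "Suc 4 = 5" "Suc 5 = 6" by simp_all
  define x y where "x = real_of_int m" and "y = real_of_int n"
  show ?thesis
    unfolding six Suc Pair neighbour_simps side_coeff_def lattice_det_def lattice_inner_def
    by (simp add: x_def[symmetric] y_def[symmetric]) (simp add: power2_eq_square field_simps)
qed

lemma heron_scale: "0 < s \<Longrightarrow> heron (s * c) (s * b) (s * a) = s ^ 4 * heron c b a"
  by (simp add: heron_def power_mult_distrib power2_eq_square power4_eq_xxxx algebra_simps)

lemma sqrt_power4: "0 < s \<Longrightarrow> sqrt (s ^ 4 * x) = s\<^sup>2 * sqrt x"
proof -
  have "s ^ 4 = (s\<^sup>2)\<^sup>2" by simp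
  then show "sqrt (s ^ 4 * x) = s\<^sup>2 * sqrt x"
    by (simp only: real_sqrt_mult real_sqrt_abs) simp
qed

lemma circumradius_scale: "0 < s \<Longrightarrow> circumradius (s * c) (s * b) (s * a) = s * circumradius c b a"
  by (simp add: circumradius_def heron_scale sqrt_power4) (simp add: power2_eq_square)

locale shrinking_triangle =
  fixes P Q R :: lattice_point
  assumes triangle: "lattice_triangle P Q R"
begin

abbreviation c where "c \<xi> \<equiv> side \<xi> P Q"
abbreviation b where "b \<xi> \<equiv> side \<xi> P R"
abbreviation a where "a \<xi> \<equiv> side \<xi> Q R"

lemma sides_limit:
  "(\<lambda>\<xi>. c \<xi> / \<xi>) \<rightarrow>\<^sub>0 1" "(\<lambda>\<xi>. b \<xi> / \<xi>) \<rightarrow>\<^sub>0 1"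
  "(\<lambda>\<xi>. a \<xi> / \<xi>) \<rightarrow>\<^sub>0 1"
  using triangle by (auto simp: lattice_triangle_def intro: side_limit)

lemma eventually_acute: "\<forall>\<^sub>F \<xi> in at_right 0. acute_triangle (c \<xi>) (b \<xi>) (a \<xi>)"
proof -
  have sq: "\<forall>\<^sub>F \<xi> in at_right 0. (u \<xi>)\<^sup>2 < (v \<xi>)\<^sup>2 + (w \<xi>)\<^sup>2"
    if "(\<lambda>\<xi>. u \<xi> / \<xi>) \<rightarrow>\<^sub>0 1" "(\<lambda>\<xi>. v \<xi> / \<xi>) \<rightarrow>\<^sub>0 1"
      "(\<lambda>\<xi>. w \<xi> / \<xi>) \<rightarrow>\<^sub>0 1" for u v w :: "real \<Rightarrow> real"
  proof -
    have "(\<lambda>\<xi>. (v \<xi> / \<xi>)\<^sup>2 + (w \<xi> / \<xi>)\<^sup>2 - (u \<xi> / \<xi>)\<^sup>2) \<rightarrow>\<^sub>0 1\<^sup>2 + 1\<^sup>2 - 1\<^sup>2"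
      by (intro tendsto_intros that)
    from order_tendstoD(1)[OF this, of 0]
    have "\<forall>\<^sub>F \<xi> in at_right 0. 0 < (v \<xi> / \<xi>)\<^sup>2 + (w \<xi> / \<xi>)\<^sup>2 - (u \<xi> / \<xi>)\<^sup>2" by simp
    then show ?thesis
      using eventually_pos
    proof eventually_elim
      case (elim \<xi>)
      have "(v \<xi> / \<xi>)\<^sup>2 + (w \<xi> / \<xi>)\<^sup>2 - (u \<xi> / \<xi>)\<^sup>2 = ((v \<xi>)\<^sup>2 + (w \<xi>)\<^sup>2 - (u \<xi>)\<^sup>2) / \<xi>\<^sup>2"
        by (simp add: power_divide add_divide_distrib diff_divide_distrib)
      with elim show ?case by (simp add: zero_less_divide_iff)
    qed
  qed
  have pos: "\<forall>\<^sub>F \<xi> in at_right 0. 0 < u \<xi>" if "(\<lambda>\<xi>. u \<xi> / \<xi>) \<rightarrow>\<^sub>0 1" for u :: "real \<Rightarrow> real"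
  proof -
    have "\<forall>\<^sub>F \<xi> in at_right 0. 0 < u \<xi> / \<xi>" using order_tendstoD(1)[OF that, of 0] by simp
    then show ?thesis
      using eventually_pos by eventually_elim (simp add: zero_less_divide_iff)
  qed
  note l = sides_limit
  show ?thesis
    using pos[OF l(1)] pos[OF l(2)] pos[OF l(3)] sq[OF l(3,2,1)] sq[OF l(2,1,3)] sq[OF l(1,3,2)]
    by eventually_elim (simp add: acute_triangle_def)
qed

lemma heron_limit: "(\<lambda>\<xi>. heron (c \<xi> / \<xi>) (b \<xi> / \<xi>) (a \<xi> / \<xi>)) \<rightarrow>\<^sub>0 3"
  unfolding heron_def by (rule tendsto_eq_rhs, (rule tendsto_intros sides_limit)+) simp

lemma circumradius_limit: "(\<lambda>\<xi>. circumradius (c \<xi>) (b \<xi>) (a \<xi>) / \<xi>) \<rightarrow>\<^sub>0 1 / sqrt 3"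
proof -
  have "(\<lambda>\<xi>. circumradius (c \<xi> / \<xi>) (b \<xi> / \<xi>) (a \<xi> / \<xi>)) \<rightarrow>\<^sub>0 1 * 1 * 1 / sqrt 3"
    unfolding circumradius_def by (intro tendsto_intros sides_limit heron_limit) simp
  then show ?thesis
  proof (rule Lim_transform_eventually[OF tendsto_eq_rhs])
    show "\<forall>\<^sub>F \<xi> in at_right 0. circumradius (c \<xi> / \<xi>) (b \<xi> / \<xi>) (a \<xi> / \<xi>) = circumradius (c \<xi>) (b \<xi>) (a \<xi>) / \<xi>"
      using eventually_pos
    proof eventually_elim
      case (elim \<xi>)
      then show ?case using circumradius_scale[OF elim, of "c \<xi> / \<xi>" "b \<xi> / \<xi>" "a \<xi> / \<xi>"] by simp
    qed
  qed simp
qed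

end

section \<open>One block at small resolution\<close>

text \<open>A first order expansion of \<open>u\<close> at \<open>y\<close> passes through a differentiable function, at any rate \<open>s\<close>.\<close>
lemma tendsto_chain:
  fixes g :: "real \<Rightarrow> real"
  assumes g: "(g has_real_derivative d) (at y)"
    and u: "((\<lambda>x. (u x - y) / s x) \<longlongrightarrow> L) F" and s: "(s \<longlongrightarrow> 0) F" and s0: "\<forall>\<^sub>F x in F. s x \<noteq> 0"
  shows "((\<lambda>x. (g (u x) - g y) / s x) \<longlongrightarrow> d * L) F"
proof -
  obtain q where q: "\<And>z. g z - g y = q z * (z - y)" "isCont q y" "q y = d"
    using g unfolding CARAT_DERIV by blast
  have "((\<lambda>x. y + s x * ((u x - y) / s x)) \<longlongrightarrow> y + 0 * L) F"
    by (intro tendsto_intros s u)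
  then have "((\<lambda>x. y + s x * ((u x - y) / s x)) \<longlongrightarrow> y) F" by simp
  moreover have "\<forall>\<^sub>F x in F. y + s x * ((u x - y) / s x) = u x"
    by (rule eventually_mono[OF s0]) simp
  ultimately have "((\<lambda>x. u x) \<longlongrightarrow> y) F" by (rule Lim_transform_eventually)
  then have "((\<lambda>x. q (u x)) \<longlongrightarrow> d) F"
    using isCont_tendsto_compose[OF q(2)] q(3) by auto
  then have "((\<lambda>x. q (u x) * ((u x - y) / s x)) \<longlongrightarrow> d * L) F"
    by (intro tendsto_intros u)
  then show ?thesis by (simp add: q(1))
qed

lemma tendsto_unscale:
  assumes "(\<lambda>\<xi>. g \<xi> / \<xi>) \<rightarrow>\<^sub>0 L"
  shows "g \<rightarrow>\<^sub>0 (0::real)"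
proof -
  have "(\<lambda>\<xi>. \<xi> * (g \<xi> / \<xi>)) \<rightarrow>\<^sub>0 0 * L"
    by (intro tendsto_intros assms tendsto_id0)
  then have "(\<lambda>\<xi>. \<xi> * (g \<xi> / \<xi>)) \<rightarrow>\<^sub>0 0" by simp
  moreover have "\<forall>\<^sub>F \<xi> in at_right 0. \<xi> * (g \<xi> / \<xi>) = g \<xi>"
    by (rule eventually_mono[OF eventually_pos]) simp
  ultimately show ?thesis by (rule Lim_transform_eventually)
qed

lemma tendsto_eventually_eq:
  assumes "(g \<longlongrightarrow> L) F" "\<forall>\<^sub>F x in F. g' x = g x" "L = L'"
  shows "(g' \<longlongrightarrow> L') F"
  using tendsto_cong[OF assms(2)] assms(1,3) by blast

text \<open>A block whose sections are kept while the resolution tends to zero: it becomes a thin column of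
  height \<open>A\<close>.\<close>
locale shrinking_block = shrinking_triangle +
  fixes r0 r1 A :: real and G :: "real \<Rightarrow> frustum_lattice" and i :: nat
  assumes pos: "0 < r0" "0 < r1" "0 < A"
    and lattice: "\<And>\<xi>. 0 < \<xi> \<Longrightarrow> resolution (G \<xi>) = \<xi>"
      "\<And>\<xi>. 0 < \<xi> \<Longrightarrow> radius (G \<xi>) i = r0" "\<And>\<xi>. 0 < \<xi> \<Longrightarrow> radius (G \<xi>) (Suc i) = r1"
      "\<And>\<xi>. 0 < \<xi> \<Longrightarrow> axial (G \<xi>) i = A"
begin

abbreviation "rc \<xi> \<equiv> circumradius (c \<xi>) (b \<xi>) (a \<xi>)"
abbreviation "h \<xi> \<equiv> frustum_shape.h r0 r1 A (c \<xi>) (b \<xi>) (a \<xi>)"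
abbreviation "z \<xi> \<equiv> frustum_shape.z r0 r1 A (c \<xi>) (b \<xi>) (a \<xi>)"
abbreviation "H l \<equiv> frustum_shape.H r0 r1 A l"
abbreviation "apo \<xi> l \<equiv> frustum_shape.apo (c \<xi>) (b \<xi>) (a \<xi>) l"
abbreviation "\<tau> l \<equiv> frustum_shape.\<tau> r0 r1 A l"
abbreviation "f \<xi> l \<equiv> frustum_shape.f r0 r1 A (c \<xi>) (b \<xi>) (a \<xi>) l"
abbreviation "\<kappa> l \<equiv> frustum_shape.\<kappa> r0 r1 A l"

lemma rc0: "rc \<rightarrow>\<^sub>0 0"
  by (rule tendsto_unscale[OF circumradius_limit])

lemma sides0: "c \<rightarrow>\<^sub>0 0" "b \<rightarrow>\<^sub>0 0"
  by (fact tendsto_unscale[OF sides_limit(1)] tendsto_unscale[OF sides_limit(2)])+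

lemma eventually_block:
  "\<forall>\<^sub>F \<xi> in at_right 0. frustum_block r0 r1 A (c \<xi>) (b \<xi>) (a \<xi>) (G \<xi>) i P Q R"
proof -
  have "(\<lambda>\<xi>. 2 * (rc \<xi>)\<^sup>2 * \<bar>r1 - r0\<bar> * (r0 + r1)) \<rightarrow>\<^sub>0 2 * 0\<^sup>2 * \<bar>r1 - r0\<bar> * (r0 + r1)"
    by (intro tendsto_intros rc0)
  from order_tendstoD(2)[OF this, of "A\<^sup>2"]
  have "\<forall>\<^sub>F \<xi> in at_right 0. 2 * (rc \<xi>)\<^sup>2 * \<bar>r1 - r0\<bar> * (r0 + r1) < A\<^sup>2"
    using pos by simp
  then show ?thesis
    using eventually_acute eventually_pos
    by eventually_elim (unfold_locales; simp add: pos lattice)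
qed

lemma h_limit: "h \<rightarrow>\<^sub>0 A"
proof -
  have "h \<rightarrow>\<^sub>0 sqrt (A\<^sup>2 - ((r1 - r0) * 0)\<^sup>2)"
    unfolding frustum_shape.h_def frustum_shape.D_def frustum_shape.Rc_def
    by (intro tendsto_intros rc0)
  then show ?thesis using pos by simp
qed

lemma z_limit: "z \<rightarrow>\<^sub>0 A / 2"
proof -
  have "z \<rightarrow>\<^sub>0 (A\<^sup>2 + 2 * 0\<^sup>2 * (r1 - r0) * r0) / (2 * A)"
    unfolding frustum_shape.z_def frustum_shape.D_def frustum_shape.Rc_def
    by (intro tendsto_intros rc0 h_limit) (use pos in simp)
  then show ?thesis using pos by (simp add: power2_eq_square)
qed

lemma H_limit:
  assumes "l \<rightarrow>\<^sub>0 0"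
  shows "(\<lambda>\<xi>. H (l \<xi>)) \<rightarrow>\<^sub>0 A"
proof -
  have "(\<lambda>\<xi>. H (l \<xi>)) \<rightarrow>\<^sub>0 sqrt (A\<^sup>2 - ((r1 - r0) * 0 / 2)\<^sup>2)"
    unfolding frustum_shape.H_def frustum_shape.D_def by (intro tendsto_intros assms) simp
  then show ?thesis using pos by simp
qed

lemma tau_limit: "(\<lambda>\<xi>. \<tau> (c \<xi>)) \<rightarrow>\<^sub>0 1 / 2"
proof -
  have "(\<lambda>\<xi>. \<tau> (c \<xi>)) \<rightarrow>\<^sub>0 1 / 2 + (r1\<^sup>2 - r0\<^sup>2) * 0\<^sup>2 / (8 * A\<^sup>2)"
    unfolding frustum_shape.\<tau>_def by (intro tendsto_intros H_limit sides0) (use pos in simp)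
  then show ?thesis by simp
qed

lemma f_limit:
  assumes "l \<rightarrow>\<^sub>0 0"
  shows "(\<lambda>\<xi>. f \<xi> (l \<xi>)) \<rightarrow>\<^sub>0 (r0 + r1) / 2"
proof -
  have "(\<lambda>\<xi>. f \<xi> (l \<xi>)) \<rightarrow>\<^sub>0 (r0 + r1) * A\<^sup>2 / (2 * A * A)"
    unfolding frustum_shape.f_def by (intro tendsto_intros H_limit h_limit assms) (use pos in simp)
  then show ?thesis using pos by (simp add: power2_eq_square)
qed

lemma sqrt_twelfth: "sqrt (1 / 12) = 1 / (2 * sqrt 3)"
  by (rule real_sqrt_unique) (simp_all add: power_divide power_mult_distrib)

lemma apo_limit:
  assumes "(\<lambda>\<xi>. l \<xi> / \<xi>) \<rightarrow>\<^sub>0 1"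
  shows "(\<lambda>\<xi>. apo \<xi> (l \<xi>) / \<xi>) \<rightarrow>\<^sub>0 1 / (2 * sqrt 3)"
proof (rule tendsto_eventually_eq)
  show "(\<lambda>\<xi>. sqrt ((rc \<xi> / \<xi>)\<^sup>2 - (l \<xi> / \<xi> / 2)\<^sup>2)) \<rightarrow>\<^sub>0 sqrt ((1 / sqrt 3)\<^sup>2 - (1 / 2)\<^sup>2)"
    by (rule tendsto_real_sqrt[OF tendsto_diff[OF tendsto_power[OF circumradius_limit]
          tendsto_power[OF tendsto_divide[OF assms tendsto_const]]]]) simp
  show "\<forall>\<^sub>F \<xi> in at_right 0. apo \<xi> (l \<xi>) / \<xi> = sqrt ((rc \<xi> / \<xi>)\<^sup>2 - (l \<xi> / \<xi> / 2)\<^sup>2)"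
    using eventually_pos
  proof eventually_elim
    case (elim \<xi>)
    have "(rc \<xi> / \<xi>)\<^sup>2 - (l \<xi> / \<xi> / 2)\<^sup>2 = ((rc \<xi>)\<^sup>2 - (l \<xi> / 2)\<^sup>2) / \<xi>\<^sup>2"
      by (simp add: power_divide diff_divide_distrib)
    then show ?case
      using elim by (simp add: frustum_shape.apo_def frustum_shape.Rc_def real_sqrt_divide)
  qed
  show "sqrt ((1 / sqrt 3)\<^sup>2 - (1 / 2)\<^sup>2) = 1 / (2 * sqrt 3)"
    unfolding sqrt_twelfth[symmetric] by (simp add: power_divide)
qed

lemma arctan_limit:
  "(\<lambda>\<xi>. arctan ((r1 - r0) * apo \<xi> (c \<xi>) / h \<xi>) / \<xi>) \<rightarrow>\<^sub>0 (r1 - r0) / A / (2 * sqrt 3)"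
proof -
  have "(\<lambda>\<xi>. (r1 - r0) * (apo \<xi> (c \<xi>) / \<xi>) / h \<xi>) \<rightarrow>\<^sub>0 (r1 - r0) * (1 / (2 * sqrt 3)) / A"
    by (intro tendsto_intros apo_limit sides_limit h_limit) (use pos in simp)
  then have *: "(\<lambda>\<xi>. ((r1 - r0) * apo \<xi> (c \<xi>) / h \<xi> - 0) / \<xi>) \<rightarrow>\<^sub>0 (r1 - r0) / A / (2 * sqrt 3)"
    by (simp add: ac_simps)
  have "(arctan has_real_derivative 1) (at 0)"
    by (auto intro!: derivative_eq_intros)
  moreover have "\<forall>\<^sub>F \<xi>::real in at_right 0. \<xi> \<noteq> 0"
    by (rule eventually_mono[OF eventually_pos]) simp
  ultimately show ?thesis
    using tendsto_chain[OF _ * tendsto_id0] by fastforce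
qed

abbreviation "base \<xi> \<equiv> sec_tri (G \<xi>) i P Q R"
abbreviation "roof \<xi> \<equiv> upper_tri (G \<xi>) i P Q R"
abbreviation "base_center \<xi> \<equiv> sec_center (G \<xi>) i P Q R"
abbreviation "roof_center \<xi> \<equiv> upper_center (G \<xi>) i P Q R"
abbreviation "center \<xi> \<equiv> block_center (G \<xi>) i P Q R"
abbreviation "side_center \<xi> \<equiv> lateral_center (G \<xi>) i P Q R 0 (Suc 0)"

lemma angle_above_limit:
  assumes s: "\<And>\<xi>. 0 < \<xi> \<Longrightarrow> i \<noteq> sections (G \<xi>)"
  shows "(\<lambda>\<xi>. (angle_above (G \<xi>) i P Q R - pi / 2) / \<xi>) \<rightarrow>\<^sub>0 (r1 - r0) / A / (2 * sqrt 3)"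
  by (rule tendsto_eventually_eq[OF arctan_limit eventually_elim2[OF eventually_block eventually_pos] refl])
    (simp add: frustum_block.angle_above_eq[OF _ s] frustum_shape.D_def)

lemma angle_below_limit:
  assumes s: "i \<noteq> 0"
  shows "(\<lambda>\<xi>. (angle_below (G \<xi>) (Suc i) P Q R - pi / 2) / \<xi>) \<rightarrow>\<^sub>0 - ((r1 - r0) / A / (2 * sqrt 3))"
  by (rule tendsto_eventually_eq[OF tendsto_minus[OF arctan_limit] eventually_mono[OF eventually_block] refl])
    (simp add: frustum_block.angle_below_eq[OF _ s] frustum_shape.D_def)

lemma area_above_limit:
  assumes s: "\<And>\<xi>. 0 < \<xi> \<Longrightarrow> i \<noteq> sections (G \<xi>)"
  shows "(\<lambda>\<xi>. area_above (G \<xi>) i P Q R / \<xi>) \<rightarrow>\<^sub>0 A * (3 * r0 + r1) / (16 * sqrt 3)"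
proof (rule tendsto_eventually_eq)
  show "(\<lambda>\<xi>. apo \<xi> (c \<xi>) / \<xi> * (r0 * z \<xi> + \<bar>\<tau> (c \<xi>)\<bar> * H (c \<xi>) * f \<xi> (c \<xi>)) / 2) \<rightarrow>\<^sub>0 1 / (2 * sqrt 3) * (r0 * (A / 2) + \<bar>1 / 2\<bar> * A * ((r0 + r1) / 2)) / 2"
    by (intro tendsto_intros apo_limit sides_limit z_limit tau_limit H_limit f_limit sides0) simp
  show "\<forall>\<^sub>F \<xi> in at_right 0. area_above (G \<xi>) i P Q R / \<xi>
      = apo \<xi> (c \<xi>) / \<xi> * (r0 * z \<xi> + \<bar>\<tau> (c \<xi>)\<bar> * H (c \<xi>) * f \<xi> (c \<xi>)) / 2"
    using eventually_block eventually_pos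
    by eventually_elim (simp add: frustum_block.area_above_eq[OF _ s])
qed (simp add: field_simps)

lemma area_below_limit:
  assumes s: "i \<noteq> 0"
  shows "(\<lambda>\<xi>. area_below (G \<xi>) (Suc i) P Q R / \<xi>) \<rightarrow>\<^sub>0 A * (r0 + 3 * r1) / (16 * sqrt 3)"
proof (rule tendsto_eventually_eq)
  show "(\<lambda>\<xi>. apo \<xi> (c \<xi>) / \<xi> * (r1 * (h \<xi> - z \<xi>) + \<bar>1 - \<tau> (c \<xi>)\<bar> * H (c \<xi>) * f \<xi> (c \<xi>)) / 2) \<rightarrow>\<^sub>0 1 / (2 * sqrt 3) * (r1 * (A - A / 2) + \<bar>1 - 1 / 2\<bar> * A * ((r0 + r1) / 2)) / 2"
    by (intro tendsto_intros apo_limit sides_limit z_limit h_limit tau_limit H_limit f_limit sides0) simp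
  show "\<forall>\<^sub>F \<xi> in at_right 0. area_below (G \<xi>) (Suc i) P Q R / \<xi>
      = apo \<xi> (c \<xi>) / \<xi> * (r1 * (h \<xi> - z \<xi>) + \<bar>1 - \<tau> (c \<xi>)\<bar> * H (c \<xi>) * f \<xi> (c \<xi>)) / 2"
    using eventually_block eventually_pos
    by eventually_elim (simp add: frustum_block.area_below_eq[OF _ s])
qed (simp add: field_simps)

lemma block_limitI:
  assumes "g \<rightarrow>\<^sub>0 l" "l = l'"
    and "\<And>\<xi>. frustum_block r0 r1 A (c \<xi>) (b \<xi>) (a \<xi>) (G \<xi>) i P Q R \<Longrightarrow> g' \<xi> = g \<xi>"
  shows "g' \<rightarrow>\<^sub>0 l'"
  by (rule tendsto_eventually_eq[OF assms(1) eventually_mono[OF eventually_block assms(3)] assms(2)])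

lemma dist_center_base_limit: "(\<lambda>\<xi>. dist (center \<xi>) (base_center \<xi>)) \<rightarrow>\<^sub>0 A / 2"
  by (rule block_limitI[OF z_limit refl]) (rule frustum_block.dist_block_sec)

lemma dist_center_roof_limit: "(\<lambda>\<xi>. dist (center \<xi>) (roof_center \<xi>)) \<rightarrow>\<^sub>0 A / 2"
  by (rule block_limitI[OF tendsto_diff[OF h_limit z_limit]]) (simp_all add: frustum_block.dist_block_upper)

lemma dist_center_side_limit:
  "(\<lambda>\<xi>. dist (center \<xi>) (side_center \<xi>) / \<xi>) \<rightarrow>\<^sub>0 (r0 + r1) / (4 * sqrt 3)"
  by (rule block_limitI[OF tendsto_mult[OF apo_limit[OF sides_limit(1)] f_limit[OF sides0(1)]]])
    (simp_all add: frustum_block.dist_block_lateral01)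

lemma base_moment_limit:
  "(\<lambda>\<xi>. dist (midpoint (base \<xi> 0) (base \<xi> (Suc 0))) (base_center \<xi>) / \<xi>) \<rightarrow>\<^sub>0 r0 / (2 * sqrt 3)"
  by (rule block_limitI[OF tendsto_mult[OF tendsto_const[of r0] apo_limit[OF sides_limit(1)]]])
    (simp_all add: frustum_block.dist_midpoint_center)

lemma side_moment_limits:
  "(\<lambda>\<xi>. dist (midpoint (base \<xi> 0) (base \<xi> (Suc 0))) (side_center \<xi>)) \<rightarrow>\<^sub>0 A / 2"
  "(\<lambda>\<xi>. dist (midpoint (roof \<xi> 0) (roof \<xi> (Suc 0))) (side_center \<xi>)) \<rightarrow>\<^sub>0 A / 2"
  by (rule block_limitI[OF tendsto_mult[OF tendsto_rabs[OF tau_limit] H_limit[OF sides0(1)]]]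
      block_limitI[OF tendsto_mult[OF tendsto_rabs[OF tendsto_diff[OF tendsto_const[of 1] tau_limit]] H_limit[OF sides0(1)]]],
      simp_all add: frustum_block.dist_midpoint_lateral)+

lemma axial_moment_limits:
  "(\<lambda>\<xi>. dist (midpoint (base \<xi> 0) (roof \<xi> 0)) (side_center \<xi>) / \<xi>) \<rightarrow>\<^sub>0 (r0 + r1) / 4"
  "(\<lambda>\<xi>. dist (midpoint (base \<xi> (Suc 0)) (roof \<xi> (Suc 0))) (side_center \<xi>) / \<xi>) \<rightarrow>\<^sub>0 (r0 + r1) / 4"
proof -
  have *: "(\<lambda>\<xi>. (r0 + r1) * (c \<xi> / \<xi>) * A / (4 * H (c \<xi>))) \<rightarrow>\<^sub>0 (r0 + r1) * 1 * A / (4 * A)"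
    by (intro tendsto_intros sides_limit H_limit sides0) (use pos in simp)
  show "(\<lambda>\<xi>. dist (midpoint (base \<xi> 0) (roof \<xi> 0)) (side_center \<xi>) / \<xi>) \<rightarrow>\<^sub>0 (r0 + r1) / 4"
    "(\<lambda>\<xi>. dist (midpoint (base \<xi> (Suc 0)) (roof \<xi> (Suc 0))) (side_center \<xi>) / \<xi>) \<rightarrow>\<^sub>0 (r0 + r1) / 4"
    by (rule block_limitI[OF *], use pos in \<open>simp_all add: frustum_block.dist_axial_midpoint_lateral\<close>)+
qed

lemma axial_kite_limit:
  "(\<lambda>\<xi>. kite_area (midpoint (base \<xi> 0) (roof \<xi> 0))
      (side_center \<xi>) (center \<xi>) (lateral_center (G \<xi>) i P Q R 0 2) / \<xi>\<^sup>2) \<rightarrow>\<^sub>0 (r0 + r1)\<^sup>2 / (16 * sqrt 3)"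
proof (rule tendsto_eventually_eq)
  let ?g = "\<lambda>l \<xi>. (r0 + r1) * (l \<xi> / \<xi>) * A / (4 * H (l \<xi>)) * (apo \<xi> (l \<xi>) / \<xi> * f \<xi> (l \<xi>))"
  show "(\<lambda>\<xi>. (?g c \<xi> + ?g b \<xi>) / 2) \<rightarrow>\<^sub>0 ((r0 + r1) * 1 * A / (4 * A) * (1 / (2 * sqrt 3) * ((r0 + r1) / 2)) + (r0 + r1) * 1 * A / (4 * A) * (1 / (2 * sqrt 3) * ((r0 + r1) / 2))) / 2"
    by (intro tendsto_intros sides_limit H_limit sides0 apo_limit f_limit) (use pos in simp_all)
  show "\<forall>\<^sub>F \<xi> in at_right 0. kite_area (midpoint (base \<xi> 0) (roof \<xi> 0))
      (side_center \<xi>) (center \<xi>) (lateral_center (G \<xi>) i P Q R 0 2) / \<xi>\<^sup>2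
      = (?g c \<xi> + ?g b \<xi>) / 2"
    using eventually_block
    by eventually_elim (simp add: frustum_block.axial_kite_eq power2_eq_square add_divide_distrib ac_simps)
  show "((r0 + r1) * 1 * A / (4 * A) * (1 / (2 * sqrt 3) * ((r0 + r1) / 2)) + (r0 + r1) * 1 * A / (4 * A) * (1 / (2 * sqrt 3) * ((r0 + r1) / 2))) / 2
     = (r0 + r1)\<^sup>2 / (16 * sqrt 3)"
    using pos by (simp add: power2_eq_square)
qed

lemma kappa_limit:
  assumes "(\<lambda>\<xi>. l \<xi> / \<xi>) \<rightarrow>\<^sub>0 1"
  shows "(\<lambda>\<xi>. \<kappa> (l \<xi>) / \<xi>) \<rightarrow>\<^sub>0 (r1 - r0) / (2 * A)"
proof -
  have "(\<lambda>\<xi>. (r1 - r0) * (l \<xi> / \<xi>) / (2 * A)) \<rightarrow>\<^sub>0 (r1 - r0) * 1 / (2 * A)"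
    by (intro tendsto_intros assms) (use pos in simp)
  then show ?thesis by (simp add: frustum_shape.\<kappa>_def frustum_shape.D_def ac_simps)
qed

text \<open>By the law of cosines, only the second order coefficients of the sides matter.\<close>
lemma cos_limit:
  "(\<lambda>\<xi>. (((b \<xi>)\<^sup>2 + (c \<xi>)\<^sup>2 - (a \<xi>)\<^sup>2) / (2 * b \<xi> * c \<xi>) - 1 / 2) / \<xi>\<^sup>2) \<rightarrow>\<^sub>0 (side_coeff P Q + side_coeff P R - 2 * side_coeff Q R) / 2"
proof (rule tendsto_eventually_eq)
  let ?e = "\<lambda>l \<xi>. (l \<xi> / \<xi> - 1) / \<xi>\<^sup>2"
  have e: "?e c \<rightarrow>\<^sub>0 side_coeff P Q" "?e b \<rightarrow>\<^sub>0 side_coeff P R"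
    "?e a \<rightarrow>\<^sub>0 side_coeff Q R"
    using triangle by (auto simp: lattice_triangle_def intro: side_expansion)
  let ?q = "\<lambda>l \<xi>. ?e l \<xi> * (l \<xi> / \<xi> + 1)"
  let ?g = "\<lambda>\<xi>. (?q b \<xi> + ?q c \<xi> - ?q a \<xi> - (?e b \<xi> * (c \<xi> / \<xi>) + ?e c \<xi>)) / (2 * (b \<xi> / \<xi>) * (c \<xi> / \<xi>))"
  show "?g \<rightarrow>\<^sub>0 (side_coeff P R * (1 + 1) + side_coeff P Q * (1 + 1) - side_coeff Q R * (1 + 1)
      - (side_coeff P R * 1 + side_coeff P Q)) / (2 * 1 * 1)"
    by (intro tendsto_intros e sides_limit) simp
  show "\<forall>\<^sub>F \<xi> in at_right 0. (((b \<xi>)\<^sup>2 + (c \<xi>)\<^sup>2 - (a \<xi>)\<^sup>2) / (2 * b \<xi> * c \<xi>) - 1 / 2) / \<xi>\<^sup>2 = ?g \<xi>"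
    using eventually_pos eventually_acute
  proof eventually_elim
    case (elim \<xi>)
    define x y w where "x = b \<xi> / \<xi>" and "y = c \<xi> / \<xi>" and "w = a \<xi> / \<xi>"
    have xy: "0 < x" "0 < y" using elim by (simp_all add: x_def y_def acute_triangle_def)
    have bca: "b \<xi> = \<xi> * x" "c \<xi> = \<xi> * y" "a \<xi> = \<xi> * w" using elim by (simp_all add: x_def y_def w_def)
    have g: "?g \<xi> = ((x - 1) / \<xi>\<^sup>2 * (x + 1) + (y - 1) / \<xi>\<^sup>2 * (y + 1) - (w - 1) / \<xi>\<^sup>2 * (w + 1)
         - ((x - 1) / \<xi>\<^sup>2 * y + (y - 1) / \<xi>\<^sup>2)) / (2 * x * y)"
      by (simp only: x_def y_def w_def)
    also have "\<dots> = (x\<^sup>2 + y\<^sup>2 - w\<^sup>2 - x * y) / \<xi>\<^sup>2 / (2 * x * y)"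
    proof -
      have "(x - 1) / \<xi>\<^sup>2 * (x + 1) + (y - 1) / \<xi>\<^sup>2 * (y + 1) - (w - 1) / \<xi>\<^sup>2 * (w + 1)
         - ((x - 1) / \<xi>\<^sup>2 * y + (y - 1) / \<xi>\<^sup>2)
         = ((x - 1) * (x + 1) + (y - 1) * (y + 1) - (w - 1) * (w + 1) - ((x - 1) * y + (y - 1))) / \<xi>\<^sup>2"
        unfolding times_divide_eq_left by (simp only: add_divide_distrib diff_divide_distrib)
      also have "(x - 1) * (x + 1) + (y - 1) * (y + 1) - (w - 1) * (w + 1) - ((x - 1) * y + (y - 1)) = x\<^sup>2 + y\<^sup>2 - w\<^sup>2 - x * y"
        by (simp add: power2_eq_square algebra_simps)
      finally show ?thesis by simp
    qed
    also have "\<dots> = ((x\<^sup>2 + y\<^sup>2 - w\<^sup>2) / (2 * x * y) - 1 / 2) / \<xi>\<^sup>2"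
      using elim xy by (simp add: field_simps)
    also have "(x\<^sup>2 + y\<^sup>2 - w\<^sup>2) / (2 * x * y) = ((b \<xi>)\<^sup>2 + (c \<xi>)\<^sup>2 - (a \<xi>)\<^sup>2) / (2 * b \<xi> * c \<xi>)"
    proof -
      have "((b \<xi>)\<^sup>2 + (c \<xi>)\<^sup>2 - (a \<xi>)\<^sup>2) / (2 * b \<xi> * c \<xi>) = (\<xi>\<^sup>2 * (x\<^sup>2 + y\<^sup>2 - w\<^sup>2)) / (\<xi>\<^sup>2 * (2 * x * y))"
        unfolding bca by (simp add: power2_eq_square algebra_simps)
      then show ?thesis using elim by simp
    qed
    finally show ?case by simp
  qed
  show "(side_coeff P R * (1 + 1) + side_coeff P Q * (1 + 1) - side_coeff Q R * (1 + 1)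
      - (side_coeff P R * 1 + side_coeff P Q)) / (2 * 1 * 1) = (side_coeff P Q + side_coeff P R - 2 * side_coeff Q R) / 2"
    by simp
qed

text \<open>The dihedral angle at an axial edge differs from \<open>pi / 3\<close> by two effects of order \<open>\<xi>\<^sup>2\<close>: the shape of the flat
  triangle, and the tilt of the axial edge.\<close>
lemma axial_dihedral_limit:
  "(\<lambda>\<xi>. (dihedral (base \<xi> 0) (roof \<xi> 0) (base \<xi> (Suc 0)) (base \<xi> 2)
      - pi / 3) / \<xi>\<^sup>2) \<rightarrow>\<^sub>0 - (2 / sqrt 3) * ((side_coeff P Q + side_coeff P R - 2 * side_coeff Q R) / 2 - ((r1 - r0) / A)\<^sup>2 / 8)"
proof -
  define k where "k = (r1 - r0) / (2 * A)"
  define \<gamma> where "\<gamma> = (side_coeff P Q + side_coeff P R - 2 * side_coeff Q R) / 2"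
  define x where "x \<xi> = \<kappa> (b \<xi>)" for \<xi>
  define y where "y \<xi> = \<kappa> (c \<xi>)" for \<xi>
  define t where "t \<xi> = ((b \<xi>)\<^sup>2 + (c \<xi>)\<^sup>2 - (a \<xi>)\<^sup>2) / (2 * b \<xi> * c \<xi>)" for \<xi>
  define S where "S \<xi> = sqrt (1 - (x \<xi>)\<^sup>2) * sqrt (1 - (y \<xi>)\<^sup>2)" for \<xi>
  have x: "(\<lambda>\<xi>. x \<xi> / \<xi>) \<rightarrow>\<^sub>0 k" and y: "(\<lambda>\<xi>. y \<xi> / \<xi>) \<rightarrow>\<^sub>0 k"
    unfolding x_def y_def k_def by (intro kappa_limit sides_limit)+
  have x0: "x \<rightarrow>\<^sub>0 0" and y0: "y \<rightarrow>\<^sub>0 0"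
    using x y by (auto intro: tendsto_unscale)
  have t: "(\<lambda>\<xi>. (t \<xi> - 1 / 2) / \<xi>\<^sup>2) \<rightarrow>\<^sub>0 \<gamma>"
    unfolding t_def \<gamma>_def by (rule cos_limit)
  have S: "S \<rightarrow>\<^sub>0 1"
  proof -
    have "S \<rightarrow>\<^sub>0 sqrt (1 - 0\<^sup>2) * sqrt (1 - 0\<^sup>2)"
      unfolding S_def[abs_def] by (intro tendsto_intros x0 y0)
    then show ?thesis by simp
  qed
  have small: "\<forall>\<^sub>F \<xi> in at_right 0. \<bar>w \<xi>\<bar> < 1" if "w \<rightarrow>\<^sub>0 0" for w :: "real \<Rightarrow> real"
    using order_tendstoD(2)[OF tendsto_rabs[OF that], of 1] by simp
  have "(\<lambda>\<xi>. ((t \<xi> - x \<xi> * y \<xi>) / S \<xi> - 1 / 2) / \<xi>\<^sup>2) \<rightarrow>\<^sub>0 \<gamma> - k\<^sup>2 / 2"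
  proof (rule tendsto_eventually_eq)
    \<comment> \<open>The last summand is half of \<open>(1 - S) / \<xi>\<^sup>2\<close>; with \<open>1 - S\<close> written as \<open>(1 - S\<^sup>2) / (1 + S)\<close>, it converges term by term.\<close>
    let ?g = "\<lambda>\<xi>. ((t \<xi> - 1 / 2) / \<xi>\<^sup>2 - (x \<xi> / \<xi>) * (y \<xi> / \<xi>)
        + ((x \<xi> / \<xi>)\<^sup>2 + (y \<xi> / \<xi>)\<^sup>2 - (x \<xi> / \<xi>)\<^sup>2 * (y \<xi>)\<^sup>2) / (2 * (1 + S \<xi>))) / S \<xi>"
    show "?g \<rightarrow>\<^sub>0 (\<gamma> - k * k + (k\<^sup>2 + k\<^sup>2 - k\<^sup>2 * 0\<^sup>2) / (2 * (1 + 1))) / 1"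
      by (intro tendsto_intros t x y y0 S) simp_all
    show "\<forall>\<^sub>F \<xi> in at_right 0. ((t \<xi> - x \<xi> * y \<xi>) / S \<xi> - 1 / 2) / \<xi>\<^sup>2 = ?g \<xi>"
      using eventually_pos small[OF x0] small[OF y0]
    proof eventually_elim
      case (elim \<xi>)
      have le: "(x \<xi>)\<^sup>2 < 1" "(y \<xi>)\<^sup>2 < 1" using elim by (simp_all add: abs_square_less_1)
      then have Spos: "0 < S \<xi>" by (simp add: S_def)
      have "(S \<xi>)\<^sup>2 = (1 - (x \<xi>)\<^sup>2) * (1 - (y \<xi>)\<^sup>2)"
        using le by (simp add: S_def power_mult_distrib)
      then have "(1 - S \<xi>) * (1 + S \<xi>) = (x \<xi>)\<^sup>2 + (y \<xi>)\<^sup>2 - (x \<xi>)\<^sup>2 * (y \<xi>)\<^sup>2"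
        by (simp add: power2_eq_square algebra_simps)
      then have m: "((x \<xi>)\<^sup>2 + (y \<xi>)\<^sup>2 - (x \<xi>)\<^sup>2 * (y \<xi>)\<^sup>2) / (2 * (1 + S \<xi>)) = (1 - S \<xi>) / 2"
        using Spos by (simp add: field_simps)
      have "?g \<xi> = (t \<xi> - 1 / 2 - x \<xi> * y \<xi> + ((x \<xi>)\<^sup>2 + (y \<xi>)\<^sup>2 - (x \<xi>)\<^sup>2 * (y \<xi>)\<^sup>2) / (2 * (1 + S \<xi>))) / S \<xi> / \<xi>\<^sup>2"
        by (simp add: power2_eq_square add_divide_distrib diff_divide_distrib ac_simps)
      also have "\<dots> = ((t \<xi> - x \<xi> * y \<xi>) / S \<xi> - 1 / 2) / \<xi>\<^sup>2"
        unfolding m using Spos by (simp add: add_divide_distrib diff_divide_distrib)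
      finally show ?case by simp
    qed
    show "(\<gamma> - k * k + (k\<^sup>2 + k\<^sup>2 - k\<^sup>2 * 0\<^sup>2) / (2 * (1 + 1))) / 1 = \<gamma> - k\<^sup>2 / 2"
      by (simp add: power2_eq_square)
  qed
  moreover have "(arccos has_real_derivative - (2 / sqrt 3)) (at (1 / 2))"
  proof -
    have q: "sqrt (1 - (1 / 2)\<^sup>2) = sqrt 3 / 2"
      by (rule real_sqrt_unique) (simp_all add: power_divide)
    show ?thesis
      using DERIV_arccos[of "1 / 2"] unfolding q by simp
  qed
  moreover have "(\<lambda>\<xi>::real. \<xi>\<^sup>2) \<rightarrow>\<^sub>0 0"
    using tendsto_power[OF tendsto_id0, of 2] by simp
  moreover have "\<forall>\<^sub>F \<xi>::real in at_right 0. \<xi>\<^sup>2 \<noteq> 0"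
    by (rule eventually_mono[OF eventually_pos]) simp
  ultimately have *: "(\<lambda>\<xi>. (arccos ((t \<xi> - x \<xi> * y \<xi>) / S \<xi>) - arccos (1 / 2)) / \<xi>\<^sup>2) \<rightarrow>\<^sub>0 - (2 / sqrt 3) * (\<gamma> - k\<^sup>2 / 2)"
    by (intro tendsto_chain)
  have a: "arccos (1 / 2) = pi / 3"
    using arccos_cos[of "pi / 3"] by (simp add: cos_60)
  show ?thesis
  proof (rule tendsto_eventually_eq[OF *])
    show "\<forall>\<^sub>F \<xi> in at_right 0. (dihedral (base \<xi> 0) (roof \<xi> 0)
          (base \<xi> (Suc 0)) (base \<xi> 2) - pi / 3) / \<xi>\<^sup>2
        = (arccos ((t \<xi> - x \<xi> * y \<xi>) / S \<xi>) - arccos (1 / 2)) / \<xi>\<^sup>2"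
      using eventually_block
      by eventually_elim (simp add: frustum_block.axial_dihedral_eq a t_def x_def y_def S_def)
    show "- (2 / sqrt 3) * (\<gamma> - k\<^sup>2 / 2)
      = - (2 / sqrt 3) * ((side_coeff P Q + side_coeff P R - 2 * side_coeff Q R) / 2 - ((r1 - r0) / A)\<^sup>2 / 8)"
      by (simp add: \<gamma>_def k_def power_divide power_mult_distrib)
  qed
qed

end

section \<open>Simplicial Ricci curvature at small resolution\<close>

text \<open>The length of the dual edge cancels from the volume fractions.\<close>
lemma dual_ricci_weights:
  assumes "lam \<noteq> 0"
  shows "dual_ricci lam es = (\<Sum>(l, e, A, m)\<leftarrow>es. 2 * (e / A) * (l * m / (\<Sum>(l, e, A, m)\<leftarrow>es. l * m)))"
proof -
  define W where "W = (\<Sum>(l, e, A, m)\<leftarrow>es. l * m)"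
  have vol: "(\<Sum>(l, e, A, m)\<leftarrow>es. 1 / 6 * lam * l * m) = lam / 6 * W"
    unfolding W_def by (induction es) (auto simp: distrib_left)
  have "1 / 6 * lam * l * m / (lam / 6 * W) = l * m / W" for l m
    using assms by simp
  then show ?thesis
    unfolding dual_ricci_def Let_def vol W_def[symmetric] by simp
qed

lemma tendsto_sum_list:
  fixes g :: "'b \<Rightarrow> 'a \<Rightarrow> real"
  assumes "\<And>x. x \<in> set xs \<Longrightarrow> (g x \<longlongrightarrow> L x) F"
  shows "((\<lambda>\<xi>. \<Sum>x\<leftarrow>xs. g x \<xi>) \<longlongrightarrow> (\<Sum>x\<leftarrow>xs. L x)) F"
  using assms by (induction xs) (auto intro!: tendsto_intros)

text \<open>The limit is a weighted mean of the limits \<open>K\<close> of the ratios of deficit and dual area. The weights \<open>w\<close> are the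
  limits of \<open>l * m\<close> after division by a common scale \<open>s\<close>.\<close>
lemma dual_ricci_limit:
  fixes xs :: "((real \<Rightarrow> real \<times> real \<times> real \<times> real) \<times> real \<times> real) list"
  assumes lim: "\<And>g K w. (g, K, w) \<in> set xs \<Longrightarrow>
      ((\<lambda>\<xi>. case g \<xi> of (l, e, A, m) \<Rightarrow> e / A) \<longlongrightarrow> K) F \<and>
      ((\<lambda>\<xi>. case g \<xi> of (l, e, A, m) \<Rightarrow> l * m / s \<xi>) \<longlongrightarrow> w) F"
    and W: "(\<Sum>(g, K, w)\<leftarrow>xs. w) \<noteq> 0"
    and s: "\<forall>\<^sub>F \<xi> in F. s \<xi> \<noteq> 0" and lam: "\<forall>\<^sub>F \<xi> in F. lam \<xi> \<noteq> 0"
  shows "((\<lambda>\<xi>. dual_ricci (lam \<xi>) (map (\<lambda>(g, K, w). g \<xi>) xs)) \<longlongrightarrow>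
     (\<Sum>(g, K, w)\<leftarrow>xs. 2 * K * (w / (\<Sum>(g, K, w)\<leftarrow>xs. w)))) F"
proof -
  define W where "W = (\<Sum>(g, K, w)\<leftarrow>xs. w)"
  define V where "V \<xi> = (\<Sum>(g, K, w)\<leftarrow>xs. case g \<xi> of (l, e, A, m) \<Rightarrow> l * m / s \<xi>)" for \<xi>
  have V: "(V \<longlongrightarrow> W) F"
    unfolding V_def W_def by (rule tendsto_sum_list) (use lim in auto)
  have "((\<lambda>\<xi>. \<Sum>x\<leftarrow>xs. case x of (g, K, w) \<Rightarrow> 2 * (case g \<xi> of (l, e, A, m) \<Rightarrow> e / A) * ((case g \<xi> of (l, e, A, m) \<Rightarrow> l * m / s \<xi>) / V \<xi>))
     \<longlongrightarrow> (\<Sum>x\<leftarrow>xs. case x of (g, K, w) \<Rightarrow> 2 * K * (w / W))) F"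
    by (rule tendsto_sum_list) (use lim V W in \<open>auto intro!: tendsto_intros simp: W_def\<close>)
  then show ?thesis
  proof (rule tendsto_eventually_eq)
    show "\<forall>\<^sub>F \<xi> in F. dual_ricci (lam \<xi>) (map (\<lambda>(g, K, w). g \<xi>) xs)
      = (\<Sum>x\<leftarrow>xs. case x of (g, K, w) \<Rightarrow> 2 * (case g \<xi> of (l, e, A, m) \<Rightarrow> e / A) * ((case g \<xi> of (l, e, A, m) \<Rightarrow> l * m / s \<xi>) / V \<xi>))"
      using s lam
    proof eventually_elim
      case (elim \<xi>)
      have "(\<Sum>(l, e, A, m)\<leftarrow>map (\<lambda>(g, K, w). g \<xi>) xs. l * m) = s \<xi> * V \<xi>"
        unfolding V_def using elim(1) by (induction xs) (auto simp: distrib_left split: prod.split)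
      then show ?case
        unfolding dual_ricci_weights[OF elim(2)] using elim(1)
        by (simp add: o_def case_prod_beta)
    qed
  qed (simp add: W_def)
qed

text \<open>The lattice with its sections fixed, as a family indexed by the resolution.\<close>
locale fixed_sections =
  fixes N :: nat and r L :: "nat \<Rightarrow> real" and G :: "real \<Rightarrow> frustum_lattice"
  assumes pos: "\<And>j. j \<in> {1..N} \<Longrightarrow> 0 < r j" "\<And>j. j \<in> {1..<N} \<Longrightarrow> 0 < L j"
    and lattice: "\<And>\<xi>. 0 < \<xi> \<Longrightarrow> sections (G \<xi>) = N" "\<And>\<xi>. 0 < \<xi> \<Longrightarrow> resolution (G \<xi>) = \<xi>"
      "\<And>\<xi> j. 0 < \<xi> \<Longrightarrow> j \<in> {1..N} \<Longrightarrow> radius (G \<xi>) j = r j"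
      "\<And>\<xi> j. 0 < \<xi> \<Longrightarrow> j \<in> {1..<N} \<Longrightarrow> axial (G \<xi>) j = L j"
begin

lemma block:
  assumes "lattice_triangle P Q R" "1 \<le> i" "i < N"
  shows "shrinking_block P Q R (r i) (r (Suc i)) (L i) G i"
  using assms by unfold_locales (auto simp: pos lattice)

definition slope where "slope i = (r (Suc i) - r i) / L i"

lemma edge_length_limit:
  assumes "adjacent P Q" "i \<in> {1..N}"
  shows "(\<lambda>\<xi>. edge_length (G \<xi>) i P Q / \<xi>) \<rightarrow>\<^sub>0 r i"
proof (rule tendsto_eventually_eq)
  show "(\<lambda>\<xi>. r i * (side \<xi> P Q / \<xi>)) \<rightarrow>\<^sub>0 r i * 1"
    by (intro tendsto_intros side_limit assms)
  show "\<forall>\<^sub>F \<xi> in at_right 0. edge_length (G \<xi>) i P Q / \<xi> = r i * (side \<xi> P Q / \<xi>)"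
    using eventually_pos by eventually_elim (use assms(2) in \<open>simp add: edge_length_def side_def lattice\<close>)
qed simp

text \<open>The four dihedral angles differ from right angles by the slopes of the lateral faces above and below the
  edge, so that the deficit measures the change of slope.\<close>
lemma edge_deficit_limit:
  assumes "adjacent P Q" "1 \<le> j" "Suc j < N"
  shows "(\<lambda>\<xi>. edge_deficit (G \<xi>) (Suc j) P Q / \<xi>) \<rightarrow>\<^sub>0 (slope j - slope (Suc j)) / sqrt 3"
proof (rule tendsto_eventually_eq)
  let ?a = "\<lambda>\<xi> k. (angle_above (G \<xi>) (Suc j) P Q (apex k P Q) - pi / 2) / \<xi>
     + (angle_below (G \<xi>) (Suc j) P Q (apex k P Q) - pi / 2) / \<xi>"
  show "(\<lambda>\<xi>. - (\<Sum>k\<in>{1, 5}. ?a \<xi> k)) \<rightarrow>\<^sub>0 - (\<Sum>k\<in>{1, 5::nat}. slope (Suc j) / (2 * sqrt 3) + - (slope j / (2 * sqrt 3)))"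
    unfolding slope_def
    by (intro tendsto_minus tendsto_sum tendsto_add shrinking_block.angle_above_limit[OF block]
      shrinking_block.angle_below_limit[OF block] lattice_triangle_apex)
      (use assms lattice in auto)
  show "\<forall>\<^sub>F \<xi> in at_right 0. edge_deficit (G \<xi>) (Suc j) P Q / \<xi> = - (\<Sum>k\<in>{1, 5}. ?a \<xi> k)"
    using eventually_pos by eventually_elim (simp add: edge_deficit_def field_simps)
qed (simp add: field_simps)

lemma edge_dual_area_limit:
  assumes "adjacent P Q" "1 \<le> j" "Suc j < N"
  shows "(\<lambda>\<xi>. edge_dual_area (G \<xi>) (Suc j) P Q / \<xi>) \<rightarrow>\<^sub>0 (L (Suc j) * (3 * r (Suc j) + r (Suc (Suc j))) + L j * (r j + 3 * r (Suc j))) / (8 * sqrt 3)"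
proof (rule tendsto_eventually_eq)
  let ?a = "\<lambda>\<xi> k. area_above (G \<xi>) (Suc j) P Q (apex k P Q) / \<xi> + area_below (G \<xi>) (Suc j) P Q (apex k P Q) / \<xi>"
  show "(\<lambda>\<xi>. \<Sum>k\<in>{1, 5}. ?a \<xi> k) \<rightarrow>\<^sub>0 (\<Sum>k\<in>{1, 5::nat}. L (Suc j) * (3 * r (Suc j) + r (Suc (Suc j))) / (16 * sqrt 3)
      + L j * (r j + 3 * r (Suc j)) / (16 * sqrt 3))"
    by (intro tendsto_sum tendsto_add shrinking_block.area_above_limit[OF block]
      shrinking_block.area_below_limit[OF block] lattice_triangle_apex)
      (use assms lattice in auto)
  show "\<forall>\<^sub>F \<xi> in at_right 0. edge_dual_area (G \<xi>) (Suc j) P Q / \<xi> = (\<Sum>k\<in>{1, 5}. ?a \<xi> k)"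
    using eventually_pos by eventually_elim (simp add: edge_dual_area_def add_divide_distrib)
qed (simp add: add_divide_distrib)

text \<open>A lattice form of \<open>- \<rho>'' / \<rho>\<close>, the curvature of the planes that contain the axial direction.\<close>
definition edge_curvature where
  "edge_curvature j = 8 * (slope j - slope (Suc j)) /
     (L (Suc j) * (3 * r (Suc j) + r (Suc (Suc j))) + L j * (r j + 3 * r (Suc j)))"

lemma edge_curvature_limit:
  assumes "adjacent P Q" "1 \<le> j" "Suc j < N"
  shows "(\<lambda>\<xi>. edge_deficit (G \<xi>) (Suc j) P Q / edge_dual_area (G \<xi>) (Suc j) P Q) \<rightarrow>\<^sub>0 edge_curvature j"
proof (rule tendsto_eventually_eq)
  have p: "0 < r j" "0 < r (Suc j)" "0 < r (Suc (Suc j))" "0 < L j" "0 < L (Suc j)"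
    using assms by (auto intro!: pos)
  have s: "0 < L (Suc j) * (3 * r (Suc j) + r (Suc (Suc j))) + L j * (r j + 3 * r (Suc j))"
    using p by (intro add_pos_pos mult_pos_pos) auto
  show "(\<lambda>\<xi>. (edge_deficit (G \<xi>) (Suc j) P Q / \<xi>) / (edge_dual_area (G \<xi>) (Suc j) P Q / \<xi>)) \<rightarrow>\<^sub>0 ((slope j - slope (Suc j)) / sqrt 3) /
     ((L (Suc j) * (3 * r (Suc j) + r (Suc (Suc j))) + L j * (r j + 3 * r (Suc j))) / (8 * sqrt 3))"
    by (rule tendsto_divide[OF edge_deficit_limit edge_dual_area_limit]) (use assms s in auto)
  show "\<forall>\<^sub>F \<xi> in at_right 0. edge_deficit (G \<xi>) (Suc j) P Q / edge_dual_area (G \<xi>) (Suc j) P Q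
     = (edge_deficit (G \<xi>) (Suc j) P Q / \<xi>) / (edge_dual_area (G \<xi>) (Suc j) P Q / \<xi>)"
    using eventually_pos by eventually_elim simp
qed (simp add: edge_curvature_def)

text \<open>The defect of the sphere triangulation contributes \<open>sqrt 3 / 2\<close> at every vertex, and the tilt of the axial edge
  reduces it by the square of the slope.\<close>
lemma axial_deficit_limit:
  assumes "1 \<le> i" "i < N"
  shows "(\<lambda>\<xi>. axial_deficit (G \<xi>) i P / \<xi>\<^sup>2) \<rightarrow>\<^sub>0 sqrt 3 / 2 * (1 - (slope i)\<^sup>2)"
proof (rule tendsto_eventually_eq)
  let ?d = "\<lambda>\<xi> k. dihedral (sec_tri (G \<xi>) i P (neighbour k P) (neighbour (Suc k) P) 0)
      (upper_tri (G \<xi>) i P (neighbour k P) (neighbour (Suc k) P) 0)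
      (sec_tri (G \<xi>) i P (neighbour k P) (neighbour (Suc k) P) (Suc 0))
      (sec_tri (G \<xi>) i P (neighbour k P) (neighbour (Suc k) P) 2)"
  let ?s = "\<lambda>k. side_coeff P (neighbour k P) + side_coeff P (neighbour (Suc k) P)
      - 2 * side_coeff (neighbour k P) (neighbour (Suc k) P)"
  show "(\<lambda>\<xi>. - (\<Sum>k<6. (?d \<xi> k - pi / 3) / \<xi>\<^sup>2)) \<rightarrow>\<^sub>0 - (\<Sum>k<6. - (2 / sqrt 3) * (?s k / 2 - (slope i)\<^sup>2 / 8))"
    unfolding slope_def
    by (intro tendsto_minus tendsto_sum shrinking_block.axial_dihedral_limit[OF block] lattice_triangle_neighbours assms)
  show "\<forall>\<^sub>F \<xi> in at_right 0. axial_deficit (G \<xi>) i P / \<xi>\<^sup>2 = - (\<Sum>k<6. (?d \<xi> k - pi / 3) / \<xi>\<^sup>2)"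
    by (rule always_eventually)
      (simp add: axial_deficit_def Let_def sum_subtractf diff_divide_distrib flip: sum_divide_distrib)
  have "- (\<Sum>k<6. - (2 / sqrt 3) * (?s k / 2 - (slope i)\<^sup>2 / 8)) = 2 / sqrt 3 * (\<Sum>k<6. ?s k / 2 - (slope i)\<^sup>2 / 8)"
    by (simp add: sum_distrib_left sum_negf)
  also have "(\<Sum>k<6. ?s k / 2 - (slope i)\<^sup>2 / 8) = (\<Sum>k<6. ?s k) / 2 - 6 * ((slope i)\<^sup>2 / 8)"
    unfolding sum_subtractf[of "\<lambda>k. ?s k / 2"] by (simp only: sum_divide_distrib[symmetric]) simp
  also have "\<dots> = 3 / 4 * (1 - (slope i)\<^sup>2)"
    unfolding side_coeff_star by (simp add: field_simps)
  also have "2 / sqrt 3 * (3 / 4 * (1 - (slope i)\<^sup>2)) = 3 / sqrt 3 / 2 * (1 - (slope i)\<^sup>2)"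
  proof -
    have "2 / s * (3 / 4 * x) = 3 / s / 2 * x" for s x :: real by (simp add: field_simps)
    then show ?thesis .
  qed
  also have "3 / sqrt 3 = sqrt 3" by (rule real_div_sqrt) simp
  finally show "- (\<Sum>k<6. - (2 / sqrt 3) * (?s k / 2 - (slope i)\<^sup>2 / 8)) = sqrt 3 / 2 * (1 - (slope i)\<^sup>2)" .
qed

lemma axial_dual_area_limit:
  assumes "1 \<le> i" "i < N"
  shows "(\<lambda>\<xi>. axial_dual_area (G \<xi>) i P / \<xi>\<^sup>2) \<rightarrow>\<^sub>0 sqrt 3 / 8 * (r i + r (Suc i))\<^sup>2"
proof (rule tendsto_eventually_eq)
  let ?d = "\<lambda>\<xi> k. kite_area (midpoint (sec_tri (G \<xi>) i P (neighbour k P) (neighbour (Suc k) P) 0)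
      (upper_tri (G \<xi>) i P (neighbour k P) (neighbour (Suc k) P) 0))
      (lateral_center (G \<xi>) i P (neighbour k P) (neighbour (Suc k) P) 0 (Suc 0))
      (block_center (G \<xi>) i P (neighbour k P) (neighbour (Suc k) P))
      (lateral_center (G \<xi>) i P (neighbour k P) (neighbour (Suc k) P) 0 2)"
  show "(\<lambda>\<xi>. \<Sum>k<6. ?d \<xi> k / \<xi>\<^sup>2) \<rightarrow>\<^sub>0 (\<Sum>k<6::nat. (r i + r (Suc i))\<^sup>2 / (16 * sqrt 3))"
    by (intro tendsto_sum shrinking_block.axial_kite_limit[OF block] lattice_triangle_neighbours assms)
  show "\<forall>\<^sub>F \<xi> in at_right 0. axial_dual_area (G \<xi>) i P / \<xi>\<^sup>2 = (\<Sum>k<6. ?d \<xi> k / \<xi>\<^sup>2)"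
    by (rule always_eventually) (simp add: axial_dual_area_def Let_def sum_divide_distrib)
qed (simp add: field_simps)

text \<open>A lattice form of \<open>(1 - \<rho>'\<^sup>2) / \<rho>\<^sup>2\<close>, the curvature of the planes tangent to the cross sections.\<close>
definition axial_curvature where
  "axial_curvature i = (1 - (slope i)\<^sup>2) / ((r i + r (Suc i)) / 2)\<^sup>2"

lemma axial_curvature_limit:
  assumes "1 \<le> i" "i < N"
  shows "(\<lambda>\<xi>. axial_deficit (G \<xi>) i P / axial_dual_area (G \<xi>) i P) \<rightarrow>\<^sub>0 axial_curvature i"
proof (rule tendsto_eventually_eq)
  have p: "0 < r i" "0 < r (Suc i)" using assms by (auto intro!: pos)
  show "(\<lambda>\<xi>. (axial_deficit (G \<xi>) i P / \<xi>\<^sup>2) / (axial_dual_area (G \<xi>) i P / \<xi>\<^sup>2)) \<rightarrow>\<^sub>0 (sqrt 3 / 2 * (1 - (slope i)\<^sup>2)) / (sqrt 3 / 8 * (r i + r (Suc i))\<^sup>2)"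
    by (rule tendsto_divide[OF axial_deficit_limit axial_dual_area_limit]) (use assms p in auto)
  show "\<forall>\<^sub>F \<xi> in at_right 0. axial_deficit (G \<xi>) i P / axial_dual_area (G \<xi>) i P
    = (axial_deficit (G \<xi>) i P / \<xi>\<^sup>2) / (axial_dual_area (G \<xi>) i P / \<xi>\<^sup>2)"
    using eventually_pos by eventually_elim simp
  show "(sqrt 3 / 2 * (1 - (slope i)\<^sup>2)) / (sqrt 3 / 8 * (r i + r (Suc i))\<^sup>2) = axial_curvature i"
    by (simp add: axial_curvature_def power_divide)
qed

lemma base_triangles:
  "lattice_triangle pt_O pt_X pt_Y" "lattice_triangle pt_O pt_Y pt_X" "lattice_triangle pt_X pt_Y pt_O"
  "adjacent pt_O pt_X" "adjacent pt_O pt_Y" "adjacent pt_X pt_Y"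
  by (simp_all add: lattice_triangle_def adjacent_def lattice_inner_def)

lemma dual_alpha_limit:
  assumes "1 \<le> j" "Suc j < N"
  shows "(\<lambda>\<xi>. dual_alpha (G \<xi>) (Suc j)) \<rightarrow>\<^sub>0 (L j + L (Suc j)) / 2"
proof (rule tendsto_eventually_eq)
  show "(\<lambda>\<xi>. dist (block_center (G \<xi>) j pt_O pt_X pt_Y) (upper_center (G \<xi>) j pt_O pt_X pt_Y)
     + dist (block_center (G \<xi>) (Suc j) pt_O pt_X pt_Y) (sec_center (G \<xi>) (Suc j) pt_O pt_X pt_Y)) \<rightarrow>\<^sub>0 L j / 2 + L (Suc j) / 2"
    by (intro tendsto_add shrinking_block.dist_center_roof_limit[OF block]
      shrinking_block.dist_center_base_limit[OF block] base_triangles) (use assms in auto)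
  show "\<forall>\<^sub>F \<xi> in at_right 0. dual_alpha (G \<xi>) (Suc j) =
    dist (block_center (G \<xi>) j pt_O pt_X pt_Y) (upper_center (G \<xi>) j pt_O pt_X pt_Y)
     + dist (block_center (G \<xi>) (Suc j) pt_O pt_X pt_Y) (sec_center (G \<xi>) (Suc j) pt_O pt_X pt_Y)"
    using eventually_pos by eventually_elim (use assms in \<open>simp add: dual_alpha_def lattice\<close>)
qed simp

lemma dual_sigma_limit:
  assumes "1 \<le> i" "i < N"
  shows "(\<lambda>\<xi>. dual_sigma (G \<xi>) i / \<xi>) \<rightarrow>\<^sub>0 (r i + r (Suc i)) / (2 * sqrt 3)"
proof (rule tendsto_eventually_eq)
  show "(\<lambda>\<xi>. \<Sum>k\<in>{1, 5}. dist (block_center (G \<xi>) i pt_O pt_X (apex k pt_O pt_X)) (lateral_center (G \<xi>) i pt_O pt_X (apex k pt_O pt_X) 0 (Suc 0)) / \<xi>) \<rightarrow>\<^sub>0 (\<Sum>k\<in>{1, 5::nat}. (r i + r (Suc i)) / (4 * sqrt 3))"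
    by (intro tendsto_sum shrinking_block.dist_center_side_limit[OF block] lattice_triangle_apex base_triangles assms)
  show "\<forall>\<^sub>F \<xi> in at_right 0. dual_sigma (G \<xi>) i / \<xi> =
    (\<Sum>k\<in>{1, 5}. dist (block_center (G \<xi>) i pt_O pt_X (apex k pt_O pt_X)) (lateral_center (G \<xi>) i pt_O pt_X (apex k pt_O pt_X) 0 (Suc 0)) / \<xi>)"
    by (rule always_eventually) (simp add: dual_sigma_def Let_def add_divide_distrib)
qed (simp add: field_simps)

text \<open>The triangle is asymptotically equilateral and its three edges have the same curvature.\<close>
lemma Rc_alpha_limit:
  assumes "1 \<le> j" "Suc j < N"
  shows "(\<lambda>\<xi>. Rc_alpha (G \<xi>) (Suc j)) \<rightarrow>\<^sub>0 2 * edge_curvature j"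
proof (rule tendsto_eventually_eq)
  let ?i = "Suc j"
  let ?m = "\<lambda>P Q R \<xi>. dist (midpoint (sec_tri (G \<xi>) ?i P Q R 0) (sec_tri (G \<xi>) ?i P Q R (Suc 0))) (sec_center (G \<xi>) ?i P Q R)"
  let ?g = "\<lambda>P Q R \<xi>. (edge_length (G \<xi>) ?i P Q, edge_deficit (G \<xi>) ?i P Q, edge_dual_area (G \<xi>) ?i P Q, ?m P Q R \<xi>)"
  let ?w = "r ?i * (r ?i / (2 * sqrt 3))"
  let ?xs = "map (\<lambda>(P, Q, R). (?g P Q R, edge_curvature j, ?w)) [(pt_O, pt_X, pt_Y), (pt_O, pt_Y, pt_X), (pt_X, pt_Y, pt_O)]"
  have p: "0 < r ?i" "0 < L j" "0 < L ?i" using assms by (auto intro!: pos)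
  have g: "((\<lambda>\<xi>. case ?g P Q R \<xi> of (l, e, A, m) \<Rightarrow> e / A) \<rightarrow>\<^sub>0 edge_curvature j) \<and>
      ((\<lambda>\<xi>. case ?g P Q R \<xi> of (l, e, A, m) \<Rightarrow> l * m / \<xi>\<^sup>2) \<rightarrow>\<^sub>0 ?w)"
    if t: "lattice_triangle P Q R" for P Q R
  proof -
    have a: "adjacent P Q" using t by (simp add: lattice_triangle_def)
    have "(\<lambda>\<xi>. (edge_length (G \<xi>) ?i P Q / \<xi>) * (?m P Q R \<xi> / \<xi>)) \<rightarrow>\<^sub>0 ?w"
      by (intro tendsto_mult edge_length_limit shrinking_block.base_moment_limit[OF block] a t) (use assms in auto)
    then show ?thesis
      using edge_curvature_limit[OF a assms] by (simp add: power2_eq_square)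
  qed
  show "(\<lambda>\<xi>. dual_ricci (dual_alpha (G \<xi>) ?i) (map (\<lambda>(g, K, w). g \<xi>) ?xs)) \<rightarrow>\<^sub>0 (\<Sum>(g, K, w)\<leftarrow>?xs. 2 * K * (w / (\<Sum>(g, K, w)\<leftarrow>?xs. w)))"
  proof (rule dual_ricci_limit)
    show "((\<lambda>\<xi>. case g \<xi> of (l, e, A, m) \<Rightarrow> e / A) \<rightarrow>\<^sub>0 K) \<and>
      ((\<lambda>\<xi>. case g \<xi> of (l, e, A, m) \<Rightarrow> l * m / \<xi>\<^sup>2) \<rightarrow>\<^sub>0 w)" if "(g, K, w) \<in> set ?xs" for g K w
      using that unfolding list.map set_simps prod.case insert_iff empty_iff prod.inject simp_thms
      by (elim disjE conjE; hypsubst) (rule g, rule base_triangles)+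
    show "\<forall>\<^sub>F \<xi>::real in at_right 0. \<xi>\<^sup>2 \<noteq> 0"
      by (rule eventually_mono[OF eventually_pos]) simp
    show "\<forall>\<^sub>F \<xi> in at_right 0. dual_alpha (G \<xi>) ?i \<noteq> 0"
      by (rule tendsto_imp_eventually_ne[OF dual_alpha_limit[OF assms]]) (use p in auto)
    show "(\<Sum>(g, K, w)\<leftarrow>?xs. w) \<noteq> 0" using p by simp
  qed
  show "\<forall>\<^sub>F \<xi> in at_right 0. Rc_alpha (G \<xi>) ?i = dual_ricci (dual_alpha (G \<xi>) ?i) (map (\<lambda>(g, K, w). g \<xi>) ?xs)"
    by (rule always_eventually) (simp add: Rc_alpha_def)
  show "(\<Sum>(g, K, w)\<leftarrow>?xs. 2 * K * (w / (\<Sum>(g, K, w)\<leftarrow>?xs. w))) = 2 * edge_curvature j"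
    using p by simp
qed

text \<open>Half of the weight falls on the two axial edges, and the other half on the two edges of the cross sections in
  proportion to their radii.\<close>
lemma Rc_sigma_limit:
  assumes "1 \<le> j" "Suc (Suc j) < N"
  shows "(\<lambda>\<xi>. Rc_sigma (G \<xi>) (Suc j)) \<rightarrow>\<^sub>0 (r (Suc j) * edge_curvature j + r (Suc (Suc j)) * edge_curvature (Suc j)) / (r (Suc j) + r (Suc (Suc j)))
     + axial_curvature (Suc j)"
proof (rule tendsto_eventually_eq)
  let ?i = "Suc j"
  let ?B = "\<lambda>\<xi>. sec_tri (G \<xi>) ?i pt_O pt_X pt_Y" and ?T = "\<lambda>\<xi>. upper_tri (G \<xi>) ?i pt_O pt_X pt_Y"
  let ?c = "\<lambda>\<xi>. lateral_center (G \<xi>) ?i pt_O pt_X pt_Y 0 (Suc 0)"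
  let ?g1 = "\<lambda>\<xi>. (edge_length (G \<xi>) ?i pt_O pt_X, edge_deficit (G \<xi>) ?i pt_O pt_X,
     edge_dual_area (G \<xi>) ?i pt_O pt_X, dist (midpoint (?B \<xi> 0) (?B \<xi> (Suc 0))) (?c \<xi>))"
  let ?g2 = "\<lambda>\<xi>. (edge_length (G \<xi>) (Suc ?i) pt_O pt_X, edge_deficit (G \<xi>) (Suc ?i) pt_O pt_X,
     edge_dual_area (G \<xi>) (Suc ?i) pt_O pt_X, dist (midpoint (?T \<xi> 0) (?T \<xi> (Suc 0))) (?c \<xi>))"
  let ?g3 = "\<lambda>\<xi>. (axial (G \<xi>) ?i, axial_deficit (G \<xi>) ?i pt_O, axial_dual_area (G \<xi>) ?i pt_O,
     dist (midpoint (?B \<xi> 0) (?T \<xi> 0)) (?c \<xi>))"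
  let ?g4 = "\<lambda>\<xi>. (axial (G \<xi>) ?i, axial_deficit (G \<xi>) ?i pt_X, axial_dual_area (G \<xi>) ?i pt_X,
     dist (midpoint (?B \<xi> (Suc 0)) (?T \<xi> (Suc 0))) (?c \<xi>))"
  define r0 r1 A where "r0 = r ?i" and "r1 = r (Suc ?i)" and "A = L ?i"
  let ?xs = "[(?g1, edge_curvature j, r0 * (A / 2)), (?g2, edge_curvature ?i, r1 * (A / 2)),
     (?g3, axial_curvature ?i, A * ((r0 + r1) / 4)), (?g4, axial_curvature ?i, A * ((r0 + r1) / 4))]"
  have p: "0 < r0" "0 < r1" "0 < A" using assms by (auto intro!: pos simp: r0_def r1_def A_def)
  have i: "1 \<le> ?i" "?i < N" using assms by auto
  note m = shrinking_block.side_moment_limits[OF block[OF base_triangles(1) i], folded r0_def r1_def A_def]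
    shrinking_block.axial_moment_limits[OF block[OF base_triangles(1) i], folded r0_def r1_def A_def]
  have ax: "(\<lambda>\<xi>. axial (G \<xi>) ?i) \<rightarrow>\<^sub>0 A"
    by (rule tendsto_eventually_eq[OF tendsto_const _ refl], rule eventually_mono[OF eventually_pos])
      (use i in \<open>simp add: A_def lattice\<close>)
  have e: "(\<lambda>\<xi>. edge_length (G \<xi>) ?i pt_O pt_X / \<xi>) \<rightarrow>\<^sub>0 r0"
    "(\<lambda>\<xi>. edge_length (G \<xi>) (Suc ?i) pt_O pt_X / \<xi>) \<rightarrow>\<^sub>0 r1"
    using assms unfolding r0_def r1_def by (auto intro!: edge_length_limit base_triangles)
  have g1: "((\<lambda>\<xi>. case ?g1 \<xi> of (l, e, A, m) \<Rightarrow> e / A) \<rightarrow>\<^sub>0 edge_curvature j) \<and>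
      ((\<lambda>\<xi>. case ?g1 \<xi> of (l, e, A, m) \<Rightarrow> l * m / \<xi>) \<rightarrow>\<^sub>0 r0 * (A / 2))"
    using edge_curvature_limit[OF base_triangles(4), of j] tendsto_mult[OF e(1) m(1)] assms by simp
  have g2: "((\<lambda>\<xi>. case ?g2 \<xi> of (l, e, A, m) \<Rightarrow> e / A) \<rightarrow>\<^sub>0 edge_curvature ?i) \<and>
      ((\<lambda>\<xi>. case ?g2 \<xi> of (l, e, A, m) \<Rightarrow> l * m / \<xi>) \<rightarrow>\<^sub>0 r1 * (A / 2))"
    using edge_curvature_limit[OF base_triangles(4), of ?i] tendsto_mult[OF e(2) m(2)] assms by simp
  have g3: "((\<lambda>\<xi>. case ?g3 \<xi> of (l, e, A, m) \<Rightarrow> e / A) \<rightarrow>\<^sub>0 axial_curvature ?i) \<and>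
      ((\<lambda>\<xi>. case ?g3 \<xi> of (l, e, A, m) \<Rightarrow> l * m / \<xi>) \<rightarrow>\<^sub>0 A * ((r0 + r1) / 4))"
    using axial_curvature_limit[OF i] tendsto_mult[OF ax m(3)] by simp
  have g4: "((\<lambda>\<xi>. case ?g4 \<xi> of (l, e, A, m) \<Rightarrow> e / A) \<rightarrow>\<^sub>0 axial_curvature ?i) \<and>
      ((\<lambda>\<xi>. case ?g4 \<xi> of (l, e, A, m) \<Rightarrow> l * m / \<xi>) \<rightarrow>\<^sub>0 A * ((r0 + r1) / 4))"
    using axial_curvature_limit[OF i] tendsto_mult[OF ax m(4)] by simp
  have W: "(\<Sum>(g, K, w)\<leftarrow>?xs. w) = A * (r0 + r1)" by (simp add: field_simps)
  show "(\<lambda>\<xi>. dual_ricci (dual_sigma (G \<xi>) ?i) (map (\<lambda>(g, K, w). g \<xi>) ?xs)) \<rightarrow>\<^sub>0 (\<Sum>(g, K, w)\<leftarrow>?xs. 2 * K * (w / (\<Sum>(g, K, w)\<leftarrow>?xs. w)))"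
  proof (rule dual_ricci_limit)
    show "((\<lambda>\<xi>. case g \<xi> of (l, e, A, m) \<Rightarrow> e / A) \<rightarrow>\<^sub>0 K) \<and>
      ((\<lambda>\<xi>. case g \<xi> of (l, e, A, m) \<Rightarrow> l * m / \<xi>) \<rightarrow>\<^sub>0 w)" if "(g, K, w) \<in> set ?xs" for g K w
      using that g1 g2 g3 g4 unfolding set_simps insert_iff empty_iff prod.inject by blast
    show "\<forall>\<^sub>F \<xi>::real in at_right 0. \<xi> \<noteq> 0"
      by (rule eventually_mono[OF eventually_pos]) simp
    have "\<forall>\<^sub>F \<xi> in at_right 0. dual_sigma (G \<xi>) ?i / \<xi> \<noteq> 0"
      by (rule tendsto_imp_eventually_ne[OF dual_sigma_limit[OF i]]) (use p in \<open>auto simp: r0_def r1_def\<close>)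
    then show "\<forall>\<^sub>F \<xi> in at_right 0. dual_sigma (G \<xi>) ?i \<noteq> 0"
      by eventually_elim simp
    show "(\<Sum>(g, K, w)\<leftarrow>?xs. w) \<noteq> 0" unfolding W using p by simp
  qed
  show "\<forall>\<^sub>F \<xi> in at_right 0. Rc_sigma (G \<xi>) ?i = dual_ricci (dual_sigma (G \<xi>) ?i) (map (\<lambda>(g, K, w). g \<xi>) ?xs)"
    by (rule always_eventually) (simp add: Rc_sigma_def Let_def)
  show "(\<Sum>(g, K, w)\<leftarrow>?xs. 2 * K * (w / (\<Sum>(g, K, w)\<leftarrow>?xs. w)))
    = (r ?i * edge_curvature j + r (Suc ?i) * edge_curvature (Suc j)) / (r ?i + r (Suc ?i)) + axial_curvature ?i"
  proof -
    have q: "r0 * (A / 2) / (A * (r0 + r1)) = r0 / (r0 + r1) / 2" "r1 * (A / 2) / (A * (r0 + r1)) = r1 / (r0 + r1) / 2"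
      "A * ((r0 + r1) / 4) / (A * (r0 + r1)) = 1 / 4"
      using p by simp_all
    moreover have half: "2 * K * (x / s / 2) = x * K / s" for K x s :: real by simp
    ultimately show ?thesis
      unfolding W
      unfolding list.map sum_list.Cons sum_list.Nil prod.case q half r0_def[symmetric] r1_def[symmetric]
      by (simp add: add_divide_distrib)
  qed
qed

end

section \<open>Rates of change of the dual edges\<close>

definition has_rate_limit :: "(real \<Rightarrow> real \<Rightarrow> real) \<Rightarrow> real \<Rightarrow> real \<Rightarrow> bool" where
  "has_rate_limit f t d0 \<longleftrightarrow> (\<exists>d. (d \<rightarrow>\<^sub>0 d0) \<and>
     (\<forall>\<^sub>F \<xi> in at_right 0. (f \<xi> has_real_derivative d \<xi>) (at t)))"

lemma has_rate_limitI:
  assumes "d \<rightarrow>\<^sub>0 d0"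
    and "\<forall>\<^sub>F \<xi> in at_right 0. (g \<xi> has_real_derivative d \<xi>) (at t) \<and> (\<forall>\<^sub>F u in nhds t. f \<xi> u = g \<xi> u)"
  shows "has_rate_limit f t d0"
  unfolding has_rate_limit_def
proof (intro exI conjI)
  show "\<forall>\<^sub>F \<xi> in at_right 0. (f \<xi> has_real_derivative d \<xi>) (at t)"
    using assms(2)
  proof eventually_elim
    case (elim \<xi>)
    then have "\<forall>\<^sub>F u in nhds t. f \<xi> u = g \<xi> u" by blast
    from DERIV_cong_ev[OF refl this refl] show ?case using elim by blast
  qed
qed fact

lemma has_rate_limit_add:
  assumes "has_rate_limit f t d" "has_rate_limit g t e"
  shows "has_rate_limit (\<lambda>\<xi> u. f \<xi> u + g \<xi> u) t (d + e)"
proof -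
  from assms obtain d' e' where l: "d' \<rightarrow>\<^sub>0 d" "e' \<rightarrow>\<^sub>0 e"
    and f: "\<forall>\<^sub>F \<xi> in at_right 0. (f \<xi> has_real_derivative d' \<xi>) (at t)"
    and g: "\<forall>\<^sub>F \<xi> in at_right 0. (g \<xi> has_real_derivative e' \<xi>) (at t)"
    unfolding has_rate_limit_def by blast
  have "\<forall>\<^sub>F \<xi> in at_right 0. ((\<lambda>u. f \<xi> u + g \<xi> u) has_real_derivative d' \<xi> + e' \<xi>) (at t)"
    using f g by eventually_elim (rule DERIV_add)
  with tendsto_add[OF l] show ?thesis unfolding has_rate_limit_def by blast
qed

text \<open>A logarithmic rate does not see the factor \<open>s\<close>; for \<open>dual_sigma\<close>, which vanishes in the limit, the factor is the
  resolution.\<close>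
lemma log_rate_limit:
  assumes rate: "has_rate_limit g t d" and v: "(\<lambda>\<xi>. g \<xi> t) \<rightarrow>\<^sub>0 v" "v \<noteq> 0"
    and f: "\<forall>\<^sub>F \<xi> in at_right 0. s \<xi> \<noteq> 0 \<and> (\<forall>\<^sub>F u in nhds t. f \<xi> u = s \<xi> * g \<xi> u)"
  shows "(\<lambda>\<xi>. log_rate (f \<xi>) t) \<rightarrow>\<^sub>0 d / v"
proof -
  from rate obtain d' where l: "d' \<rightarrow>\<^sub>0 d"
    and g: "\<forall>\<^sub>F \<xi> in at_right 0. (g \<xi> has_real_derivative d' \<xi>) (at t)"
    unfolding has_rate_limit_def by blast
  show ?thesis
  proof (rule tendsto_eventually_eq[OF tendsto_divide[OF l v] _ refl])
    show "\<forall>\<^sub>F \<xi> in at_right 0. log_rate (f \<xi>) t = d' \<xi> / g \<xi> t"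
      using f g
    proof eventually_elim
      case (elim \<xi>)
      then have ev: "\<forall>\<^sub>F u in nhds t. f \<xi> u = s \<xi> * g \<xi> u" by blast
      have "((\<lambda>u. s \<xi> * g \<xi> u) has_real_derivative s \<xi> * d' \<xi>) (at t)"
        using elim by (intro DERIV_cmult) blast
      then have "deriv (\<lambda>u. s \<xi> * g \<xi> u) t = s \<xi> * d' \<xi>" by (rule DERIV_imp_deriv)
      moreover have "deriv (f \<xi>) t = deriv (\<lambda>u. s \<xi> * g \<xi> u) t"
        by (rule deriv_cong_ev[OF ev refl])
      moreover have "f \<xi> t = s \<xi> * g \<xi> t" by (rule eventually_nhds_x_imp_x[OF ev])
      ultimately show ?case using elim by (simp add: log_rate_def)
    qed
  qed
qed

lemma sqrt_difference_derivative:
  fixes A D :: "real \<Rightarrow> real"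
  assumes "(A has_real_derivative A') (at t)" "(D has_real_derivative D') (at t)" "(D t * s)\<^sup>2 < (A t)\<^sup>2"
  shows "((\<lambda>u. sqrt ((A u)\<^sup>2 - (D u * s)\<^sup>2)) has_real_derivative
     (A t * A' - D t * D' * s\<^sup>2) / sqrt ((A t)\<^sup>2 - (D t * s)\<^sup>2)) (at t)"
proof -
  have "((\<lambda>u. (A u)\<^sup>2 - (D u * s)\<^sup>2) has_real_derivative 2 * (A t * A' - D t * D' * s\<^sup>2)) (at t)"
    by (rule DERIV_cong[OF DERIV_diff[OF DERIV_power[OF assms(1)] DERIV_power[OF DERIV_cmult_right[OF assms(2)]]]])
      (simp add: power2_eq_square algebra_simps)
  moreover have "0 < (A t)\<^sup>2 - (D t * s)\<^sup>2" using assms(3) by simp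
  ultimately have "((\<lambda>u. sqrt ((A u)\<^sup>2 - (D u * s)\<^sup>2)) has_real_derivative
     inverse (sqrt ((A t)\<^sup>2 - (D t * s)\<^sup>2)) / 2 * (2 * (A t * A' - D t * D' * s\<^sup>2))) (at t)"
    by (intro DERIV_chain2[OF DERIV_real_sqrt])
  moreover have "inverse q / 2 * (2 * E) = E / q" for q E :: real by (simp add: field_simps)
  ultimately show ?thesis by (simp only:)
qed

text \<open>A block whose radii and axial length change with time. The unit triangle does not, because the resolution is
  constant in time.\<close>
locale moving_block = shrinking_triangle +
  fixes i :: nat and r0 r1 A :: "real \<Rightarrow> real" and r0' r1' A' t :: real
    and J :: "real set" and G :: "real \<Rightarrow> real \<Rightarrow> frustum_lattice"
  assumes J: "open J" "t \<in> J"
    and deriv: "(r0 has_real_derivative r0') (at t)" "(r1 has_real_derivative r1') (at t)" "(A has_real_derivative A') (at t)"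
    and lattice_data: "\<And>\<xi> u. 0 < \<xi> \<Longrightarrow> u \<in> J \<Longrightarrow> resolution (G \<xi> u) = \<xi>"
      "\<And>\<xi> u. 0 < \<xi> \<Longrightarrow> u \<in> J \<Longrightarrow> radius (G \<xi> u) i = r0 u"
      "\<And>\<xi> u. 0 < \<xi> \<Longrightarrow> u \<in> J \<Longrightarrow> radius (G \<xi> u) (Suc i) = r1 u"
      "\<And>\<xi> u. 0 < \<xi> \<Longrightarrow> u \<in> J \<Longrightarrow> axial (G \<xi> u) i = A u"
    and moving_pos: "\<And>u. u \<in> J \<Longrightarrow> 0 < r0 u" "\<And>u. u \<in> J \<Longrightarrow> 0 < r1 u" "\<And>u. u \<in> J \<Longrightarrow> 0 < A u"
begin

sublocale shrinking_block P Q R "r0 t" "r1 t" "A t" "\<lambda>\<xi>. G \<xi> t" i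
  using J by unfold_locales (auto simp: lattice_data moving_pos)

lemma eventually_J: "\<forall>\<^sub>F u in nhds t. u \<in> J"
  using J by (rule eventually_nhds_in_open)

text \<open>The conditions on a block are strict inequalities between continuous functions of time.\<close>
lemma eventually_moving_block:
  assumes "frustum_block (r0 t) (r1 t) (A t) (c \<xi>) (b \<xi>) (a \<xi>) (G \<xi> t) i P Q R" "0 < \<xi>"
  shows "\<forall>\<^sub>F u in nhds t. frustum_block (r0 u) (r1 u) (A u) (c \<xi>) (b \<xi>) (a \<xi>) (G \<xi> u) i P Q R"
proof -
  interpret blk: frustum_block "r0 t" "r1 t" "A t" "c \<xi>" "b \<xi>" "a \<xi>" "G \<xi> t" i P Q R by fact
  have c0: "isCont r0 t" "isCont r1 t" "isCont A t" using deriv by (auto dest: DERIV_isCont)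
  define q where "q u = (A u)\<^sup>2 - 2 * (rc \<xi>)\<^sup>2 * \<bar>r1 u - r0 u\<bar> * (r0 u + r1 u)" for u
  have "isCont q t" unfolding q_def[abs_def] by (intro continuous_intros c0)
  then have "(q \<longlongrightarrow> q t) (nhds t)"
    by (simp only: isCont_def tendsto_at_iff_tendsto_nhds)
  from order_tendstoD(1)[OF this, of 0]
  have "\<forall>\<^sub>F u in nhds t. 2 * (rc \<xi>)\<^sup>2 * \<bar>r1 u - r0 u\<bar> * (r0 u + r1 u) < (A u)\<^sup>2"
    using blk.thin by (simp add: q_def)
  then show ?thesis
    using eventually_J
    by eventually_elim (unfold_locales; simp add: moving_pos lattice_data assms(2) blk.acute)
qed

abbreviation "ht \<xi> u \<equiv> frustum_shape.h (r0 u) (r1 u) (A u) (c \<xi>) (b \<xi>) (a \<xi>)"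
abbreviation "zt \<xi> u \<equiv> frustum_shape.z (r0 u) (r1 u) (A u) (c \<xi>) (b \<xi>) (a \<xi>)"

definition "h' \<xi> = (A t * A' - (r1 t - r0 t) * (r1' - r0') * (rc \<xi>)\<^sup>2) / h \<xi>"
definition "z' \<xi> = ((2 * A t * A' + 2 * (rc \<xi>)\<^sup>2 * ((r1' - r0') * r0 t + (r1 t - r0 t) * r0')) * (2 * h \<xi>)
   - ((A t)\<^sup>2 + 2 * (rc \<xi>)\<^sup>2 * (r1 t - r0 t) * r0 t) * (2 * h' \<xi>)) / (2 * h \<xi>)\<^sup>2"

lemma h_derivative:
  assumes "frustum_block (r0 t) (r1 t) (A t) (c \<xi>) (b \<xi>) (a \<xi>) (G \<xi> t) i P Q R"
  shows "(ht \<xi> has_real_derivative h' \<xi>) (at t)"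
proof -
  interpret blk: frustum_block "r0 t" "r1 t" "A t" "c \<xi>" "b \<xi>" "a \<xi>" "G \<xi> t" i P Q R by fact
  show ?thesis
    unfolding h'_def frustum_shape.h_def frustum_shape.D_def frustum_shape.Rc_def
    by (rule sqrt_difference_derivative[OF deriv(3) DERIV_diff[OF deriv(2,1)]])
      (use blk.thin_bounds(1) in \<open>simp add: frustum_shape.D_def frustum_shape.Rc_def\<close>)
qed

lemma z_derivative:
  assumes blk: "frustum_block (r0 t) (r1 t) (A t) (c \<xi>) (b \<xi>) (a \<xi>) (G \<xi> t) i P Q R"
  shows "(zt \<xi> has_real_derivative z' \<xi>) (at t)"
proof -
  have h0: "h \<xi> \<noteq> 0" using frustum_block.h_pos[OF blk] by simp
  have n: "((\<lambda>u. (A u)\<^sup>2 + 2 * (rc \<xi>)\<^sup>2 * (r1 u - r0 u) * r0 u) has_real_derivative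
     2 * A t * A' + 2 * (rc \<xi>)\<^sup>2 * ((r1' - r0') * r0 t + (r1 t - r0 t) * r0')) (at t)"
    by (rule DERIV_cong[OF DERIV_add[OF DERIV_power[OF deriv(3)]
          DERIV_mult[OF DERIV_cmult[OF DERIV_diff[OF deriv(2,1)]] deriv(1)]]]) (simp add: algebra_simps)
  have d: "((\<lambda>u. 2 * ht \<xi> u) has_real_derivative 2 * h' \<xi>) (at t)"
    by (rule DERIV_cmult[OF h_derivative[OF blk]])
  have "2 * h \<xi> \<noteq> 0" using h0 by simp
  from DERIV_divide[OF n d this] show ?thesis
    unfolding z'_def frustum_shape.z_def[abs_def] frustum_shape.D_def frustum_shape.Rc_def
      power2_eq_square[of "2 * h \<xi>"] .
qed

lemma h'_limit: "h' \<rightarrow>\<^sub>0 A'"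
proof -
  have A: "A t \<noteq> 0" using moving_pos[OF J(2)] by simp
  have "h' \<rightarrow>\<^sub>0 (A t * A' - (r1 t - r0 t) * (r1' - r0') * 0\<^sup>2) / A t"
    unfolding h'_def by (intro tendsto_intros rc0 h_limit A)
  then show ?thesis using A by simp
qed

lemma z'_limit: "z' \<rightarrow>\<^sub>0 A' / 2"
proof -
  have A: "A t \<noteq> 0" using moving_pos[OF J(2)] by simp
  have "z' \<rightarrow>\<^sub>0 ((2 * A t * A' + 2 * 0\<^sup>2 * ((r1' - r0') * r0 t + (r1 t - r0 t) * r0')) * (2 * A t)
   - ((A t)\<^sup>2 + 2 * 0\<^sup>2 * (r1 t - r0 t) * r0 t) * (2 * A')) / (2 * A t)\<^sup>2"
    unfolding z'_def by (intro tendsto_intros rc0 h_limit h'_limit) (use A in simp)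
  then show ?thesis using A by (simp add: power2_eq_square)
qed

lemma base_dist_rate: "has_rate_limit (\<lambda>\<xi> u. dist (block_center (G \<xi> u) i P Q R) (sec_center (G \<xi> u) i P Q R)) t (A' / 2)"
proof (rule has_rate_limitI[OF z'_limit])
  show "\<forall>\<^sub>F \<xi> in at_right 0. (zt \<xi> has_real_derivative z' \<xi>) (at t) \<and>
      (\<forall>\<^sub>F u in nhds t. dist (block_center (G \<xi> u) i P Q R) (sec_center (G \<xi> u) i P Q R) = zt \<xi> u)"
    using eventually_block eventually_pos
  proof eventually_elim
    case (elim \<xi>)
    have "\<forall>\<^sub>F u in nhds t. dist (block_center (G \<xi> u) i P Q R) (sec_center (G \<xi> u) i P Q R) = zt \<xi> u"
      using eventually_moving_block[OF elim] by eventually_elim (rule frustum_block.dist_block_sec)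
    with z_derivative[OF elim(1)] show ?case by blast
  qed
qed

lemma roof_dist_rate: "has_rate_limit (\<lambda>\<xi> u. dist (block_center (G \<xi> u) i P Q R) (upper_center (G \<xi> u) i P Q R)) t (A' / 2)"
proof (rule has_rate_limitI)
  show "(\<lambda>\<xi>. h' \<xi> - z' \<xi>) \<rightarrow>\<^sub>0 A' / 2"
    using tendsto_diff[OF h'_limit z'_limit] by simp
  show "\<forall>\<^sub>F \<xi> in at_right 0. ((\<lambda>u. ht \<xi> u - zt \<xi> u) has_real_derivative h' \<xi> - z' \<xi>) (at t) \<and>
      (\<forall>\<^sub>F u in nhds t. dist (block_center (G \<xi> u) i P Q R) (upper_center (G \<xi> u) i P Q R) = ht \<xi> u - zt \<xi> u)"
    using eventually_block eventually_pos
  proof eventually_elim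
    case (elim \<xi>)
    have "\<forall>\<^sub>F u in nhds t. dist (block_center (G \<xi> u) i P Q R) (upper_center (G \<xi> u) i P Q R) = ht \<xi> u - zt \<xi> u"
      using eventually_moving_block[OF elim] by eventually_elim (rule frustum_block.dist_block_upper)
    with DERIV_diff[OF h_derivative[OF elim(1)] z_derivative[OF elim(1)]] show ?case by blast
  qed
qed

definition "H' \<xi> = (A t * A' - (r1 t - r0 t) * (r1' - r0') * (c \<xi> / 2)\<^sup>2) / H (c \<xi>)"
definition "f' \<xi> = (((r0' + r1') * (A t)\<^sup>2 + (r0 t + r1 t) * (2 * A t * A')) * (2 * h \<xi> * H (c \<xi>))
   - (r0 t + r1 t) * (A t)\<^sup>2 * (2 * h' \<xi> * H (c \<xi>) + 2 * h \<xi> * H' \<xi>)) / (2 * h \<xi> * H (c \<xi>))\<^sup>2"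

lemma f_derivative:
  assumes blk: "frustum_block (r0 t) (r1 t) (A t) (c \<xi>) (b \<xi>) (a \<xi>) (G \<xi> t) i P Q R"
  shows "((\<lambda>u. frustum_shape.f (r0 u) (r1 u) (A u) (c \<xi>) (b \<xi>) (a \<xi>) (c \<xi>)) has_real_derivative f' \<xi>) (at t)"
proof -
  interpret blk: frustum_block "r0 t" "r1 t" "A t" "c \<xi>" "b \<xi>" "a \<xi>" "G \<xi> t" i P Q R by fact
  have H: "0 < H (c \<xi>)" "(H (c \<xi>))\<^sup>2 = (A t)\<^sup>2 - ((r1 t - r0 t) * (c \<xi> / 2))\<^sup>2"
    using blk.H_pos[of 0 "Suc 0", OF _ _ blk.sides_delta(1)] blk.H_square[of 0 "Suc 0", OF _ _ blk.sides_delta(1)]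
    by (simp_all add: frustum_shape.D_def)
  have HD: "((\<lambda>u. frustum_shape.H (r0 u) (r1 u) (A u) (c \<xi>)) has_real_derivative H' \<xi>) (at t)"
  proof -
    have "0 < (A t)\<^sup>2 - ((r1 t - r0 t) * (c \<xi> / 2))\<^sup>2"
      unfolding H(2)[symmetric] using H(1) by simp
    then show ?thesis
      using sqrt_difference_derivative[OF deriv(3) DERIV_diff[OF deriv(2,1)], of "c \<xi> / 2"]
      unfolding H'_def frustum_shape.H_def[abs_def] frustum_shape.D_def by simp
  qed
  have n: "((\<lambda>u. (r0 u + r1 u) * (A u)\<^sup>2) has_real_derivative
      (r0' + r1') * (A t)\<^sup>2 + (r0 t + r1 t) * (2 * A t * A')) (at t)"
    by (rule DERIV_cong[OF DERIV_mult[OF DERIV_add[OF deriv(1,2)] DERIV_power[OF deriv(3)]]]) (simp add: algebra_simps)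
  have d: "((\<lambda>u. 2 * ht \<xi> u * frustum_shape.H (r0 u) (r1 u) (A u) (c \<xi>)) has_real_derivative
      2 * h' \<xi> * H (c \<xi>) + 2 * h \<xi> * H' \<xi>) (at t)"
    by (rule DERIV_cong[OF DERIV_mult[OF DERIV_cmult[OF h_derivative[OF blk]] HD]]) (simp add: algebra_simps)
  have "2 * h \<xi> * H (c \<xi>) \<noteq> 0" using blk.h_pos H(1) by simp
  from DERIV_divide[OF n d this] show ?thesis
    unfolding f'_def frustum_shape.f_def[abs_def] power2_eq_square[of "2 * h \<xi> * H (c \<xi>)"] .
qed

lemma f'_limit: "f' \<rightarrow>\<^sub>0 (r0' + r1') / 2"
proof -
  have A: "A t \<noteq> 0" using moving_pos[OF J(2)] by simp
  have "H' \<rightarrow>\<^sub>0 (A t * A' - (r1 t - r0 t) * (r1' - r0') * (0 / 2)\<^sup>2) / A t"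
    unfolding H'_def by (intro tendsto_intros sides0 H_limit A) simp
  then have H': "H' \<rightarrow>\<^sub>0 A'" using A by simp
  have "f' \<rightarrow>\<^sub>0 (((r0' + r1') * (A t)\<^sup>2 + (r0 t + r1 t) * (2 * A t * A')) * (2 * A t * A t)
   - (r0 t + r1 t) * (A t)\<^sup>2 * (2 * A' * A t + 2 * A t * A')) / (2 * A t * A t)\<^sup>2"
    unfolding f'_def by (intro tendsto_intros h_limit h'_limit H' H_limit sides0) (use A in simp)
  moreover have e: "(((r0' + r1') * (A t)\<^sup>2 + (r0 t + r1 t) * (2 * A t * A')) * (2 * A t * A t)
   - (r0 t + r1 t) * (A t)\<^sup>2 * (2 * A' * A t + 2 * A t * A')) = (r0' + r1') / 2 * (2 * A t * A t)\<^sup>2"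
    by (simp add: power2_eq_square algebra_simps)
  ultimately have "f' \<rightarrow>\<^sub>0 (r0' + r1') / 2 * (2 * A t * A t)\<^sup>2 / (2 * A t * A t)\<^sup>2"
    unfolding e by (simp only:)
  moreover have "(2 * A t * A t)\<^sup>2 \<noteq> 0" using A by simp
  ultimately show ?thesis by (metis nonzero_mult_div_cancel_right)
qed

lemma lateral_dist_rate:
  "has_rate_limit (\<lambda>\<xi> u. dist (block_center (G \<xi> u) i P Q R) (lateral_center (G \<xi> u) i P Q R 0 (Suc 0)) / \<xi>) t
     ((r0' + r1') / (4 * sqrt 3))"
proof (rule has_rate_limitI)
  have "(\<lambda>\<xi>. apo \<xi> (c \<xi>) / \<xi> * f' \<xi>) \<rightarrow>\<^sub>0 1 / (2 * sqrt 3) * ((r0' + r1') / 2)"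
    by (intro tendsto_mult apo_limit sides_limit f'_limit)
  then show "(\<lambda>\<xi>. apo \<xi> (c \<xi>) / \<xi> * f' \<xi>) \<rightarrow>\<^sub>0 (r0' + r1') / (4 * sqrt 3)"
    by simp
  let ?g = "\<lambda>\<xi> u. apo \<xi> (c \<xi>) / \<xi> * frustum_shape.f (r0 u) (r1 u) (A u) (c \<xi>) (b \<xi>) (a \<xi>) (c \<xi>)"
  show "\<forall>\<^sub>F \<xi> in at_right 0. (?g \<xi> has_real_derivative apo \<xi> (c \<xi>) / \<xi> * f' \<xi>) (at t) \<and>
     (\<forall>\<^sub>F u in nhds t. dist (block_center (G \<xi> u) i P Q R) (lateral_center (G \<xi> u) i P Q R 0 (Suc 0)) / \<xi> = ?g \<xi> u)"
    using eventually_block eventually_pos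
  proof eventually_elim
    case (elim \<xi>)
    have "\<forall>\<^sub>F u in nhds t. dist (block_center (G \<xi> u) i P Q R) (lateral_center (G \<xi> u) i P Q R 0 (Suc 0)) / \<xi> = ?g \<xi> u"
      using eventually_moving_block[OF elim]
      by eventually_elim (simp add: frustum_block.dist_block_lateral01)
    then show ?case
      using DERIV_cmult[OF f_derivative[OF elim(1)]] by blast
  qed
qed

end

section \<open>Differences of smooth functions\<close>

lemma C2_on_partials:
  fixes f :: "real \<times> real \<Rightarrow> real"
  assumes "C2_on f S"
  shows "\<exists>(D :: real \<times> real \<Rightarrow> real \<times> real \<Rightarrow> real) D2.
    (\<forall>z\<in>S. (f has_derivative D z) (at z)) \<and>
    (\<forall>z\<in>S. \<forall>v. ((\<lambda>w. D w v) has_derivative (\<lambda>u. D2 z u v)) (at z)) \<and>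
    (\<forall>u v. continuous_on S (\<lambda>z. D2 z u v))"
proof -
  obtain f' :: "real \<times> real \<Rightarrow> (real \<times> real) \<Rightarrow>\<^sub>L real" and f''
    where f: "\<And>z. z \<in> S \<Longrightarrow> (f has_derivative blinfun_apply (f' z)) (at z)"
      "\<And>z. z \<in> S \<Longrightarrow> (f' has_derivative blinfun_apply (f'' z)) (at z)" "continuous_on S f''"
    using assms unfolding C2_on_def by blast
  have "((\<lambda>w. blinfun_apply (f' w) v) has_derivative (\<lambda>u. blinfun_apply (blinfun_apply (f'' z) u) v)) (at z)"
    if "z \<in> S" for z v
    by (rule bounded_linear.has_derivative[OF blinfun.bounded_linear_left f(2)[OF that]])
  moreover have "continuous_on S (\<lambda>z. blinfun_apply (blinfun_apply (f'' z) u) v)" for u v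
    by (intro continuous_intros f(3))
  ultimately show ?thesis
    using f(1)
    by (intro exI[of _ "\<lambda>z. blinfun_apply (f' z)"] exI[of _ "\<lambda>z u. blinfun_apply (blinfun_apply (f'' z) u)"]) simp
qed

lemma has_derivative_slice:
  fixes f :: "real \<times> real \<Rightarrow> real"
  assumes "(f has_derivative D) (at (x, t))"
  shows "((\<lambda>y. f (y, t)) has_real_derivative D (1, 0)) (at x)"
    and "((\<lambda>s. f (x, s)) has_real_derivative D (0, 1)) (at t)"
proof -
  interpret D: bounded_linear D using assms by (rule has_derivative_bounded_linear)
  have sc: "(\<lambda>h. D (h, 0)) = (*) (D (1, 0))" "(\<lambda>h. D (0, h)) = (*) (D (0, 1))"
  proof -
    have a: "D (h, 0) = D (1, 0) * h" "D (0, h) = D (0, 1) * h" for h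
      using D.scaleR[of h "(1, 0)"] D.scaleR[of h "(0, 1)"] by simp_all
    show "(\<lambda>h. D (h, 0)) = (*) (D (1, 0))" by (rule ext) (rule a(1))
    show "(\<lambda>h. D (0, h)) = (*) (D (0, 1))" by (rule ext) (rule a(2))
  qed
  have "((\<lambda>y. (y, t)) has_derivative (\<lambda>h. (h, 0))) (at x)" "((\<lambda>s. (x, s)) has_derivative (\<lambda>h. (0, h))) (at t)"
    by (rule has_derivative_Pair has_derivative_ident has_derivative_const)+
  from has_derivative_compose[OF this(1) assms] has_derivative_compose[OF this(2) assms]
  show "((\<lambda>y. f (y, t)) has_real_derivative D (1, 0)) (at x)"
    "((\<lambda>s. f (x, s)) has_real_derivative D (0, 1)) (at t)"
    unfolding has_field_derivative_def sc .
qed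

lemma has_derivative_along_curve:
  fixes f :: "real \<times> real \<Rightarrow> real" and g :: "real \<Rightarrow> real"
  assumes "(f has_derivative D) (at (g t, t))" "(g has_real_derivative g') (at t)"
  shows "((\<lambda>s. f (g s, s)) has_real_derivative D (1, 0) * g' + D (0, 1)) (at t)"
proof -
  interpret D: bounded_linear D using assms(1) by (rule has_derivative_bounded_linear)
  have "((\<lambda>s. (g s, s)) has_derivative (\<lambda>h. (g' * h, h))) (at t)"
    using assms(2) unfolding has_field_derivative_def by (rule has_derivative_Pair[OF _ has_derivative_ident])
  from has_derivative_compose[OF this assms(1)]
  have "((\<lambda>s. f (g s, s)) has_derivative (\<lambda>h. D (g' * h, h))) (at t)" .
  moreover have "(\<lambda>h. D (g' * h, h)) = (*) (D (1, 0) * g' + D (0, 1))"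
  proof
    fix h
    have "(g' * h, h) = (g' * h) *\<^sub>R (1, 0) + h *\<^sub>R (0, 1)" by simp
    then have "D (g' * h, h) = g' * h * D (1, 0) + h * D (0, 1)"
      by (simp only: D.add D.scaleR real_scaleR_def)
    then show "D (g' * h, h) = (D (1, 0) * g' + D (0, 1)) * h" by (simp add: algebra_simps)
  qed
  ultimately show ?thesis unfolding has_field_derivative_def by (simp only:)
qed

lemma mixed_difference:
  fixes f :: "real \<Rightarrow> real \<Rightarrow> real"
  assumes "0 < h"
    and fx: "\<And>y s. x \<le> y \<Longrightarrow> y \<le> x + h \<Longrightarrow> t \<le> s \<Longrightarrow> s \<le> t + h \<Longrightarrow> ((\<lambda>y. f y s) has_real_derivative fx y s) (at y)"
    and fxt: "\<And>y s. x \<le> y \<Longrightarrow> y \<le> x + h \<Longrightarrow> t \<le> s \<Longrightarrow> s \<le> t + h \<Longrightarrow> ((\<lambda>s. fx y s) has_real_derivative fxt y s) (at s)"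
  shows "\<exists>y s. x < y \<and> y < x + h \<and> t < s \<and> s < t + h \<and>
     f (x + h) (t + h) - f (x + h) t - f x (t + h) + f x t = h\<^sup>2 * fxt y s"
proof -
  have "\<exists>y>x. y < x + h \<and> (f (x + h) (t + h) - f (x + h) t) - (f x (t + h) - f x t) = (x + h - x) * (fx y (t + h) - fx y t)"
    using assms(1) by (intro MVT2[where f = "\<lambda>y. f y (t + h) - f y t" and f' = "\<lambda>y. fx y (t + h) - fx y t"] DERIV_diff fx) auto
  then obtain y where y: "x < y" "y < x + h"
    "(f (x + h) (t + h) - f (x + h) t) - (f x (t + h) - f x t) = h * (fx y (t + h) - fx y t)" by auto
  have "\<exists>s>t. s < t + h \<and> fx y (t + h) - fx y t = (t + h - t) * fxt y s"
    using assms(1) y by (intro MVT2 fxt) auto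
  then obtain s where "t < s" "s < t + h" "fx y (t + h) - fx y t = h * fxt y s" by auto
  with y show ?thesis
    by (intro exI[of _ y] exI[of _ s]) (simp add: power2_eq_square algebra_simps)
qed

text \<open>Both orders of differentiation give a mean value of the same second difference over a small square, divided
  by its area; by continuity the two values agree in the limit.\<close>
lemma C2_mixed_partials:
  fixes f :: "real \<times> real \<Rightarrow> real"
  assumes S: "open S" "(x, t) \<in> S"
    and D: "\<And>z. z \<in> S \<Longrightarrow> (f has_derivative D z) (at z)"
    and D2: "\<And>z v. z \<in> S \<Longrightarrow> ((\<lambda>w. D w v) has_derivative (\<lambda>u. D2 z u v)) (at z)"
    and cont: "\<And>u v. continuous_on S (\<lambda>z. D2 z u v)"
  shows "D2 (x, t) (1, 0) (0, 1) = D2 (x, t) (0, 1) (1, 0)"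
proof (rule ccontr)
  define a where "a z = D2 z (0, 1) (1, 0)" for z
  define b where "b z = D2 z (1, 0) (0, 1)" for z
  assume "D2 (x, t) (1, 0) (0, 1) \<noteq> D2 (x, t) (0, 1) (1, 0)"
  then have e: "0 < \<bar>a (x, t) - b (x, t)\<bar> / 2" by (simp add: a_def b_def)
  have "isCont a (x, t)" "isCont b (x, t)"
    using cont S by (auto simp: a_def[abs_def] b_def[abs_def] continuous_on_eq_continuous_at)
  then have "\<forall>\<^sub>F z in nhds (x, t). dist (a z) (a (x, t)) < \<bar>a (x, t) - b (x, t)\<bar> / 2 \<and> dist (b z) (b (x, t)) < \<bar>a (x, t) - b (x, t)\<bar> / 2"
    using e by (intro eventually_conj tendstoD) (auto simp: isCont_def tendsto_at_iff_tendsto_nhds)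
  moreover have "\<forall>\<^sub>F z in nhds (x, t). z \<in> S" using S by (rule eventually_nhds_in_open)
  ultimately have "\<forall>\<^sub>F z in nhds (x, t). z \<in> S \<and> dist (a z) (a (x, t)) < \<bar>a (x, t) - b (x, t)\<bar> / 2 \<and> dist (b z) (b (x, t)) < \<bar>a (x, t) - b (x, t)\<bar> / 2"
    by eventually_elim simp
  then obtain d where d: "0 < d" "\<And>z. dist z (x, t) < d \<Longrightarrow> z \<in> S \<and> dist (a z) (a (x, t)) < \<bar>a (x, t) - b (x, t)\<bar> / 2 \<and> dist (b z) (b (x, t)) < \<bar>a (x, t) - b (x, t)\<bar> / 2"
    unfolding eventually_nhds_metric by blast
  \<comment> \<open>Two sides of the square together are shorter than \<open>d\<close>.\<close>
  define h where "h = d / 3"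
  have h: "0 < h" using d by (simp add: h_def)
  have near: "dist (y, s) (x, t) < d" if "x \<le> y" "y \<le> x + h" "t \<le> s" "s \<le> t + h" for y s
  proof -
    have "dist (y, s) (x, t) \<le> dist y x + dist s t"
      unfolding dist_prod_def using sqrt_sum_squares_le_sum[of "dist y x" "dist s t"] by simp
    also have "\<dots> \<le> h + h" using that by (auto simp: dist_real_def)
    also have "\<dots> < d" using d by (simp add: h_def)
    finally show ?thesis .
  qed
  have "\<exists>y s. x < y \<and> y < x + h \<and> t < s \<and> s < t + h \<and>
     f (x + h, t + h) - f (x + h, t) - f (x, t + h) + f (x, t) = h\<^sup>2 * a (y, s)"
    unfolding a_def
    by (rule mixed_difference[where f = "\<lambda>y s. f (y, s)" and fx = "\<lambda>y s. D (y, s) (1, 0)"], fact h)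
      (use d(2)[OF near] in \<open>auto intro: has_derivative_slice[OF D] has_derivative_slice[OF D2]\<close>)
  then obtain y s where ys: "x < y" "y < x + h" "t < s" "s < t + h"
     "f (x + h, t + h) - f (x + h, t) - f (x, t + h) + f (x, t) = h\<^sup>2 * a (y, s)" by blast
  have "\<exists>s y. t < s \<and> s < t + h \<and> x < y \<and> y < x + h \<and>
     f (x + h, t + h) - f (x, t + h) - f (x + h, t) + f (x, t) = h\<^sup>2 * b (y, s)"
    unfolding b_def
    by (rule mixed_difference[where f = "\<lambda>s y. f (y, s)" and fx = "\<lambda>s y. D (y, s) (0, 1)"], fact h)
      (use d(2)[OF near] in \<open>auto intro: has_derivative_slice[OF D] has_derivative_slice[OF D2]\<close>)
  then obtain s' y' where ys': "t < s'" "s' < t + h" "x < y'" "y' < x + h"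
     "f (x + h, t + h) - f (x, t + h) - f (x + h, t) + f (x, t) = h\<^sup>2 * b (y', s')" by blast
  have "h\<^sup>2 * a (y, s) = h\<^sup>2 * b (y', s')" using ys(5) ys'(5) by linarith
  then have "a (y, s) = b (y', s')" using h by simp
  moreover have "dist (a (y, s)) (a (x, t)) < \<bar>a (x, t) - b (x, t)\<bar> / 2"
    using d(2)[OF near] ys by auto
  moreover have "dist (b (y', s')) (b (x, t)) < \<bar>a (x, t) - b (x, t)\<bar> / 2"
    using d(2)[OF near] ys' by auto
  moreover have "\<bar>a (x, t) - b (x, t)\<bar> \<le> \<bar>a (y, s) - a (x, t)\<bar> + \<bar>a (y, s) - b (x, t)\<bar>" by linarith
  ultimately show False unfolding dist_real_def by simp
qed

lemma tendsto_between:
  fixes u w z :: "nat \<Rightarrow> real"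
  assumes "u \<longlonglongrightarrow> p" "w \<longlonglongrightarrow> p" "\<forall>\<^sub>F n in sequentially. u n < z n \<and> z n < w n"
  shows "z \<longlonglongrightarrow> p"
proof (rule tendsto_sandwich[OF _ _ assms(1,2)])
  show "\<forall>\<^sub>F n in sequentially. u n \<le> z n" "\<forall>\<^sub>F n in sequentially. z n \<le> w n"
    using assms(3) by (auto elim!: eventually_mono)
qed

lemma difference_quotient_limit:
  fixes g :: "real \<Rightarrow> real"
  assumes u: "u \<longlonglongrightarrow> p" "v \<longlonglongrightarrow> p" and lt: "\<forall>\<^sub>F n in sequentially. u n < v n"
    and p: "p \<in> {l<..<r}" and g: "\<And>y. y \<in> {l<..<r} \<Longrightarrow> (g has_real_derivative g' y) (at y)" and c: "isCont g' p"
  shows "(\<lambda>n. (g (v n) - g (u n)) / (v n - u n)) \<longlonglongrightarrow> g' p"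
proof -
  have "\<forall>\<^sub>F n in sequentially. l < u n" "\<forall>\<^sub>F n in sequentially. v n < r"
    using p order_tendstoD(1)[OF u(1)] order_tendstoD(2)[OF u(2)] by auto
  with lt have "\<forall>\<^sub>F n in sequentially. \<exists>z. u n < z \<and> z < v n \<and> (g (v n) - g (u n)) / (v n - u n) = g' z"
  proof eventually_elim
    case (elim n)
    then have "\<exists>z>u n. z < v n \<and> g (v n) - g (u n) = (v n - u n) * g' z"
      by (intro MVT2 g) auto
    then show ?case using elim by auto
  qed
  then obtain z where z: "\<forall>\<^sub>F n in sequentially. u n < z n \<and> z n < v n \<and> (g (v n) - g (u n)) / (v n - u n) = g' (z n)"
    unfolding eventually_ex by blast
  have "z \<longlonglongrightarrow> p"
    using u by (rule tendsto_between) (use z in \<open>auto elim!: eventually_mono\<close>)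
  then have "(\<lambda>n. g' (z n)) \<longlonglongrightarrow> g' p" by (rule isCont_tendsto_compose[OF c])
  then show ?thesis
    by (rule tendsto_eventually_eq) (use z in \<open>auto elim!: eventually_mono\<close>)
qed

text \<open>The weights need not converge; this makes the limits below independent of the ratios of adjacent spacings.\<close>
lemma convex_combination_limit:
  fixes s t x y :: "nat \<Rightarrow> real"
  assumes pos: "\<forall>\<^sub>F n in sequentially. 0 < s n \<and> 0 < t n" and l: "x \<longlonglongrightarrow> l" "y \<longlonglongrightarrow> l"
  shows "(\<lambda>n. (s n * x n + t n * y n) / (s n + t n)) \<longlonglongrightarrow> l"
proof (rule tendsto_sandwich)
  show "(\<lambda>n. min (x n) (y n)) \<longlonglongrightarrow> l" "(\<lambda>n. max (x n) (y n)) \<longlonglongrightarrow> l"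
    using tendsto_min[OF l] tendsto_max[OF l] by simp_all
  show "\<forall>\<^sub>F n in sequentially. min (x n) (y n) \<le> (s n * x n + t n * y n) / (s n + t n)"
    using pos
  proof eventually_elim
    case (elim n)
    then have "s n * min (x n) (y n) + t n * min (x n) (y n) \<le> s n * x n + t n * y n"
      by (intro add_mono mult_left_mono) auto
    then show ?case using elim by (simp add: pos_le_divide_eq algebra_simps)
  qed
  show "\<forall>\<^sub>F n in sequentially. (s n * x n + t n * y n) / (s n + t n) \<le> max (x n) (y n)"
    using pos
  proof eventually_elim
    case (elim n)
    then have "s n * x n + t n * y n \<le> s n * max (x n) (y n) + t n * max (x n) (y n)"
      by (intro add_mono mult_left_mono) auto
    then show ?case using elim by (simp add: pos_divide_le_eq algebra_simps)
  qed
qed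

lemma second_order_taylor:
  fixes g :: "real \<Rightarrow> real"
  assumes "v \<noteq> w" and g: "\<And>y. min v w \<le> y \<Longrightarrow> y \<le> max v w \<Longrightarrow> (g has_real_derivative g' y) (at y)"
    and g': "\<And>y. min v w \<le> y \<Longrightarrow> y \<le> max v w \<Longrightarrow> (g' has_real_derivative g'' y) (at y)"
  shows "\<exists>z. min v w < z \<and> z < max v w \<and> (g w - g v) / (w - v) = g' v + g'' z / 2 * (w - v)"
proof -
  define diff where "diff m = (if m = 0 then g else if m = 1 then g' else g'')" for m :: nat
  have "\<exists>z. (if w < v then w < z \<and> z < v else v < z \<and> z < w) \<and>
    g w = (\<Sum>m<2. diff m v / fact m * (w - v) ^ m) + diff 2 z / fact 2 * (w - v) ^ 2"
  proof (rule Taylor[where a = "min v w" and b = "max v w"])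
    show "\<forall>m y. m < 2 \<and> min v w \<le> y \<and> y \<le> max v w \<longrightarrow> (diff m has_real_derivative diff (Suc m) y) (at y)"
      using g g' by (auto simp: diff_def less_2_cases_iff)
  qed (use assms(1) in \<open>auto simp: diff_def\<close>)
  then obtain z where z: "if w < v then w < z \<and> z < v else v < z \<and> z < w"
    "g w = (\<Sum>m<2. diff m v / fact m * (w - v) ^ m) + diff 2 z / fact 2 * (w - v) ^ 2" by blast
  have "g w - g v = (g' v + g'' z / 2 * (w - v)) * (w - v)"
    using z(2) by (simp add: diff_def numeral_2_eq_2 field_simps)
  then show ?thesis
    using z(1) assms(1) by (intro exI[of _ z]) (auto split: if_splits simp: min_def max_def)
qed

text \<open>By Taylor's theorem around the middle point, the second difference is a convex combination of two values
  of \<open>g''\<close>. The spacing may be uneven.\<close>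
lemma second_difference_limit:
  fixes g :: "real \<Rightarrow> real"
  assumes u: "u \<longlonglongrightarrow> p" "v \<longlonglongrightarrow> p" "w \<longlonglongrightarrow> p" and lt: "\<forall>\<^sub>F n in sequentially. u n < v n \<and> v n < w n"
    and p: "p \<in> {l<..<r}" and g: "\<And>y. y \<in> {l<..<r} \<Longrightarrow> (g has_real_derivative g' y) (at y)"
    and g': "\<And>y. y \<in> {l<..<r} \<Longrightarrow> (g' has_real_derivative g'' y) (at y)" and c: "isCont g'' p"
  shows "(\<lambda>n. 2 * ((g (w n) - g (v n)) / (w n - v n) - (g (v n) - g (u n)) / (v n - u n)) / (w n - u n)) \<longlonglongrightarrow> g'' p"
proof -
  have ev: "\<forall>\<^sub>F n in sequentially. l < u n" "\<forall>\<^sub>F n in sequentially. w n < r"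
    using p order_tendstoD(1)[OF u(1)] order_tendstoD(2)[OF u(3)] by auto
  from lt ev have "\<forall>\<^sub>F n in sequentially. \<exists>z. v n < z \<and> z < w n \<and> (g (w n) - g (v n)) / (w n - v n) = g' (v n) + g'' z / 2 * (w n - v n)"
  proof eventually_elim
    case (elim n)
    have "\<exists>z. min (v n) (w n) < z \<and> z < max (v n) (w n) \<and> (g (w n) - g (v n)) / (w n - v n) = g' (v n) + g'' z / 2 * (w n - v n)"
      by (rule second_order_taylor) (use elim in \<open>auto intro!: g g'\<close>)
    then show ?case using elim by auto
  qed
  then obtain z where z: "\<forall>\<^sub>F n in sequentially. v n < z n \<and> z n < w n \<and> (g (w n) - g (v n)) / (w n - v n) = g' (v n) + g'' (z n) / 2 * (w n - v n)"
    unfolding eventually_ex by blast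
  from lt ev have "\<forall>\<^sub>F n in sequentially. \<exists>z. u n < z \<and> z < v n \<and> (g (u n) - g (v n)) / (u n - v n) = g' (v n) + g'' z / 2 * (u n - v n)"
  proof eventually_elim
    case (elim n)
    have "\<exists>z. min (v n) (u n) < z \<and> z < max (v n) (u n) \<and> (g (u n) - g (v n)) / (u n - v n) = g' (v n) + g'' z / 2 * (u n - v n)"
      by (rule second_order_taylor) (use elim in \<open>auto intro!: g g'\<close>)
    then show ?case using elim by auto
  qed
  then obtain y where y: "\<forall>\<^sub>F n in sequentially. u n < y n \<and> y n < v n \<and> (g (u n) - g (v n)) / (u n - v n) = g' (v n) + g'' (y n) / 2 * (u n - v n)"
    unfolding eventually_ex by blast
  have "z \<longlonglongrightarrow> p"
    using u(2,3) by (rule tendsto_between) (use z in \<open>auto elim!: eventually_mono\<close>)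
  moreover have "y \<longlonglongrightarrow> p"
    using u(1,2) by (rule tendsto_between) (use y in \<open>auto elim!: eventually_mono\<close>)
  ultimately have "(\<lambda>n. g'' (z n)) \<longlonglongrightarrow> g'' p" "(\<lambda>n. g'' (y n)) \<longlonglongrightarrow> g'' p"
    by (auto intro: isCont_tendsto_compose[OF c])
  then have "(\<lambda>n. ((w n - v n) * g'' (z n) + (v n - u n) * g'' (y n)) / ((w n - v n) + (v n - u n))) \<longlonglongrightarrow> g'' p"
    by (intro convex_combination_limit) (use lt in \<open>auto elim!: eventually_mono\<close>)
  then show ?thesis
  proof (rule tendsto_eventually_eq)
    show "\<forall>\<^sub>F n in sequentially. 2 * ((g (w n) - g (v n)) / (w n - v n) - (g (v n) - g (u n)) / (v n - u n)) / (w n - u n)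
      = ((w n - v n) * g'' (z n) + (v n - u n) * g'' (y n)) / ((w n - v n) + (v n - u n))"
      using y z
    proof eventually_elim
      case (elim n)
      have "(g (v n) - g (u n)) / (v n - u n) = (g (u n) - g (v n)) / (u n - v n)"
        using minus_divide_divide[of "g (u n) - g (v n)" "u n - v n"] by simp
      moreover have "2 * ((c + z' / 2 * (w n - v n)) - (c + y' / 2 * (u n - v n))) = (w n - v n) * z' + (v n - u n) * y'" for c z' y' :: real
        by (simp add: field_simps)
      ultimately have "2 * ((g (w n) - g (v n)) / (w n - v n) - (g (v n) - g (u n)) / (v n - u n))
        = (w n - v n) * g'' (z n) + (v n - u n) * g'' (y n)"
        using elim by (simp only:)
      then show ?case by simp
    qed
  qed simp
qed

section \<open>The smooth geometry\<close>

text \<open>The smooth geometry around the time \<open>t\<close>, with its first derivatives \<open>DA\<close>, \<open>DR\<close> and second derivatives \<open>D2A\<close>, \<open>D2R\<close>.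
  The last argument of a second derivative is the direction of the first differentiation.\<close>
locale warped_flow =
  fixes A \<rho> :: "real \<times> real \<Rightarrow> real"
    and DA DR :: "real \<times> real \<Rightarrow> real \<times> real \<Rightarrow> real"
    and D2A D2R :: "real \<times> real \<Rightarrow> real \<times> real \<Rightarrow> real \<times> real \<Rightarrow> real"
    and xl xr t :: real and J :: "real set"
  assumes J: "open J" "t \<in> J"
    and stretch: "\<And>x u. x \<in> {xl<..<xr} \<Longrightarrow> u \<in> J \<Longrightarrow> 0 < deriv (\<lambda>y. A (y, u)) x"
    and bounded_A: "bounded ((\<lambda>x. A (x, t)) ` {xl<..<xr})"
    and radius_pos: "\<And>x u. x \<in> {xl<..<xr} \<Longrightarrow> u \<in> J \<Longrightarrow> 0 < \<rho> (A (x, u), u)"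
    and DA: "\<And>z. z \<in> {xl<..<xr} \<times> J \<Longrightarrow> (A has_derivative DA z) (at z)"
    and D2A: "\<And>z v. z \<in> {xl<..<xr} \<times> J \<Longrightarrow> ((\<lambda>w. DA w v) has_derivative (\<lambda>u. D2A z u v)) (at z)"
    and cont_D2A: "\<And>u v. continuous_on ({xl<..<xr} \<times> J) (\<lambda>z. D2A z u v)"
    and DR: "\<And>z. z \<in> (\<lambda>(x, u). (A (x, u), u)) ` ({xl<..<xr} \<times> J) \<Longrightarrow> (\<rho> has_derivative DR z) (at z)"
    and D2R: "\<And>z v. z \<in> (\<lambda>(x, u). (A (x, u), u)) ` ({xl<..<xr} \<times> J) \<Longrightarrow>
        ((\<lambda>w. DR w v) has_derivative (\<lambda>u. D2R z u v)) (at z)"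
    and cont_D2R: "\<And>u v. continuous_on ((\<lambda>(x, u). (A (x, u), u)) ` ({xl<..<xr} \<times> J)) (\<lambda>z. D2R z u v)"
begin

abbreviation "I \<equiv> {xl<..<xr}"

lemma image_mem: "x \<in> I \<Longrightarrow> u \<in> J \<Longrightarrow> (A (x, u), u) \<in> (\<lambda>(x, u). (A (x, u), u)) ` (I \<times> J)"
  by force

lemma A_derivatives:
  assumes "x \<in> I" "u \<in> J"
  shows "((\<lambda>y. A (y, u)) has_real_derivative DA (x, u) (1, 0)) (at x)"
    and "((\<lambda>s. A (x, s)) has_real_derivative DA (x, u) (0, 1)) (at u)"
  using has_derivative_slice[OF DA[of "(x, u)"]] assms by auto

lemma deriv_A: "x \<in> I \<Longrightarrow> u \<in> J \<Longrightarrow> deriv (\<lambda>y. A (y, u)) x = DA (x, u) (1, 0)"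
  by (rule DERIV_imp_deriv[OF A_derivatives(1)])

lemma stretch_pos: "x \<in> I \<Longrightarrow> u \<in> J \<Longrightarrow> 0 < DA (x, u) (1, 0)"
  using stretch deriv_A by metis

lemma A_increasing:
  assumes "x \<in> I" "y \<in> I" "x < y" "u \<in> J"
  shows "A (x, u) < A (y, u)"
proof (rule DERIV_pos_imp_increasing[of x y "\<lambda>x. A (x, u)"])
  show "\<exists>d. ((\<lambda>x. A (x, u)) has_real_derivative d) (at z) \<and> 0 < d" if "x \<le> z" "z \<le> y" for z
    using A_derivatives(1)[of z u] stretch_pos[of z u] that assms by auto
qed fact

lemma A_cont: "x \<in> I \<Longrightarrow> isCont (\<lambda>y. A (y, t)) x"
  using A_derivatives(1)[of x t] J by (auto intro: DERIV_isCont)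

text \<open>At a fixed time, the axial distance is strictly increasing in the label, so that convergence of the axial
  distances implies convergence of the labels.\<close>
lemma position_limit:
  assumes p: "p \<in> I" and u: "\<forall>\<^sub>F n in sequentially. u n \<in> I" and l: "(\<lambda>n. A (u n, t)) \<longlonglongrightarrow> A (p, t)"
  shows "u \<longlonglongrightarrow> p"
proof (rule order_tendstoI)
  fix a assume "a < p"
  \<comment> \<open>Replaces \<open>a\<close> by a label inside the interval, where \<open>A\<close> is monotonic.\<close>
  define a' where "a' = max a ((xl + p) / 2)"
  have a': "a' \<in> I" "a' < p" "a \<le> a'" using p \<open>a < p\<close> by (auto simp: a'_def max_def)
  then have "A (a', t) < A (p, t)" using p J by (intro A_increasing) auto
  from order_tendstoD(1)[OF l this] u show "\<forall>\<^sub>F n in sequentially. a < u n"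
  proof eventually_elim
    case (elim n)
    have "a' < u n"
    proof (rule ccontr)
      assume "\<not> a' < u n"
      then have "A (u n, t) \<le> A (a', t)"
        using A_increasing[of "u n" a' t] a' elim J by (cases "u n = a'") auto
      with elim show False by simp
    qed
    with a' show ?case by simp
  qed
next
  fix a assume "p < a"
  define a' where "a' = min a ((xr + p) / 2)"
  have a': "a' \<in> I" "p < a'" "a' \<le> a" using p \<open>p < a\<close> by (auto simp: a'_def min_def)
  then have "A (p, t) < A (a', t)" using p J by (intro A_increasing) auto
  from order_tendstoD(2)[OF l this] u show "\<forall>\<^sub>F n in sequentially. u n < a"
  proof eventually_elim
    case (elim n)
    have "u n < a'"
    proof (rule ccontr)
      assume "\<not> u n < a'"
      then have "A (a', t) \<le> A (u n, t)"
        using A_increasing[of a' "u n" t] a' elim J by (cases "u n = a'") auto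
      with elim show False by simp
    qed
    with a' show ?case by simp
  qed
qed

text \<open>The axial distances of the labels fill a neighbourhood of the one of \<open>p\<close>, so that the profile can be differentiated
  there.\<close>
lemma position_neighbourhood:
  assumes p: "p \<in> I"
  obtains l r where "A (p, t) \<in> {l<..<r}" "\<And>y. y \<in> {l<..<r} \<Longrightarrow> \<exists>x\<in>I. y = A (x, t)"
proof -
  define p1 p2 where "p1 = (xl + p) / 2" and "p2 = (xr + p) / 2"
  have I: "p1 \<in> I" "p2 \<in> I" "p1 < p" "p < p2" using p by (auto simp: p1_def p2_def)
  show thesis
  proof (rule that[of "A (p1, t)" "A (p2, t)"])
    show "A (p, t) \<in> {A (p1, t)<..<A (p2, t)}" using A_increasing I p J by auto
    fix y assume y: "y \<in> {A (p1, t)<..<A (p2, t)}"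
    have "\<exists>x\<ge>p1. x \<le> p2 \<and> A (x, t) = y"
      by (rule IVT) (use y I in \<open>auto intro!: A_cont\<close>)
    then show "\<exists>x\<in>I. y = A (x, t)" using I by force
  qed
qed

definition profile_slope where "profile_slope a = DR (a, t) (1, 0)"
definition profile_curv where "profile_curv a = D2R (a, t) (1, 0) (1, 0)"

lemma profile_derivatives:
  assumes "\<exists>x\<in>I. a = A (x, t)"
  shows "((\<lambda>a. \<rho> (a, t)) has_real_derivative profile_slope a) (at a)"
    and "(profile_slope has_real_derivative profile_curv a) (at a)"
  using has_derivative_slice(1)[OF DR] has_derivative_slice(1)[OF D2R] image_mem J assms
  unfolding profile_slope_def[abs_def] profile_curv_def by blast+

lemma profile_curv_cont:
  assumes p: "p \<in> I" shows "isCont profile_curv (A (p, t))"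
proof -
  obtain l r where lr: "A (p, t) \<in> {l<..<r}" "\<And>y. y \<in> {l<..<r} \<Longrightarrow> \<exists>x\<in>I. y = A (x, t)"
    using position_neighbourhood[OF p] by metis
  have "continuous_on {l<..<r} (\<lambda>a. D2R (a, t) (1, 0) (1, 0))"
  proof (rule continuous_on_compose2[OF cont_D2R])
    show "continuous_on {l<..<r} (\<lambda>a. (a, t))" by (intro continuous_intros)
    show "(\<lambda>a. (a, t)) ` {l<..<r} \<subseteq> (\<lambda>(x, u). (A (x, u), u)) ` (I \<times> J)"
      using lr(2) image_mem J(2) by blast
  qed
  then show ?thesis
    using lr(1) by (simp add: profile_curv_def[abs_def] continuous_on_eq_continuous_at)
qed

lemma profile_deriv:
  assumes p: "p \<in> I"
  shows "deriv (\<lambda>a. \<rho> (a, t)) (A (p, t)) = profile_slope (A (p, t))"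
    and "deriv (deriv (\<lambda>a. \<rho> (a, t))) (A (p, t)) = profile_curv (A (p, t))"
proof -
  have ex: "\<exists>x\<in>I. A (p, t) = A (x, t)" using p by blast
  show "deriv (\<lambda>a. \<rho> (a, t)) (A (p, t)) = profile_slope (A (p, t))"
    by (rule DERIV_imp_deriv[OF profile_derivatives(1)[OF ex]])
  obtain l r where lr: "A (p, t) \<in> {l<..<r}" "\<And>y. y \<in> {l<..<r} \<Longrightarrow> \<exists>x\<in>I. y = A (x, t)"
    using position_neighbourhood[OF p] by metis
  have "\<forall>\<^sub>F y in nhds (A (p, t)). y \<in> {l<..<r}"
    by (rule eventually_nhds_in_open[OF open_greaterThanLessThan lr(1)])
  then have "\<forall>\<^sub>F y in nhds (A (p, t)). deriv (\<lambda>a. \<rho> (a, t)) y = profile_slope y"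
    by eventually_elim (rule DERIV_imp_deriv[OF profile_derivatives(1)[OF lr(2)]])
  then have "deriv (deriv (\<lambda>a. \<rho> (a, t))) (A (p, t)) = deriv profile_slope (A (p, t))"
    by (intro deriv_cong_ev) auto
  also have "\<dots> = profile_curv (A (p, t))"
    by (rule DERIV_imp_deriv[OF profile_derivatives(2)[OF ex]])
  finally show "deriv (deriv (\<lambda>a. \<rho> (a, t))) (A (p, t)) = profile_curv (A (p, t))" .
qed

definition position_rate where "position_rate x = DA (x, t) (0, 1)"
text \<open>Rate of the radius of a section with fixed label: the section also moves with respect to the axial distance.\<close>
definition radius_rate where
  "radius_rate x = DR (A (x, t), t) (1, 0) * position_rate x + DR (A (x, t), t) (0, 1)"

lemma position_rate: "x \<in> I \<Longrightarrow> ((\<lambda>u. A (x, u)) has_real_derivative position_rate x) (at t)"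
  unfolding position_rate_def by (rule A_derivatives(2)) (use J in auto)

lemma radius_rate: "x \<in> I \<Longrightarrow> ((\<lambda>u. \<rho> (A (x, u), u)) has_real_derivative radius_rate x) (at t)"
  unfolding radius_rate_def
  by (rule has_derivative_along_curve[where g = "\<lambda>u. A (x, u)", OF DR position_rate]) (use J image_mem in auto)

lemma position_rate_slope: "x \<in> I \<Longrightarrow> (position_rate has_real_derivative D2A (x, t) (1, 0) (0, 1)) (at x)"
  unfolding position_rate_def[abs_def] using has_derivative_slice(1)[OF D2A[of "(x, t)"]] J by auto

lemma radius_rate_cont:
  assumes "x \<in> I" shows "isCont radius_rate x"
proof -
  have c: "isCont (\<lambda>y. (A (y, t), t)) x"
    by (intro continuous_intros A_cont assms)
  have "isCont (\<lambda>w. DR w v) (A (x, t), t)" for v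
    using D2R[OF image_mem[OF assms J(2)], of v] by (rule has_derivative_continuous)
  then have "isCont (\<lambda>y. DR (A (y, t), t) v) x" for v
    by (rule isCont_o2[OF c])
  moreover have "isCont position_rate x"
    using position_rate_slope[OF assms] by (rule DERIV_isCont)
  ultimately show ?thesis
    unfolding radius_rate_def[abs_def] by (intro continuous_intros)
qed

lemma slice_cont:
  assumes "x \<in> I" shows "isCont (\<lambda>y. D2A (y, t) u v) x" "isCont (\<lambda>y. DA (y, t) v) x"
proof -
  have "continuous_on I (\<lambda>y. D2A (y, t) u v)"
    by (rule continuous_on_compose2[OF cont_D2A]) (use J in \<open>auto intro!: continuous_intros\<close>)
  then show "isCont (\<lambda>y. D2A (y, t) u v) x"
    using assms by (simp add: continuous_on_eq_continuous_at)
  show "isCont (\<lambda>y. DA (y, t) v) x"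
    using has_derivative_slice(1)[OF D2A[of "(x, t)" v]] assms J by (auto intro: DERIV_isCont)
qed

text \<open>The lattice yields the rate of change of the axial distance first and its slope in the label second, while the
  left-hand side differentiates in the opposite order.\<close>
lemma stretch_rate:
  assumes "p \<in> I"
  shows "log_rate (\<lambda>u. deriv (\<lambda>y. A (y, u)) p) t = D2A (p, t) (1, 0) (0, 1) / DA (p, t) (1, 0)"
proof -
  have "\<forall>\<^sub>F u in nhds t. u \<in> J" using J by (rule eventually_nhds_in_open)
  then have ev: "\<forall>\<^sub>F u in nhds t. deriv (\<lambda>y. A (y, u)) p = DA (p, u) (1, 0)"
    by eventually_elim (rule deriv_A[OF assms])
  have "deriv (\<lambda>u. deriv (\<lambda>y. A (y, u)) p) t = deriv (\<lambda>u. DA (p, u) (1, 0)) t"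
    by (rule deriv_cong_ev[OF ev refl])
  also have "\<dots> = D2A (p, t) (0, 1) (1, 0)"
    by (rule DERIV_imp_deriv[OF has_derivative_slice(2)[OF D2A]]) (use assms J in auto)
  also have "\<dots> = D2A (p, t) (1, 0) (0, 1)"
    by (rule C2_mixed_partials[OF _ _ DA D2A cont_D2A, symmetric])
      (use assms J in \<open>auto intro: open_Times\<close>)
  finally show ?thesis using deriv_A[OF assms J(2)] by (simp add: log_rate_def)
qed

end

section \<open>The limit of many sections\<close>

text \<open>The lattices that approximate the geometry, with the chosen vertex on section \<open>i N\<close>.\<close>
locale lattice_sequence = warped_flow +
  fixes x0 K :: real and x :: "nat \<Rightarrow> nat \<Rightarrow> real" and i :: "nat \<Rightarrow> nat"
    and F :: "nat \<Rightarrow> real \<Rightarrow> real \<Rightarrow> frustum_lattice"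
  assumes x_mem: "\<And>N j. j \<in> {1..N} \<Longrightarrow> x N j \<in> I"
    and x_less: "\<And>N j. j \<in> {1..<N} \<Longrightarrow> x N j < x N (Suc j)"
    and ends: "(\<lambda>N. x N 1) \<longlonglongrightarrow> xl" "(\<lambda>N. x N N) \<longlonglongrightarrow> xr"
    and spaced: "\<And>N. nearly_equally_spaced K N (\<lambda>j. A (x N j, t))"
    and approx: "\<And>N \<xi> u. 0 < \<xi> \<Longrightarrow> u \<in> J \<Longrightarrow>
           approximates (F N \<xi> u) N \<xi> (\<lambda>j. A (x N j, u)) (\<lambda>a. \<rho> (a, u))"
    and i_mem: "\<And>N. 2 \<le> N \<Longrightarrow> i N \<in> {1..<N}"
    and x0: "x0 \<in> I" "(\<lambda>N. x N (i N)) \<longlonglongrightarrow> x0"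
begin

abbreviation "pos N j \<equiv> A (x N j, t)"
abbreviation "rad N j \<equiv> \<rho> (A (x N j, t), t)"
abbreviation "len N j \<equiv> pos N (Suc j) - pos N j"

lemma fixed: "fixed_sections N (rad N) (len N) (\<lambda>\<xi>. F N \<xi> t)"
proof unfold_locales
  show "0 < rad N j" if "j \<in> {1..N}" for j
    using x_mem[OF that] J by (intro radius_pos)
  show "0 < len N j" if "j \<in> {1..<N}" for j
    using A_increasing[OF x_mem x_mem x_less] that J by simp
qed (use approx J in \<open>auto simp: approximates_def\<close>)

lemma moving:
  assumes "lattice_triangle P Q R" "k \<in> {1..<N}"
  shows "moving_block P Q R k (\<lambda>u. \<rho> (A (x N k, u), u)) (\<lambda>u. \<rho> (A (x N (Suc k), u), u))
    (\<lambda>u. A (x N (Suc k), u) - A (x N k, u)) (radius_rate (x N k)) (radius_rate (x N (Suc k)))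
    (position_rate (x N (Suc k)) - position_rate (x N k)) t J (F N)"
proof -
  have k: "x N k \<in> I" "x N (Suc k) \<in> I" "x N k < x N (Suc k)"
    using assms(2) x_mem[of k N] x_mem[of "Suc k" N] x_less[of k N] by auto
  show ?thesis
    by unfold_locales
      (use assms k J approx in \<open>auto simp: approximates_def intro!: radius_rate position_rate DERIV_diff radius_pos A_increasing\<close>)
qed

text \<open>If one gap were large, all of them would be, up to the factor \<open>K\<close>; but their sum is bounded, so that each is of
  order \<open>1 / N\<close>.\<close>
lemma gap_limit:
  assumes "\<forall>\<^sub>F N in sequentially. k N \<in> {1..<N}"
  shows "(\<lambda>N. len N (k N)) \<longlonglongrightarrow> 0"
proof -
  from bounded_A obtain B where "\<forall>y\<in>(\<lambda>x. A (x, t)) ` I. norm y \<le> B"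
    unfolding bounded_iff ..
  then have B: "\<bar>A (y, t)\<bar> \<le> B" if "y \<in> I" for y using that by force
  define C where "C = \<bar>K\<bar> * (2 * B)"
  show ?thesis
  proof (rule tendsto_sandwich)
    show "\<forall>\<^sub>F N in sequentially. 0 \<le> len N (k N)"
      using assms by eventually_elim (use fixed_sections.pos(2)[OF fixed] in \<open>auto simp: less_imp_le\<close>)
    show "\<forall>\<^sub>F N in sequentially. len N (k N) \<le> C / (real N - 1)"
      using assms eventually_ge_at_top[of 2]
    proof eventually_elim
      case (elim N)
      have "(real N - 1) * len N (k N) = (\<Sum>j\<in>{1..<N}. len N (k N))"
        using elim by (simp add: of_nat_diff)
      also have "\<dots> \<le> (\<Sum>j\<in>{1..<N}. K * len N j)"
        using spaced[of N] elim by (intro sum_mono) (auto simp: nearly_equally_spaced_def)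
      also have "\<dots> = K * (pos N N - pos N 1)"
        using elim sum_Suc_diff'[of 1 N "pos N"] by (simp add: sum_distrib_left[symmetric])
      also have "\<dots> \<le> \<bar>K\<bar> * \<bar>pos N N - pos N 1\<bar>"
        by (metis abs_ge_self abs_mult)
      also have "\<dots> \<le> C"
        unfolding C_def using B[OF x_mem[of N N]] B[OF x_mem[of 1 N]] elim by (intro mult_left_mono) auto
      finally show ?case using elim by (simp add: field_simps)
    qed
    show "(\<lambda>N. C / (real N - 1)) \<longlonglongrightarrow> 0"
    proof (rule tendsto_divide_0[OF tendsto_const])
      have "filterlim (\<lambda>N. - 1 + real N) at_top sequentially"
        by (rule filterlim_tendsto_add_at_top[OF tendsto_const filterlim_real_sequentially])
      then show "filterlim (\<lambda>N. real N - 1) at_infinity sequentially"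
        by (simp add: filterlim_at_top_imp_at_infinity)
    qed
  qed simp
qed

lemma neighbour_limit:
  assumes k: "\<forall>\<^sub>F N in sequentially. k N \<in> {1..<N}"
  shows "(\<lambda>N. x N (k N)) \<longlonglongrightarrow> x0 \<Longrightarrow> (\<lambda>N. x N (Suc (k N))) \<longlonglongrightarrow> x0"
    and "(\<lambda>N. x N (Suc (k N))) \<longlonglongrightarrow> x0 \<Longrightarrow> (\<lambda>N. x N (k N)) \<longlonglongrightarrow> x0"
proof -
  note gap = gap_limit[OF k]
  have mem: "\<forall>\<^sub>F N in sequentially. x N (k N) \<in> I" "\<forall>\<^sub>F N in sequentially. x N (Suc (k N)) \<in> I"
    by (rule eventually_mono[OF k], rule x_mem, simp)+
  {
    assume "(\<lambda>N. x N (k N)) \<longlonglongrightarrow> x0"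
    then have "(\<lambda>N. pos N (k N)) \<longlonglongrightarrow> A (x0, t)" by (rule isCont_tendsto_compose[OF A_cont[OF x0(1)]])
    from tendsto_add[OF this gap] show "(\<lambda>N. x N (Suc (k N))) \<longlonglongrightarrow> x0"
      by (intro position_limit[OF x0(1) mem(2)]) simp
  next
    assume "(\<lambda>N. x N (Suc (k N))) \<longlonglongrightarrow> x0"
    then have "(\<lambda>N. pos N (Suc (k N))) \<longlonglongrightarrow> A (x0, t)" by (rule isCont_tendsto_compose[OF A_cont[OF x0(1)]])
    from tendsto_diff[OF this gap] show "(\<lambda>N. x N (k N)) \<longlonglongrightarrow> x0"
      by (intro position_limit[OF x0(1) mem(1)]) simp
  }
qed

text \<open>The two equations at section \<open>i N\<close> involve the sections from \<open>i N - 1\<close> to \<open>i N + 2\<close>. Numbering them from \<open>j N\<close> avoids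
  subtractions.\<close>
definition j where "j N = i N - 1"

lemma eventually_i: "\<forall>\<^sub>F N in sequentially. i N \<in> {1..<N}"
  using eventually_ge_at_top[of 2] by eventually_elim (rule i_mem)

text \<open>The labels of the end sections tend to the ends of the interval while those of sections \<open>i N\<close> and \<open>i N + 1\<close> tend to
  \<open>x0\<close>. Hence the end caps do not take part in the equations for large \<open>N\<close>.\<close>
lemma eventually_interior:
  "\<forall>\<^sub>F N in sequentially. 1 \<le> j N \<and> Suc (j N) = i N \<and> Suc (Suc (j N)) < N"
proof -
  have "\<forall>\<^sub>F N in sequentially. x N 1 < (xl + x0) / 2" "\<forall>\<^sub>F N in sequentially. (xl + x0) / 2 < x N (i N)"
    using order_tendstoD(2)[OF ends(1), of "(xl + x0) / 2"] order_tendstoD(1)[OF x0(2), of "(xl + x0) / 2"] x0(1)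
    by simp_all
  moreover have "\<forall>\<^sub>F N in sequentially. (x0 + xr) / 2 < x N N" "\<forall>\<^sub>F N in sequentially. x N (Suc (i N)) < (x0 + xr) / 2"
    using order_tendstoD(1)[OF ends(2), of "(x0 + xr) / 2"]
      order_tendstoD(2)[OF neighbour_limit(1)[OF eventually_i x0(2)], of "(x0 + xr) / 2"] x0(1)
    by simp_all
  ultimately show ?thesis
    using eventually_i
  proof eventually_elim
    case (elim N)
    then have "i N \<noteq> 1" "Suc (i N) \<noteq> N" by auto
    with elim show ?case by (auto simp: j_def)
  qed
qed

lemma eventually_range:
  "\<forall>\<^sub>F N in sequentially. j N \<in> {1..<N}" "\<forall>\<^sub>F N in sequentially. Suc (j N) \<in> {1..<N}"
  "\<forall>\<^sub>F N in sequentially. Suc (Suc (j N)) \<in> {1..<N}"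
  using eventually_interior by (auto elim!: eventually_mono)

lemma x_limits:
  "(\<lambda>N. x N (j N)) \<longlonglongrightarrow> x0" "(\<lambda>N. x N (Suc (j N))) \<longlonglongrightarrow> x0" "(\<lambda>N. x N (Suc (Suc (j N)))) \<longlonglongrightarrow> x0"
  "(\<lambda>N. x N (Suc (Suc (Suc (j N))))) \<longlonglongrightarrow> x0"
proof -
  have "\<forall>\<^sub>F N in sequentially. x N (Suc (j N)) = x N (i N)"
    using eventually_interior by eventually_elim auto
  then show 1: "(\<lambda>N. x N (Suc (j N))) \<longlonglongrightarrow> x0"
    by (rule tendsto_eventually_eq[OF x0(2) _ refl])
  show "(\<lambda>N. x N (j N)) \<longlonglongrightarrow> x0" by (rule neighbour_limit(2)[OF eventually_range(1) 1])
  show 2: "(\<lambda>N. x N (Suc (Suc (j N)))) \<longlonglongrightarrow> x0" by (rule neighbour_limit(1)[OF eventually_range(2) 1])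
  show "(\<lambda>N. x N (Suc (Suc (Suc (j N))))) \<longlonglongrightarrow> x0" by (rule neighbour_limit(1)[OF eventually_range(3) 2])
qed

abbreviation "a0 \<equiv> A (x0, t)"

lemma pos_limit: "u \<longlonglongrightarrow> x0 \<Longrightarrow> (\<lambda>N. A (u N, t)) \<longlonglongrightarrow> a0"
  by (rule isCont_tendsto_compose[OF A_cont[OF x0(1)]])

lemma rad_limit: "u \<longlonglongrightarrow> x0 \<Longrightarrow> (\<lambda>N. \<rho> (A (u N, t), t)) \<longlonglongrightarrow> \<rho> (a0, t)"
proof -
  have "isCont (\<lambda>a. \<rho> (a, t)) a0"
    by (rule DERIV_isCont[OF profile_derivatives(1)]) (use x0(1) in blast)
  then show "u \<longlonglongrightarrow> x0 \<Longrightarrow> (\<lambda>N. \<rho> (A (u N, t), t)) \<longlonglongrightarrow> \<rho> (a0, t)"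
    by (rule isCont_tendsto_compose) (rule pos_limit)
qed

lemma rad0_pos: "0 < \<rho> (a0, t)"
  by (rule radius_pos[OF x0(1) J(2)])

lemma eventually_order:
  "\<forall>\<^sub>F N in sequentially. x N (j N) < x N (Suc (j N)) \<and> x N (Suc (j N)) < x N (Suc (Suc (j N))) \<and>
     x N (Suc (Suc (j N))) < x N (Suc (Suc (Suc (j N))))"
  using eventually_range by eventually_elim (blast intro: x_less)

lemma eventually_len:
  "\<forall>\<^sub>F N in sequentially. 0 < len N (j N) \<and> 0 < len N (Suc (j N)) \<and> 0 < len N (Suc (Suc (j N)))"
  using eventually_range by eventually_elim (blast intro: fixed_sections.pos(2)[OF fixed])

lemma slope_limit:
  assumes "u \<longlonglongrightarrow> x0" "v \<longlonglongrightarrow> x0" "\<forall>\<^sub>F N in sequentially. A (u N, t) < A (v N, t)"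
  shows "(\<lambda>N. (\<rho> (A (v N, t), t) - \<rho> (A (u N, t), t)) / (A (v N, t) - A (u N, t))) \<longlonglongrightarrow> profile_slope a0"
proof -
  obtain l r where lr: "a0 \<in> {l<..<r}" "\<And>y. y \<in> {l<..<r} \<Longrightarrow> \<exists>x\<in>I. y = A (x, t)"
    using position_neighbourhood[OF x0(1)] by metis
  show ?thesis
  proof (rule difference_quotient_limit[OF pos_limit pos_limit _ lr(1)])
    show "((\<lambda>a. \<rho> (a, t)) has_real_derivative profile_slope y) (at y)" if "y \<in> {l<..<r}" for y
      by (rule profile_derivatives(1)[OF lr(2)[OF that]])
    show "isCont profile_slope a0"
      by (rule DERIV_isCont[OF profile_derivatives(2)[OF lr(2)[OF lr(1)]]])
  qed fact+
qed

lemma second_slope_limit: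
  assumes "u \<longlonglongrightarrow> x0" "v \<longlonglongrightarrow> x0" "w \<longlonglongrightarrow> x0"
    and "\<forall>\<^sub>F N in sequentially. A (u N, t) < A (v N, t) \<and> A (v N, t) < A (w N, t)"
  shows "(\<lambda>N. 2 * ((\<rho> (A (w N, t), t) - \<rho> (A (v N, t), t)) / (A (w N, t) - A (v N, t)) -
     (\<rho> (A (v N, t), t) - \<rho> (A (u N, t), t)) / (A (v N, t) - A (u N, t))) / (A (w N, t) - A (u N, t)))
    \<longlonglongrightarrow> profile_curv a0"
proof -
  obtain l r where lr: "a0 \<in> {l<..<r}" "\<And>y. y \<in> {l<..<r} \<Longrightarrow> \<exists>x\<in>I. y = A (x, t)"
    using position_neighbourhood[OF x0(1)] by metis
  show ?thesis
  proof (rule second_difference_limit[OF pos_limit pos_limit pos_limit assms(4) lr(1)])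
    show "isCont profile_curv a0" by (rule profile_curv_cont[OF x0(1)])
    show "((\<lambda>a. \<rho> (a, t)) has_real_derivative profile_slope y) (at y)"
      "(profile_slope has_real_derivative profile_curv y) (at y)" if "y \<in> {l<..<r}" for y
      by (rule profile_derivatives[OF lr(2)[OF that]])+
  qed fact+
qed

text \<open>The numerator is a second divided difference of the profile, and the denominator a convex combination of two
  quantities that both tend to four times the radius.\<close>
lemma edge_curvature_continuum:
  assumes k: "\<forall>\<^sub>F N in sequentially. k N \<in> {1..<N} \<and> Suc (k N) \<in> {1..<N}"
    and l: "(\<lambda>N. x N (k N)) \<longlonglongrightarrow> x0" "(\<lambda>N. x N (Suc (k N))) \<longlonglongrightarrow> x0" "(\<lambda>N. x N (Suc (Suc (k N)))) \<longlonglongrightarrow> x0"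
  shows "(\<lambda>N. fixed_sections.edge_curvature (rad N) (len N) (k N)) \<longlonglongrightarrow> - profile_curv a0 / \<rho> (a0, t)"
proof (rule tendsto_eventually_eq)
  have len: "\<forall>\<^sub>F N in sequentially. 0 < len N (Suc (k N)) \<and> 0 < len N (k N)"
    using k by eventually_elim (blast intro: fixed_sections.pos(2)[OF fixed])
  let ?Q = "\<lambda>N. 2 * ((rad N (Suc (Suc (k N))) - rad N (Suc (k N))) / len N (Suc (k N)) -
     (rad N (Suc (k N)) - rad N (k N)) / len N (k N)) / (pos N (Suc (Suc (k N))) - pos N (k N))"
  let ?M = "\<lambda>N. (len N (Suc (k N)) * (3 * rad N (Suc (k N)) + rad N (Suc (Suc (k N)))) +
     len N (k N) * (rad N (k N) + 3 * rad N (Suc (k N)))) / (len N (Suc (k N)) + len N (k N))"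
  have Q: "?Q \<longlonglongrightarrow> profile_curv a0"
    by (rule second_slope_limit[OF l]) (use len in \<open>auto elim!: eventually_mono\<close>)
  have "?M \<longlonglongrightarrow> 3 * \<rho> (a0, t) + \<rho> (a0, t)"
  proof (rule convex_combination_limit[OF len])
    show "(\<lambda>N. 3 * rad N (Suc (k N)) + rad N (Suc (Suc (k N)))) \<longlonglongrightarrow> 3 * \<rho> (a0, t) + \<rho> (a0, t)"
      by (intro tendsto_intros rad_limit l)
    have "(\<lambda>N. rad N (k N) + 3 * rad N (Suc (k N))) \<longlonglongrightarrow> \<rho> (a0, t) + 3 * \<rho> (a0, t)"
      by (intro tendsto_intros rad_limit l)
    then show "(\<lambda>N. rad N (k N) + 3 * rad N (Suc (k N))) \<longlonglongrightarrow> 3 * \<rho> (a0, t) + \<rho> (a0, t)"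
      by simp
  qed
  then show "(\<lambda>N. - 4 * ?Q N / ?M N) \<longlonglongrightarrow> - 4 * profile_curv a0 / (3 * \<rho> (a0, t) + \<rho> (a0, t))"
    by (intro tendsto_intros Q) (use rad0_pos in auto)
  show "\<forall>\<^sub>F N in sequentially. fixed_sections.edge_curvature (rad N) (len N) (k N) = - 4 * ?Q N / ?M N"
    using len
  proof eventually_elim
    case (elim N)
    have e: "fixed_sections.edge_curvature (rad N) (len N) (k N) = 8 * (s1 - s2) / m"
      if "s1 = (rad N (Suc (k N)) - rad N (k N)) / len N (k N)"
        "s2 = (rad N (Suc (Suc (k N))) - rad N (Suc (k N))) / len N (Suc (k N))"
        "m = len N (Suc (k N)) * (3 * rad N (Suc (k N)) + rad N (Suc (Suc (k N)))) +
         len N (k N) * (rad N (k N) + 3 * rad N (Suc (k N)))" for s1 s2 m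
      unfolding fixed_sections.edge_curvature_def[OF fixed] fixed_sections.slope_def[OF fixed] that ..
    have t: "pos N (Suc (Suc (k N))) - pos N (k N) = len N (Suc (k N)) + len N (k N)" by simp
    have "len N (Suc (k N)) + len N (k N) \<noteq> 0" using elim by linarith
    then have "- 4 * (2 * (s2 - s1) / (len N (Suc (k N)) + len N (k N))) / (m / (len N (Suc (k N)) + len N (k N))) = 8 * (s1 - s2) / m" for s1 s2 m
      by (simp add: divide_simps)
    then show ?case unfolding t e[OF refl refl refl] by (simp only:)
  qed
  show "- 4 * profile_curv a0 / (3 * \<rho> (a0, t) + \<rho> (a0, t)) = - profile_curv a0 / \<rho> (a0, t)"
    using rad0_pos by (simp add: field_simps)
qed

lemma axial_curvature_continuum:
  "(\<lambda>N. fixed_sections.axial_curvature (rad N) (len N) (Suc (j N))) \<longlonglongrightarrow> (1 - (profile_slope a0)\<^sup>2) / (\<rho> (a0, t))\<^sup>2"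
proof -
  have "(\<lambda>N. (rad N (Suc (Suc (j N))) - rad N (Suc (j N))) / len N (Suc (j N))) \<longlonglongrightarrow> profile_slope a0"
    by (rule slope_limit[OF x_limits(2,3)]) (use eventually_len in \<open>auto elim!: eventually_mono\<close>)
  then have "(\<lambda>N. fixed_sections.axial_curvature (rad N) (len N) (Suc (j N))) \<longlonglongrightarrow>
     (1 - (profile_slope a0)\<^sup>2) / ((\<rho> (a0, t) + \<rho> (a0, t)) / 2)\<^sup>2"
    unfolding fixed_sections.axial_curvature_def[OF fixed] fixed_sections.slope_def[OF fixed]
    by (intro tendsto_intros rad_limit x_limits) (use rad0_pos in auto)
  then show ?thesis by simp
qed

lemma Rc_alpha_continuum:
  "continuum_limit (\<lambda>N \<xi>. - Rc_alpha (F N \<xi> t) (i N)) (2 * (profile_curv a0 / \<rho> (a0, t)))"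
  unfolding continuum_limit_def
proof (intro exI conjI)
  let ?g = "\<lambda>N. - (2 * fixed_sections.edge_curvature (rad N) (len N) (j N))"
  show "\<forall>\<^sub>F N in sequentially. ((\<lambda>\<xi>. - Rc_alpha (F N \<xi> t) (i N)) \<rightarrow>\<^sub>0 ?g N)"
    using eventually_interior
  proof eventually_elim
    case (elim N)
    then show ?case
      using tendsto_minus[OF fixed_sections.Rc_alpha_limit[OF fixed, of "j N" N]] by auto
  qed
  have "?g \<longlonglongrightarrow> - (2 * (- profile_curv a0 / \<rho> (a0, t)))"
    by (intro tendsto_minus tendsto_mult tendsto_const edge_curvature_continuum x_limits)
      (use eventually_interior in \<open>auto elim!: eventually_mono\<close>)
  then show "?g \<longlonglongrightarrow> 2 * (profile_curv a0 / \<rho> (a0, t))" by simp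
qed

lemma Rc_sigma_continuum:
  "continuum_limit (\<lambda>N \<xi>. - Rc_sigma (F N \<xi> t) (i N))
     (profile_curv a0 / \<rho> (a0, t) + (profile_slope a0 / \<rho> (a0, t))\<^sup>2 - 1 / (\<rho> (a0, t))\<^sup>2)"
  unfolding continuum_limit_def
proof (intro exI conjI)
  let ?E = "\<lambda>N. fixed_sections.edge_curvature (rad N) (len N)"
  let ?C = "\<lambda>N. (rad N (Suc (j N)) * ?E N (j N) + rad N (Suc (Suc (j N))) * ?E N (Suc (j N))) /
     (rad N (Suc (j N)) + rad N (Suc (Suc (j N))))"
  let ?g = "\<lambda>N. - (?C N + fixed_sections.axial_curvature (rad N) (len N) (Suc (j N)))"
  show "\<forall>\<^sub>F N in sequentially. ((\<lambda>\<xi>. - Rc_sigma (F N \<xi> t) (i N)) \<rightarrow>\<^sub>0 ?g N)"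
    using eventually_interior
  proof eventually_elim
    case (elim N)
    then show ?case
      using tendsto_minus[OF fixed_sections.Rc_sigma_limit[OF fixed, of "j N" N]] by auto
  qed
  have "?C \<longlonglongrightarrow> - profile_curv a0 / \<rho> (a0, t)"
  proof (rule convex_combination_limit)
    show "\<forall>\<^sub>F N in sequentially. 0 < rad N (Suc (j N)) \<and> 0 < rad N (Suc (Suc (j N)))"
      using eventually_range(2,3) by eventually_elim (auto intro!: fixed_sections.pos(1)[OF fixed])
    show "(\<lambda>N. ?E N (j N)) \<longlonglongrightarrow> - profile_curv a0 / \<rho> (a0, t)"
      by (intro edge_curvature_continuum x_limits) (use eventually_interior in \<open>auto elim!: eventually_mono\<close>)
    show "(\<lambda>N. ?E N (Suc (j N))) \<longlonglongrightarrow> - profile_curv a0 / \<rho> (a0, t)"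
      by (intro edge_curvature_continuum x_limits) (use eventually_interior in \<open>auto elim!: eventually_mono\<close>)
  qed
  then have "?g \<longlonglongrightarrow> - (- profile_curv a0 / \<rho> (a0, t) + (1 - (profile_slope a0)\<^sup>2) / (\<rho> (a0, t))\<^sup>2)"
    by (intro tendsto_minus tendsto_add axial_curvature_continuum)
  moreover have "- (- profile_curv a0 / \<rho> (a0, t) + (1 - (profile_slope a0)\<^sup>2) / (\<rho> (a0, t))\<^sup>2)
      = profile_curv a0 / \<rho> (a0, t) + (profile_slope a0 / \<rho> (a0, t))\<^sup>2 - 1 / (\<rho> (a0, t))\<^sup>2"
    by (simp add: diff_divide_distrib power_divide)
  ultimately show "?g \<longlonglongrightarrow> profile_curv a0 / \<rho> (a0, t) + (profile_slope a0 / \<rho> (a0, t))\<^sup>2 - 1 / (\<rho> (a0, t))\<^sup>2"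
    by (simp only:)
qed

text \<open>To leading order \<open>dual_alpha\<close> is half of the axial distance between the sections below and above.\<close>
lemma alpha_rate:
  assumes k: "1 \<le> k" "Suc k < N"
  shows "(\<lambda>\<xi>. log_rate (\<lambda>u. dual_alpha (F N \<xi> u) (Suc k)) t) \<rightarrow>\<^sub>0 (position_rate (x N (Suc (Suc k))) - position_rate (x N k)) / (pos N (Suc (Suc k)) - pos N k)"
proof -
  let ?d = "\<lambda>\<xi> u. dist (block_center (F N \<xi> u) k pt_O pt_X pt_Y) (upper_center (F N \<xi> u) k pt_O pt_X pt_Y)
     + dist (block_center (F N \<xi> u) (Suc k) pt_O pt_X pt_Y) (sec_center (F N \<xi> u) (Suc k) pt_O pt_X pt_Y)"
  note tri = fixed_sections.base_triangles(1)[OF fixed]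
  have k': "k \<in> {1..<N}" "Suc k \<in> {1..<N}" using k by auto
  have eq: "dual_alpha (F N \<xi> u) (Suc k) = ?d \<xi> u" if "0 < \<xi>" "u \<in> J" for \<xi> u
    using approx[OF that] k by (simp add: dual_alpha_def approximates_def)
  let ?r = "position_rate (x N (Suc k)) - position_rate (x N k)"
  let ?r' = "position_rate (x N (Suc (Suc k))) - position_rate (x N (Suc k))"
  have rate: "has_rate_limit ?d t (?r / 2 + ?r' / 2)"
    by (intro has_rate_limit_add moving_block.base_dist_rate[OF moving[OF tri]]
      moving_block.roof_dist_rate[OF moving[OF tri]] k')
  have len: "0 < len N k" "0 < len N (Suc k)"
    by (rule fixed_sections.pos(2)[OF fixed], rule k')+
  have v: "(\<lambda>\<xi>. ?d \<xi> t) \<rightarrow>\<^sub>0 (len N k + len N (Suc k)) / 2"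
    by (rule tendsto_eventually_eq[OF fixed_sections.dual_alpha_limit[OF fixed k] _ refl])
      (rule eventually_mono[OF eventually_pos], simp add: eq J)
  have "(\<lambda>\<xi>. log_rate (\<lambda>u. dual_alpha (F N \<xi> u) (Suc k)) t) \<rightarrow>\<^sub>0 (?r / 2 + ?r' / 2) / ((len N k + len N (Suc k)) / 2)"
  proof (rule log_rate_limit[OF rate v, where s = "\<lambda>_. 1"])
    show "(len N k + len N (Suc k)) / 2 \<noteq> 0" using len by simp
    show "\<forall>\<^sub>F \<xi> in at_right 0. (1::real) \<noteq> 0 \<and> (\<forall>\<^sub>F u in nhds t. dual_alpha (F N \<xi> u) (Suc k) = 1 * ?d \<xi> u)"
      using eventually_pos
    proof eventually_elim
      case (elim \<xi>)
      have "\<forall>\<^sub>F u in nhds t. u \<in> J" using J by (rule eventually_nhds_in_open)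
      then have "\<forall>\<^sub>F u in nhds t. dual_alpha (F N \<xi> u) (Suc k) = 1 * ?d \<xi> u"
        by eventually_elim (simp add: eq elim)
      then show ?case by simp
    qed
  qed
  moreover have "(?r / 2 + ?r' / 2) / ((len N k + len N (Suc k)) / 2) =
    (position_rate (x N (Suc (Suc k))) - position_rate (x N k)) / (pos N (Suc (Suc k)) - pos N k)"
  proof -
    have "?r / 2 + ?r' / 2 = (position_rate (x N (Suc (Suc k))) - position_rate (x N k)) / 2" by (simp add: field_simps)
    moreover have "len N k + len N (Suc k) = pos N (Suc (Suc k)) - pos N k" by simp
    ultimately show ?thesis by simp
  qed
  ultimately show ?thesis by (simp only:)
qed

text \<open>To leading order \<open>dual_sigma\<close> is proportional to the resolution times the mean of the two radii.\<close>
lemma sigma_rate: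
  assumes k: "k \<in> {1..<N}"
  shows "(\<lambda>\<xi>. log_rate (\<lambda>u. dual_sigma (F N \<xi> u) k) t) \<rightarrow>\<^sub>0 (radius_rate (x N k) + radius_rate (x N (Suc k))) / (rad N k + rad N (Suc k))"
proof -
  let ?e = "\<lambda>m \<xi> u. dist (block_center (F N \<xi> u) k pt_O pt_X (apex m pt_O pt_X))
     (lateral_center (F N \<xi> u) k pt_O pt_X (apex m pt_O pt_X) 0 (Suc 0)) / \<xi>"
  let ?d = "\<lambda>\<xi> u. ?e 1 \<xi> u + ?e 5 \<xi> u"
  note adj = fixed_sections.base_triangles(4)[OF fixed]
  have eq: "dual_sigma (F N \<xi> u) k = \<xi> * ?d \<xi> u" if "0 < \<xi>" for \<xi> u
    using that by (simp add: dual_sigma_def Let_def distrib_left)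
  let ?r = "radius_rate (x N k) + radius_rate (x N (Suc k))"
  have rate: "has_rate_limit ?d t (?r / (4 * sqrt 3) + ?r / (4 * sqrt 3))"
    by (intro has_rate_limit_add moving_block.lateral_dist_rate[OF moving[OF lattice_triangle_apex[OF adj]]] k) auto
  have rad: "0 < rad N k" "0 < rad N (Suc k)" using k by (auto intro!: fixed_sections.pos(1)[OF fixed])
  have k': "1 \<le> k" "k < N" using k by auto
  have v: "(\<lambda>\<xi>. ?d \<xi> t) \<rightarrow>\<^sub>0 (rad N k + rad N (Suc k)) / (2 * sqrt 3)"
    by (rule tendsto_eventually_eq[OF fixed_sections.dual_sigma_limit[OF fixed k'] _ refl])
      (rule eventually_mono[OF eventually_pos], simp add: eq)
  have "(\<lambda>\<xi>. log_rate (\<lambda>u. dual_sigma (F N \<xi> u) k) t) \<rightarrow>\<^sub>0 (?r / (4 * sqrt 3) + ?r / (4 * sqrt 3)) / ((rad N k + rad N (Suc k)) / (2 * sqrt 3))"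
  proof (rule log_rate_limit[OF rate v, where s = "\<lambda>\<xi>. \<xi>"])
    show "(rad N k + rad N (Suc k)) / (2 * sqrt 3) \<noteq> 0" using rad by simp
    show "\<forall>\<^sub>F \<xi> in at_right 0. \<xi> \<noteq> 0 \<and> (\<forall>\<^sub>F u in nhds t. dual_sigma (F N \<xi> u) k = \<xi> * ?d \<xi> u)"
      using eventually_pos by eventually_elim (simp add: eq del: distrib_left_numeral)
  qed
  moreover have "(?r / (4 * sqrt 3) + ?r / (4 * sqrt 3)) / ((rad N k + rad N (Suc k)) / (2 * sqrt 3)) = ?r / (rad N k + rad N (Suc k))"
  proof -
    have "(d / (4 * q) + d / (4 * q)) / (m / (2 * q)) = d / m" if "q \<noteq> 0" for d m q :: real
    proof -
      have "d / (4 * q) + d / (4 * q) = d / (2 * q)" by (simp add: field_simps)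
      then show ?thesis using that by simp
    qed
    then show ?thesis by simp
  qed
  ultimately show ?thesis by simp
qed

text \<open>After the first limit, the rate is a quotient of two differences in the label, of the rate of the axial
  distance and of the axial distance itself.\<close>
lemma alpha_rate_continuum:
  "continuum_limit (\<lambda>N \<xi>. log_rate (\<lambda>u. dual_alpha (F N \<xi> u) (i N)) t)
     (log_rate (\<lambda>u. deriv (\<lambda>y. A (y, u)) x0) t)"
  unfolding continuum_limit_def
proof (intro exI conjI)
  let ?P = "\<lambda>N. x N (j N)" and ?R = "\<lambda>N. x N (Suc (Suc (j N)))"
  let ?g = "\<lambda>N. (position_rate (?R N) - position_rate (?P N)) / (A (?R N, t) - A (?P N, t))"
  show "\<forall>\<^sub>F N in sequentially. ((\<lambda>\<xi>. log_rate (\<lambda>u. dual_alpha (F N \<xi> u) (i N)) t) \<rightarrow>\<^sub>0 ?g N)"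
    using eventually_interior
  proof eventually_elim
    case (elim N)
    then show ?case using alpha_rate[of "j N" N] by auto
  qed
  have lt: "\<forall>\<^sub>F N in sequentially. ?P N < ?R N"
    using eventually_order by eventually_elim auto
  have n: "(\<lambda>N. (position_rate (?R N) - position_rate (?P N)) / (?R N - ?P N)) \<longlonglongrightarrow> D2A (x0, t) (1, 0) (0, 1)"
    by (rule difference_quotient_limit[OF x_limits(1,3) lt x0(1) position_rate_slope])
      (auto intro: slice_cont[OF x0(1)])
  have d: "(\<lambda>N. (A (?R N, t) - A (?P N, t)) / (?R N - ?P N)) \<longlonglongrightarrow> DA (x0, t) (1, 0)"
    by (rule difference_quotient_limit[OF x_limits(1,3) lt x0(1) A_derivatives(1)])
      (auto intro: slice_cont[OF x0(1)] simp: J)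
  have "DA (x0, t) (1, 0) \<noteq> 0" using stretch_pos[OF x0(1) J(2)] by simp
  from tendsto_divide[OF n d this]
  show "?g \<longlonglongrightarrow> log_rate (\<lambda>u. deriv (\<lambda>y. A (y, u)) x0) t"
  proof (rule tendsto_eventually_eq)
    show "\<forall>\<^sub>F N in sequentially. ?g N = (position_rate (?R N) - position_rate (?P N)) / (?R N - ?P N) / ((A (?R N, t) - A (?P N, t)) / (?R N - ?P N))"
      using lt by eventually_elim simp
  qed (simp add: stretch_rate[OF x0(1)])
qed

lemma sigma_rate_continuum:
  "continuum_limit (\<lambda>N \<xi>. log_rate (\<lambda>u. dual_sigma (F N \<xi> u) (i N)) t)
     (log_rate (\<lambda>u. \<rho> (A (x0, u), u)) t)"
  unfolding continuum_limit_def
proof (intro exI conjI)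
  let ?P = "\<lambda>N. x N (Suc (j N))" and ?R = "\<lambda>N. x N (Suc (Suc (j N)))"
  let ?g = "\<lambda>N. (radius_rate (?P N) + radius_rate (?R N)) / (\<rho> (A (?P N, t), t) + \<rho> (A (?R N, t), t))"
  show "\<forall>\<^sub>F N in sequentially. ((\<lambda>\<xi>. log_rate (\<lambda>u. dual_sigma (F N \<xi> u) (i N)) t) \<rightarrow>\<^sub>0 ?g N)"
    using eventually_interior
  proof eventually_elim
    case (elim N)
    then show ?case using sigma_rate[of "Suc (j N)" N] by auto
  qed
  have "?g \<longlonglongrightarrow> (radius_rate x0 + radius_rate x0) / (\<rho> (a0, t) + \<rho> (a0, t))"
    by (intro tendsto_divide tendsto_add rad_limit x_limits isCont_tendsto_compose[OF radius_rate_cont[OF x0(1)]])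
      (use rad0_pos in auto)
  moreover have "log_rate (\<lambda>u. \<rho> (A (x0, u), u)) t = radius_rate x0 / \<rho> (a0, t)"
    using DERIV_imp_deriv[OF radius_rate[OF x0(1)]] by (simp add: log_rate_def)
  moreover have "(radius_rate x0 + radius_rate x0) / (\<rho> (a0, t) + \<rho> (a0, t)) = radius_rate x0 / \<rho> (a0, t)"
    using rad0_pos by (simp add: field_simps)
  ultimately show "?g \<longlonglongrightarrow> log_rate (\<lambda>u. \<rho> (A (x0, u), u)) t" by simp
qed

end

text \<open>Both iterated limits are unique, so that equality of the two sides passes to the limits.\<close>
lemma equations_convergeI:
  assumes "continuum_limit l L" "continuum_limit r R"
  shows "equations_converge l r L R"
  unfolding equations_converge_def
proof (intro conjI impI assms)
  assume eq: "\<forall>\<^sub>F N in sequentially. \<forall>\<^sub>F \<xi> in at_right 0. l N \<xi> = r N \<xi>"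
  from assms obtain g g' where g: "\<forall>\<^sub>F N in sequentially. (l N \<rightarrow>\<^sub>0 g N)" "g \<longlonglongrightarrow> L"
    and g': "\<forall>\<^sub>F N in sequentially. (r N \<rightarrow>\<^sub>0 g' N)" "g' \<longlonglongrightarrow> R"
    unfolding continuum_limit_def by blast
  have "\<forall>\<^sub>F N in sequentially. g N = g' N"
    using eq g(1) g'(1)
  proof eventually_elim
    case (elim N)
    then have "l N \<rightarrow>\<^sub>0 g' N" using tendsto_cong by blast
    with elim(2) show ?case by (intro tendsto_unique[OF trivial_limit_at_right_real])
  qed
  then have "g \<longlonglongrightarrow> R" by (rule tendsto_eventually_eq[OF g'(2) _ refl])
  with g(2) show "L = R" by (rule LIMSEQ_unique)
qed

theorem theorem1:
  fixes A \<rho> :: "real \<times> real \<Rightarrow> real"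
    and xl xr x0 t K :: real
    and J :: "real set"
    and x :: "nat \<Rightarrow> nat \<Rightarrow> real"
    and i :: "nat \<Rightarrow> nat"
    and F :: "nat \<Rightarrow> real \<Rightarrow> real \<Rightarrow> frustum_lattice"
  assumes "warped_geometry xl xr J A \<rho>" and "t \<in> J"
    and "\<And>N j. j \<in> {1..N} \<Longrightarrow> x N j \<in> {xl<..<xr}"
    and "\<And>N j. j \<in> {1..<N} \<Longrightarrow> x N j < x N (j + 1)"
    and "(\<lambda>N. x N 1) \<longlonglongrightarrow> xl" and "(\<lambda>N. x N N) \<longlonglongrightarrow> xr"
    and "\<And>N. nearly_equally_spaced K N (\<lambda>j. A (x N j, t))"
    and "\<And>N \<xi> \<tau>. 0 < \<xi> \<Longrightarrow> \<tau> \<in> J \<Longrightarrow>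
           approximates (F N \<xi> \<tau>) N \<xi> (\<lambda>j. A (x N j, \<tau>)) (\<lambda>a. \<rho> (a, \<tau>))"
    and "\<And>N. 2 \<le> N \<Longrightarrow> i N \<in> {1..<N}"
    and "x0 \<in> {xl<..<xr}" and "(\<lambda>N. x N (i N)) \<longlonglongrightarrow> x0"
  shows "let a0 = A (x0, t);
             r = \<rho> (a0, t);
             r' = deriv (\<lambda>a. \<rho> (a, t)) a0;
             r'' = deriv (deriv (\<lambda>a. \<rho> (a, t))) a0
         in equations_converge
              (\<lambda>N \<xi>. log_rate (\<lambda>\<tau>. dual_sigma (F N \<xi> \<tau>) (i N)) t)
              (\<lambda>N \<xi>. - Rc_sigma (F N \<xi> t) (i N))
              (log_rate (\<lambda>\<tau>. \<rho> (A (x0, \<tau>), \<tau>)) t)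
              (r'' / r + (r' / r)\<^sup>2 - 1 / r\<^sup>2)
          \<and> equations_converge
              (\<lambda>N \<xi>. log_rate (\<lambda>\<tau>. dual_alpha (F N \<xi> \<tau>) (i N)) t)
              (\<lambda>N \<xi>. - Rc_alpha (F N \<xi> t) (i N))
              (log_rate (\<lambda>\<tau>. deriv (\<lambda>y. A (y, \<tau>)) x0) t)
              (2 * (r'' / r))"
proof -
  note geometry = assms(1)[unfolded warped_geometry_def]
  from geometry have "C2_on A ({xl<..<xr} \<times> J)" by blast
  from C2_on_partials[OF this] obtain DA D2A where
    "\<forall>z\<in>{xl<..<xr} \<times> J. (A has_derivative DA z) (at z)"
    "\<forall>z\<in>{xl<..<xr} \<times> J. \<forall>v. ((\<lambda>w. DA w v) has_derivative (\<lambda>u. D2A z u v)) (at z)"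
    "\<forall>u v. continuous_on ({xl<..<xr} \<times> J) (\<lambda>z. D2A z u v)"
    by blast
  note DA = this[rule_format]
  let ?S = "(\<lambda>(x, u). (A (x, u), u)) ` ({xl<..<xr} \<times> J)"
  from geometry have "C2_on \<rho> ?S" by blast
  from C2_on_partials[OF this] obtain DR D2R where
    "\<forall>z\<in>?S. (\<rho> has_derivative DR z) (at z)"
    "\<forall>z\<in>?S. \<forall>v. ((\<lambda>w. DR w v) has_derivative (\<lambda>u. D2R z u v)) (at z)"
    "\<forall>u v. continuous_on ?S (\<lambda>z. D2R z u v)"
    by blast
  note DR = this[rule_format]
  interpret lattice_sequence A \<rho> DA DR D2A D2R xl xr t J x0 K x i F
  proof unfold_locales
    show "open J" using geometry by blast
    show "0 < deriv (\<lambda>y. A (y, u)) z" if "z \<in> {xl<..<xr}" "u \<in> J" for z u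
      using geometry that by blast
    show "bounded ((\<lambda>x. A (x, t)) ` {xl<..<xr})"
      using geometry assms(2) by blast
    show "0 < \<rho> (A (z, u), u)" if "z \<in> {xl<..<xr}" "u \<in> J" for z u
      using geometry that by blast
    show "x N k < x N (Suc k)" if "k \<in> {1..<N}" for N k
      using assms(4)[OF that] by simp
  qed (fact assms DA DR)+
  show ?thesis
    unfolding Let_def profile_deriv[OF x0(1)]
    by (intro conjI equations_convergeI sigma_rate_continuum Rc_sigma_continuum
        alpha_rate_continuum Rc_alpha_continuum)
qed

end
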